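(* Let $0<\beta<\beta_f(\xi)$ and let $h=h_N=\rho N^{-\alpha}$ with $\rho>0$ and $\alpha\in[\tfrac14,\infty]$ ($\alpha=\infty$ meaning $h=0$). Then for all $N$ large $$\mathbb{E}\big[(\hat Z_N(\beta,h))^2\big]\le \frac{C}{\sqrt{\beta_f^2-\beta^2}}\exp\left(\frac{\rho^4\beta^2}{\beta_f^2-\beta^2}\right),\qquad \beta_f:=\beta_f(\xi),$$ where $C>0$ is a universal constant. In particular, $$\frac1N\log Z_N(\beta)\to \frac12\beta^2\xi(1)\quad\text{in probability as }N\to\infty.$$
   Context: Mixed $p$-spin model. For $p\ge2$ let $\mathcal E_{N,p}$ be the set of $p$-tuples $\boldsymbol i=(i_1,\dots,i_p)$ with $1\le i_1<\cdots<i_p\le N$, and for $\sigma\in\{-1,+1\}^N$ put $\sigma_{\boldsymbol i}=\prod_{j=1}^p\sigma_{i_j}$. The variables $(J_{\boldsymbol i})_{\boldsymbol i\in\cup_{p\ge2}\mathcal E_{N,p}}$ are i.i.d., symmetrically distributed with mean zero, variance one and finite fourth moment. The coefficients $(\theta_p)_{p\ge2}$ satisfy $\sum_{p\ge2}\theta_p^2/(p-2)!<\infty$. The Hamiltonian is $$H_N(\sigma)=\sum_{p\ge2}\frac{\theta_p}{N^{(p-1)/2}}\sum_{\boldsymbol i\in\mathcal E_{N,p}}J_{\boldsymbol i}\sigma_{\boldsymbol i},$$ the partition function is $Z_N(\beta,h)=\sum_{\sigma\in\{-1,+1\}^N}e^{\beta H_N(\sigma)+h\sum_i\sigma_i}$,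 written $Z_N(\beta)$ when the dependence on $h$ is suppressed, and $$\hat Z_N(\beta,h)=\mathbb E_h\prod_{p\ge2}\prod_{\boldsymbol i\in\mathcal E_{N,p}}\big(1+\sigma_{\boldsymbol i}\tanh(\beta\theta_pJ_{\boldsymbol i}/N^{(p-1)/2})\big),$$ where under $\mathbb E_h$ the $\sigma_i$ are i.i.d. $\pm1$ valued (independent of $J$) with $\mathbb P_h(\sigma_i=\pm1)=e^{\pm h}/(e^h+e^{-h})$. One has $Z_N(\beta,h)=(2\cosh h)^N\,\bar Z_N(\beta)\,\hat Z_N(\beta,h)$ with $\bar Z_N(\beta)=\prod_{p\ge2}\prod_{\boldsymbol i\in\mathcal E_{N,p}}\cosh(\beta\theta_pJ_{\boldsymbol i}/N^{(p-1)/2})$. Structure function: $\xi(x)=\sum_{p\ge2}\frac{\theta_p^2}{p!}x^p$ for $x\in[-1,1]$. Binary entropy function: $I(x)=\frac12(1+x)\log(1+x)+\frac12(1-x)\log(1-x)$. Critical value: $\beta_f(\xi)=\min_{x\in(0,1)}\sqrt{I(x)/\xi(x)}$.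
   Formalization: C may depend on β_f(ξ) (a universal C fails under rescaling θ, β, since E[Ẑ²] ≥ 1); the limit of (1/N) log Z_N is log 2 + β²ξ(1)/2, as Z_N is an unnormalised sum over 2^N configurations; the minimum defining β_f is an infimum, as it need not be attained. *)

theory Defs
  imports "HOL-Probability.Probability"
begin

definition tuples :: "nat \<Rightarrow> nat \<Rightarrow> nat list set" where
  "tuples N p = {i. length i = p \<and> sorted_wrt (<) i \<and> set i \<subseteq> {1..N}}"

definition all_tuples :: "nat list set" where
  "all_tuples = (\<Union>N. \<Union>p\<in>{2..}. tuples N p)"

lemma tuples_empty:
  assumes "N < p"
  shows "tuples N p = {}"
proof (rule ccontr)
  assume "tuples N p \<noteq> {}"
  then obtain i where i: "length i = p" "sorted_wrt (<) i" "set i \<subseteq> {1..N}"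
    by (auto simp: tuples_def)
  have "distinct i"
    using i(2) by (simp add: strict_sorted_iff)
  then have "p = card (set i)"
    using i(1) by (simp add: distinct_card)
  also have "\<dots> \<le> N"
    using card_mono[OF _ i(3)] by simp
  finally show False
    using assms by simp
qed

definition spin_prod :: "(nat \<Rightarrow> real) \<Rightarrow> nat list \<Rightarrow> real" where
  "spin_prod \<sigma> i = (\<Prod>j<length i. \<sigma> (i ! j))"

definition configs :: "nat \<Rightarrow> (nat \<Rightarrow> real) set" where
  "configs N = (\<Pi>\<^sub>E k\<in>{1..N}. {-1, 1})"

text \<open>The coefficients \<open>\<theta> 0\<close> and \<open>\<theta> 1\<close> are never used; sums over \<open>p \<ge> 2\<close> to infinity are
  written with \<open>p = k + 2\<close>.\<close>

locale mixed_p_spin = prob_space M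
  for M :: "'a measure"
  and J :: "nat list \<Rightarrow> 'a \<Rightarrow> real"
  and \<theta> :: "nat \<Rightarrow> real" +
  assumes J_indep: "indep_vars (\<lambda>_. borel) J all_tuples"
    and J_ident: "\<lbrakk>i \<in> all_tuples; j \<in> all_tuples\<rbrakk> \<Longrightarrow> distr M borel (J i) = distr M borel (J j)"
    and J_symmetric: "i \<in> all_tuples \<Longrightarrow> distr M borel (\<lambda>\<omega>. - J i \<omega>) = distr M borel (J i)"
    and J_mean: "i \<in> all_tuples \<Longrightarrow> expectation (J i) = 0"
    and J_variance: "i \<in> all_tuples \<Longrightarrow> variance (J i) = 1"
    and J_fourth_moment: "i \<in> all_tuples \<Longrightarrow> integrable M (\<lambda>\<omega>. J i \<omega> ^ 4)"
    and theta_summable: "summable (\<lambda>k. (\<theta> (k + 2))\<^sup>2 / fact k)"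

text \<open>By \<open>tuples_empty\<close> only \<open>p \<le> N\<close> contributes at size \<open>N\<close>, so the sums and products over
  \<open>p \<ge> 2\<close> below run over \<open>{2..N}\<close>.\<close>

definition hamiltonian ::
    "(nat list \<Rightarrow> 'a \<Rightarrow> real) \<Rightarrow> (nat \<Rightarrow> real) \<Rightarrow> nat \<Rightarrow> 'a \<Rightarrow> (nat \<Rightarrow> real) \<Rightarrow> real" where
  "hamiltonian J \<theta> N \<omega> \<sigma> =
     (\<Sum>p=2..N. \<theta> p / real N powr ((real p - 1) / 2) *
        (\<Sum>i\<in>tuples N p. J i \<omega> * spin_prod \<sigma> i))"

definition partition_fun ::
    "(nat list \<Rightarrow> 'a \<Rightarrow> real) \<Rightarrow> (nat \<Rightarrow> real) \<Rightarrow> nat \<Rightarrow> real \<Rightarrow> real \<Rightarrow> 'a \<Rightarrow> real" where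
  "partition_fun J \<theta> N \<beta> h \<omega> =
     (\<Sum>\<sigma>\<in>configs N. exp (\<beta> * hamiltonian J \<theta> N \<omega> \<sigma> + h * (\<Sum>k=1..N. \<sigma> k)))"

definition spin_pmf :: "real \<Rightarrow> real pmf" where
  "spin_pmf h =
     map_pmf (\<lambda>b. if b then 1 else -1) (bernoulli_pmf (exp h / (exp h + exp (-h))))"

text \<open>The default value \<open>undefined\<close> makes this a distribution on \<open>configs N\<close>.\<close>

definition config_pmf :: "nat \<Rightarrow> real \<Rightarrow> (nat \<Rightarrow> real) pmf" where
  "config_pmf N h = Pi_pmf {1..N} undefined (\<lambda>_. spin_pmf h)"

definition Z_hat ::
    "(nat list \<Rightarrow> 'a \<Rightarrow> real) \<Rightarrow> (nat \<Rightarrow> real) \<Rightarrow> nat \<Rightarrow> real \<Rightarrow> real \<Rightarrow> 'a \<Rightarrow> real" where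
  "Z_hat J \<theta> N \<beta> h \<omega> =
     measure_pmf.expectation (config_pmf N h)
       (\<lambda>\<sigma>. \<Prod>p=2..N. \<Prod>i\<in>tuples N p.
          1 + spin_prod \<sigma> i * tanh (\<beta> * \<theta> p * J i \<omega> / real N powr ((real p - 1) / 2)))"

definition xi :: "(nat \<Rightarrow> real) \<Rightarrow> real \<Rightarrow> real" where
  "xi \<theta> x = (\<Sum>k. (\<theta> (k + 2))\<^sup>2 / fact (k + 2) * x ^ (k + 2))"

definition binary_entropy :: "real \<Rightarrow> real" where
  "binary_entropy x = (1 + x) * ln (1 + x) / 2 + (1 - x) * ln (1 - x) / 2"

text \<open>An infimum rather than a minimum: it need not be attained in the open interval. For
  \<open>\<xi> x = x\<^sup>2 / 2\<close> (the Sherrington--Kirkpatrick model) it is the limit at \<open>0\<close>. If \<open>\<xi>\<close> vanishes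
  identically, division by zero makes the value \<open>0\<close>, so no \<open>\<beta>\<close> satisfies
  \<open>0 < \<beta> < beta_f \<xi>\<close>.\<close>

definition beta_f :: "(real \<Rightarrow> real) \<Rightarrow> real" where
  "beta_f \<xi> = (INF x\<in>{0<..<1}. sqrt (binary_entropy x / \<xi> x))"

definition ext_field :: "real \<Rightarrow> ereal \<Rightarrow> nat \<Rightarrow> real" where
  "ext_field \<rho> \<alpha> N = (if \<alpha> = \<infinity> then 0 else \<rho> * real N powr (- real_of_ereal \<alpha>))"

definition tendsto_in_prob :: "'a measure \<Rightarrow> (nat \<Rightarrow> 'a \<Rightarrow> real) \<Rightarrow> real \<Rightarrow> bool" where
  "tendsto_in_prob M X c \<longleftrightarrow>
     (\<forall>\<epsilon>>0. (\<lambda>N. measure M {\<omega> \<in> space M. \<bar>X N \<omega> - c\<bar> > \<epsilon>}) \<longlonglongrightarrow> 0)"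

end

theory Submission
  imports Defs
begin

text \<open>
  Since the couplings are independent and symmetric, the second moment of \<open>Z_hat\<close> is an average over two
  replicas in which only the signs \<open>\<tau> k = \<sigma> k * \<sigma>' k\<close> matter (\<open>second_moment_Z_hat\<close>). Its integrand is at
  most the exponential of \<open>N * \<beta>\<^sup>2 * \<xi> x\<close> up to lower order terms, where \<open>x\<close> is the mean of the signs, the
  overlap: the sum over \<open>p\<close>-tuples is an elementary symmetric polynomial of signs, which a recurrence
  (\<open>esym_recurrence\<close>) compares with the power \<open>x ^ p\<close>.

  Let \<open>r = \<beta>\<^sup>2 / \<beta>\<^sub>f\<^sup>2 < 1\<close>. By definition of \<open>\<beta>\<^sub>f\<close>, the exponent is at most about \<open>r * N * I x\<close>
  with the binary entropy \<open>I\<close>, while for vanishing fields the mean of \<open>exp (N * I x)\<close> grows slower than any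
  exponential in \<open>N\<close>, because \<open>exp (N * I x)\<close> is a likelihood ratio (\<open>overlap_expectation_exp_entropy\<close>). Overlaps away from \<open>0\<close> therefore contribute
  exponentially little. Near \<open>0\<close> only the quadratic part of \<open>\<xi>\<close> counts, the exponent is at most about
  \<open>r * (\<Sum>k. \<tau> k)\<^sup>2 / (2 * N)\<close>, and a Gaussian linearization with Hoeffding's lemma bounds its exponential
  moment by that of a Gaussian variable (\<open>overlap_expectation_exp_square\<close>). This gives the factor
  \<open>1 / sqrt (1 - r)\<close> and, from the mean \<open>(tanh h)\<^sup>2\<close> of the signs, the exponential in \<open>\<rho>^4\<close>
  (\<open>second_moment_bound\<close>).

  For the free energy write \<open>ln Z = N * ln (2 * cosh h) + ln Z_bar + ln Z_hat\<close>. The mean of \<open>ln Z_bar\<close> is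
  computed by expanding \<open>ln cosh\<close>. As \<open>Z_hat\<close> has mean \<open>1\<close>, it is not exponentially large, by Markov's
  inequality, but the second moment only shows that it exceeds \<open>1/2\<close> with a probability bounded away from
  \<open>0\<close>. What closes the gap is concentration: \<open>ln Z\<close> and \<open>ln Z_bar\<close> are Lipschitz functions of each
  coupling variable, hence have variance of order \<open>N\<close> by an inequality of Efron--Stein type
  (\<open>coord_lipschitz_variance\<close>), and a typical point of the event where \<open>Z_hat\<close> exceeds \<open>1/2\<close> determines
  the mean of \<open>ln Z\<close> up to \<open>o(N)\<close> (\<open>expectation_free_energy_near\<close>).
\<close>

section \<open>Elementary inequalities\<close>

lemma abs_tanh_le: "\<bar>tanh y\<bar> \<le> \<bar>y\<bar>" for y :: real
proof -
  have pos: "tanh z \<le> z" if "0 \<le> z" for z :: real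
  proof -
    have "(\<lambda>x. x - tanh x) 0 \<le> (\<lambda>x. x - tanh x) z"
    proof (rule DERIV_nonneg_imp_nondecreasing[OF that])
      fix x :: real
      have "cosh x \<noteq> 0" using cosh_real_pos[of x] by linarith
      then have "((\<lambda>x. x - tanh x) has_real_derivative (tanh x)\<^sup>2) (at x)"
        by (auto intro!: derivative_eq_intros)
      then show "\<exists>d. ((\<lambda>x. x - tanh x) has_real_derivative d) (at x) \<and> 0 \<le> d"
        by (intro exI[of _ "(tanh x)\<^sup>2"]) auto
    qed
    then show ?thesis by simp
  qed
  have "\<bar>tanh y\<bar> = tanh \<bar>y\<bar>" by simp
  then show ?thesis using pos[of "\<bar>y\<bar>"] by simp
qed

lemma tanh_sq_le: "(tanh y)\<^sup>2 \<le> y\<^sup>2" for y :: real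
  using abs_tanh_le[of y] by (simp add: abs_le_square_iff)

lemma abs_tanh_le_1: "\<bar>tanh x\<bar> \<le> 1" for x :: real
  using tanh_real_bounds[of x] by (auto simp: abs_le_iff)

lemma tanh_sq_le_1: "(tanh x)\<^sup>2 \<le> 1" for x :: real
  using abs_tanh_le_1[of x] by (simp add: abs_square_le_1)

lemma cosh_sq_ge: "1 + y\<^sup>2 \<le> (cosh y)\<^sup>2" for y :: real
proof -
  have pos: "z \<le> sinh z" if "0 \<le> z" for z :: real
  proof -
    have "(\<lambda>x. sinh x - x) 0 \<le> (\<lambda>x. sinh x - x) z"
    proof (rule DERIV_nonneg_imp_nondecreasing[OF that])
      fix x :: real
      have "((\<lambda>x. sinh x - x) has_real_derivative (cosh x - 1)) (at x)"
        by (auto intro!: derivative_eq_intros)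
      then show "\<exists>d. ((\<lambda>x. sinh x - x) has_real_derivative d) (at x) \<and> 0 \<le> d"
        using cosh_real_ge_1[of x] by (intro exI[of _ "cosh x - 1"]) auto
    qed
    then show ?thesis by simp
  qed
  have "\<bar>y\<bar>\<^sup>2 \<le> (sinh \<bar>y\<bar>)\<^sup>2" by (intro power_mono pos) auto
  then show ?thesis by (simp add: cosh_square_eq)
qed

lemma tanh_sq_ge: "y\<^sup>2 - y^4 \<le> (tanh y)\<^sup>2" for y :: real
proof -
  have "(tanh y)\<^sup>2 = 1 - 1 / (cosh y)\<^sup>2"
    using cosh_real_pos[of y] by (simp add: tanh_def power_divide sinh_square_eq field_simps)
  also have "\<dots> \<ge> 1 - 1 / (1 + y\<^sup>2)"
    using cosh_sq_ge[of y] by (intro diff_left_mono divide_left_mono) (auto intro!: mult_pos_pos add_pos_nonneg)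
  also have "1 - 1 / (1 + y\<^sup>2) \<ge> y\<^sup>2 - y^4"
  proof -
    have "0 < 1 + y\<^sup>2" by (auto intro!: add_pos_nonneg)
    moreover have "(y\<^sup>2 - y^4) * (1 + y\<^sup>2) \<le> y\<^sup>2"
    proof -
      have "(y\<^sup>2 - y^4) * (1 + y\<^sup>2) = y\<^sup>2 - (y^3)\<^sup>2" by algebra
      then show ?thesis by simp
    qed
    ultimately show ?thesis by (simp add: field_simps)
  qed
  finally show ?thesis .
qed

text \<open>Hoeffding's lemma for a sign with mean \<open>m\<close>.\<close>

lemma biased_sign_mgf_le:
  fixes m u :: real
  assumes "\<bar>m\<bar> \<le> 1"
  shows "cosh u + m * sinh u \<le> exp (m * u + u\<^sup>2 / 2)"
proof -
  have pos: "cosh v + l * sinh v \<le> exp (l * v + v\<^sup>2 / 2)"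
    if "\<bar>l\<bar> \<le> 1" "v \<ge> 0" for l v :: real
  proof -
    define q where "q = (1 + l) / 2"
    have q: "0 \<le> q" using that by (simp add: q_def abs_if split: if_splits)
    have l: "l = 2 * q - 1" by (simp add: q_def field_simps)
    have e: "exp (2 * v) - 1 \<ge> 0" using that by simp
    have p: "1 + q * (exp (2 * v) - 1) > 0"
      using q e by (intro add_pos_nonneg mult_nonneg_nonneg) auto
    have "- (2 * v) * q + ln (1 + q * (exp (2 * v) - 1)) \<le> (2 * v)\<^sup>2 / 8"
      using Hoeffdings_lemma_aux[of "2 * v" q] that q by simp
    then have "ln (1 + q * (exp (2 * v) - 1)) \<le> 2 * v * q + v\<^sup>2 / 2"
      by (simp add: power2_eq_square)
    then have "1 + q * (exp (2 * v) - 1) \<le> exp (2 * v * q + v\<^sup>2 / 2)"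
      using p by (metis exp_le_cancel_iff exp_ln)
    then have "exp (- v) * (1 + q * (exp (2 * v) - 1)) \<le> exp (- v) * exp (2 * v * q + v\<^sup>2 / 2)"
      by simp
    also have "\<dots> = exp (l * v + v\<^sup>2 / 2)"
      by (simp add: exp_add[symmetric] l algebra_simps)
    also have "exp (- v) * (1 + q * (exp (2 * v) - 1)) = cosh v + l * sinh v"
    proof -
      have "exp (- v) * exp (2 * v) = exp v" by (simp add: exp_add[symmetric])
      then have "exp (- v) * (1 + q * (exp (2 * v) - 1)) = exp (- v) * (1 - q) + q * exp v"
        by (simp add: algebra_simps)
      also have "\<dots> = cosh v + l * sinh v"
        by (simp add: cosh_def sinh_def l field_simps)
      finally show ?thesis .
    qed
    finally show ?thesis .
  qed
  show ?thesis
  proof (cases "u \<ge> 0")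
    case True then show ?thesis using pos assms by simp
  next
    case False then show ?thesis using pos[of "- m" "- u"] assms by simp
  qed
qed

lemma ln_cosh_le: "ln (cosh y) \<le> y\<^sup>2 / 2" for y :: real
  using biased_sign_mgf_le[of 0 y] cosh_real_pos[of y]
  by (simp add: ln_le_cancel_iff[symmetric] del: ln_le_cancel_iff)

lemma ln_cosh_ge: "y\<^sup>2 / 2 - y^4 / 2 \<le> ln (cosh y)" for y :: real
proof -
  have "y\<^sup>2 - y^4 \<le> ln (1 + y\<^sup>2)"
  proof (cases "y\<^sup>2 \<le> 1")
    case True
    have "y\<^sup>2 - (y\<^sup>2)\<^sup>2 \<le> ln (1 + y\<^sup>2)"
      using ln_one_plus_pos_lower_bound[of "y\<^sup>2"] True by simp
    then show ?thesis by simp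
  next
    case False
    then have "y\<^sup>2 * 1 \<le> y\<^sup>2 * y\<^sup>2" by (intro mult_left_mono) auto
    then have "y\<^sup>2 - y^4 \<le> 0" by (simp add: power2_eq_square power4_eq_xxxx mult.assoc)
    also have "0 \<le> ln (1 + y\<^sup>2)" by simp
    finally show ?thesis .
  qed
  also have "\<dots> \<le> ln ((cosh y)\<^sup>2)"
    using cosh_sq_ge[of y] by (subst ln_le_cancel_iff) (auto intro!: add_pos_nonneg)
  also have "\<dots> = 2 * ln (cosh y)" using cosh_real_pos[of y] by (simp add: ln_realpow)
  finally show ?thesis by simp
qed

lemma ln_cosh_nonneg: "0 \<le> ln (cosh y)" for y :: real
  using cosh_real_ge_1[of y] by simp

section \<open>The binary entropy function\<close>

lemma binary_entropy_minus [simp]: "binary_entropy (- x) = binary_entropy x"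
  by (simp add: binary_entropy_def)

lemma binary_entropy_abs [simp]: "binary_entropy \<bar>x\<bar> = binary_entropy x"
  by (simp add: abs_if)

text \<open>Any positive multiple of \<open>x\<^sup>2\<close> serves: it makes overlaps away from \<open>0\<close> exponentially unlikely.\<close>

lemma binary_entropy_ge:
  assumes "\<bar>x\<bar> \<le> 1"
  shows "x\<^sup>2 / 6 \<le> binary_entropy x"
proof -
  define y where "y = \<bar>x\<bar>"
  have y: "0 \<le> y" "y \<le> 1" using assms by (auto simp: y_def)
  have "(\<lambda>t. ln (1 + t) - 2 * t / (2 + t)) 0 \<le> (\<lambda>t. ln (1 + t) - 2 * t / (2 + t)) y"
  proof (rule DERIV_nonneg_imp_nondecreasing[OF y(1)])
    fix t :: real assume t: "0 \<le> t" "t \<le> y"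
    have "((\<lambda>t. ln (1 + t) - 2 * t / (2 + t)) has_real_derivative
            (1 / (1 + t) - 4 / (2 + t)\<^sup>2)) (at t)"
      using t by (auto intro!: derivative_eq_intros simp: power2_eq_square)
    moreover have "1 / (1 + t) - 4 / (2 + t)\<^sup>2 = t\<^sup>2 / ((1 + t) * (2 + t)\<^sup>2)"
      using t by (simp add: divide_simps) (simp add: power2_eq_square algebra_simps)
    ultimately show "\<exists>d. ((\<lambda>t. ln (1 + t) - 2 * t / (2 + t)) has_real_derivative d) (at t) \<and> 0 \<le> d"
      using t by (intro exI[of _ "t\<^sup>2 / ((1 + t) * (2 + t)\<^sup>2)"]) auto
  qed
  then have "2 * y / (2 + y) \<le> ln (1 + y)" by simp
  then have "(1 + y) * (2 * y / (2 + y)) \<le> (1 + y) * ln (1 + y)"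
    using y by (intro mult_left_mono) auto
  moreover have "- y \<le> (1 - y) * ln (1 - y)"
  proof (cases "y = 1")
    case False
    have "1 - inverse (1 - y) \<le> ln (1 - y)"
      using ln_add_one_self_le_self2[of "inverse (1 - y) - 1"] y False by (simp add: ln_inverse)
    then have "(1 - y) * (1 - inverse (1 - y)) \<le> (1 - y) * ln (1 - y)"
      using y by (intro mult_left_mono) auto
    moreover have "(1 - y) * (1 - inverse (1 - y)) = - y"
      using False by (simp add: right_diff_distrib)
    ultimately show ?thesis by simp
  qed simp
  moreover have "y\<^sup>2 / 3 \<le> (1 + y) * (2 * y / (2 + y)) - y"
  proof -
    have "(1 + y) * (2 * y / (2 + y)) - y = y\<^sup>2 / (2 + y)"
      using y by (simp add: divide_simps) (simp add: power2_eq_square algebra_simps)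
    moreover have "y\<^sup>2 / 3 \<le> y\<^sup>2 / (2 + y)" using y by (intro divide_left_mono) auto
    ultimately show ?thesis by simp
  qed
  ultimately have "y\<^sup>2 / 6 \<le> binary_entropy y"
    by (simp add: binary_entropy_def)
  then show ?thesis by (simp add: y_def)
qed

text \<open>Here the coefficient of \<open>x\<^sup>2\<close> is sharp. It turns the inequality between entropy and structure function
  into a bound on \<open>\<theta> 2\<close>.\<close>

lemma binary_entropy_le:
  assumes "0 \<le> x" "x < 1"
  shows "binary_entropy x \<le> x\<^sup>2 / 2 + x^3 / 3"
proof -
  have "(\<lambda>t. t - t\<^sup>2/2 + t^3/3 - ln (1 + t)) 0 \<le> (\<lambda>t. t - t\<^sup>2/2 + t^3/3 - ln (1 + t)) x"
  proof (rule DERIV_nonneg_imp_nondecreasing[OF assms(1)])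
    fix t :: real assume t: "0 \<le> t" "t \<le> x"
    have "((\<lambda>t. t - t\<^sup>2/2 + t^3/3 - ln (1 + t)) has_real_derivative
            (1 - t + t\<^sup>2 - 1 / (1 + t))) (at t)"
      using t by (auto intro!: derivative_eq_intros simp: power2_eq_square)
    moreover have "1 - t + t\<^sup>2 - 1 / (1 + t) = t^3 / (1 + t)"
      using t by (simp add: divide_simps) (simp add: power2_eq_square power3_eq_cube algebra_simps)
    ultimately show "\<exists>d. ((\<lambda>t. t - t\<^sup>2/2 + t^3/3 - ln (1 + t)) has_real_derivative d) (at t) \<and> 0 \<le> d"
      using t by (intro exI[of _ "t^3 / (1 + t)"]) auto
  qed
  then have a: "ln (1 + x) \<le> x - x\<^sup>2/2 + x^3/3" by simp
  have "(\<lambda>t. - t - t\<^sup>2/2 - ln (1 - t)) 0 \<le> (\<lambda>t. - t - t\<^sup>2/2 - ln (1 - t)) x"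
  proof (rule DERIV_nonneg_imp_nondecreasing[OF assms(1)])
    fix t :: real assume t: "0 \<le> t" "t \<le> x"
    have t1: "t < 1" using t assms by simp
    have "((\<lambda>t. - t - t\<^sup>2/2 - ln (1 - t)) has_real_derivative
            (- 1 - t + 1 / (1 - t))) (at t)"
      using t t1 by (auto intro!: derivative_eq_intros)
    moreover have "- 1 - t + 1 / (1 - t) = t\<^sup>2 / (1 - t)"
      using t1 by (simp add: divide_simps) (simp add: power2_eq_square algebra_simps)
    ultimately show "\<exists>d. ((\<lambda>t. - t - t\<^sup>2/2 - ln (1 - t)) has_real_derivative d) (at t) \<and> 0 \<le> d"
      using t t1 by (intro exI[of _ "t\<^sup>2 / (1 - t)"]) auto
  qed
  then have b: "ln (1 - x) \<le> - x - x\<^sup>2/2" by simp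
  have "binary_entropy x \<le> (1 + x) * (x - x\<^sup>2/2 + x^3/3) / 2 + (1 - x) * (- x - x\<^sup>2/2) / 2"
    unfolding binary_entropy_def using a b assms
    by (intro add_mono divide_right_mono mult_left_mono) auto
  also have "\<dots> = x\<^sup>2 / 2 + x^3 / 6 + x^4 / 6"
    by (simp add: field_simps power2_eq_square power3_eq_cube power4_eq_xxxx)
  also have "x^4 \<le> x^3" using assms by (intro power_decreasing) auto
  finally show ?thesis by simp
qed

lemma binary_entropy_le_1:
  assumes "0 \<le> x" "x < 1"
  shows "binary_entropy x \<le> binary_entropy 1"
proof -
  have "(1 + x) * ln (1 + x) \<le> 2 * ln 2"
    using assms by (intro mult_mono) auto
  moreover have "(1 - x) * ln (1 - x) \<le> 0"
    using assms by (intro mult_nonneg_nonpos) auto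
  ultimately show ?thesis by (simp add: binary_entropy_def)
qed

section \<open>Elementary symmetric polynomials of signs\<close>

definition esym :: "(nat \<Rightarrow> real) \<Rightarrow> nat \<Rightarrow> nat \<Rightarrow> real" where
  "esym \<tau> N p = (\<Sum>i\<in>tuples N p. spin_prod \<tau> i)"

lemma tuples_0: "tuples N 0 = {[]}"
  by (auto simp: tuples_def)

lemma finite_tuples: "finite (tuples N p)"
proof -
  have "tuples N p \<subseteq> {i. set i \<subseteq> {1..N} \<and> length i = p}" by (auto simp: tuples_def)
  then show ?thesis using finite_lists_length_eq[of "{1..N}" p] finite_subset by auto
qed

lemma tuples_Suc:
  "tuples (Suc N) (Suc p) = tuples N (Suc p) \<union> (\<lambda>i. i @ [Suc N]) ` tuples N p"
proof (intro equalityI subsetI)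
  fix i assume i: "i \<in> tuples (Suc N) (Suc p)"
  then obtain j k where jk: "i = j @ [k]" "length j = p"
    by (auto simp: tuples_def length_Suc_conv_rev)
  have s: "sorted_wrt (<) j" "\<forall>l\<in>set j. l < k" "k \<in> {1..Suc N}" "set j \<subseteq> {1..Suc N}"
    using i jk by (auto simp: tuples_def sorted_wrt_append)
  show "i \<in> tuples N (Suc p) \<union> (\<lambda>i. i @ [Suc N]) ` tuples N p"
  proof (cases "k = Suc N")
    case True
    then have "j \<in> tuples N p" using s jk by (fastforce simp: tuples_def)
    then show ?thesis using True jk by auto
  next
    case False
    then have "i \<in> tuples N (Suc p)" using s jk by (fastforce simp: tuples_def sorted_wrt_append)
    then show ?thesis by simp
  qed
next
  fix i assume "i \<in> tuples N (Suc p) \<union> (\<lambda>i. i @ [Suc N]) ` tuples N p"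
  then show "i \<in> tuples (Suc N) (Suc p)"
    by (fastforce simp: tuples_def sorted_wrt_append)
qed

lemma spin_prod_append: "spin_prod \<tau> (i @ [k]) = \<tau> k * spin_prod \<tau> i"
  by (simp add: spin_prod_def nth_append)

lemma esym_0 [simp]: "esym \<tau> N 0 = 1"
  by (simp add: esym_def tuples_0 spin_prod_def)

lemma esym_0_Suc [simp]: "esym \<tau> 0 (Suc p) = 0"
  by (simp add: esym_def tuples_empty)

lemma esym_Suc_Suc:
  "esym \<tau> (Suc N) (Suc p) = esym \<tau> N (Suc p) + \<tau> (Suc N) * esym \<tau> N p"
proof -
  have disj: "tuples N (Suc p) \<inter> (\<lambda>i. i @ [Suc N]) ` tuples N p = {}"
    by (auto simp: tuples_def)
  have "esym \<tau> (Suc N) (Suc p)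
      = esym \<tau> N (Suc p) + (\<Sum>i\<in>(\<lambda>i. i @ [Suc N]) ` tuples N p. spin_prod \<tau> i)"
    unfolding esym_def tuples_Suc using disj
    by (intro sum.union_disjoint) (auto simp: finite_tuples)
  also have "(\<Sum>i\<in>(\<lambda>i. i @ [Suc N]) ` tuples N p. spin_prod \<tau> i) = \<tau> (Suc N) * esym \<tau> N p"
    by (subst sum.reindex) (auto simp: inj_on_def spin_prod_append esym_def sum_distrib_left)
  finally show ?thesis .
qed

lemma esym_1: "esym \<tau> N (Suc 0) = (\<Sum>k=1..N. \<tau> k)"
  by (induction N) (simp_all add: esym_Suc_Suc)

lemma card_tuples: "card (tuples N p) = N choose p"
proof -
  have "real (card (tuples N p)) = esym (\<lambda>_. 1) N p"
    by (simp add: esym_def spin_prod_def)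
  also have "\<dots> = real (N choose p)"
  proof (induction N arbitrary: p)
    case 0 then show ?case by (cases p) auto
  next
    case (Suc N) then show ?case by (cases p) (auto simp: esym_Suc_Suc)
  qed
  finally show ?thesis by simp
qed

lemma abs_spin_prod:
  assumes "\<And>k. k \<in> {1..N} \<Longrightarrow> \<bar>\<tau> k\<bar> = 1" "i \<in> tuples N p"
  shows "\<bar>spin_prod \<tau> i\<bar> = 1"
proof -
  have "\<bar>\<tau> (i ! j)\<bar> = 1" if "j < length i" for j
    using assms that nth_mem[OF that] by (force simp: tuples_def)
  then show ?thesis by (simp add: spin_prod_def abs_prod)
qed

lemma abs_esym_le:
  assumes "\<And>k. k \<in> {1..N} \<Longrightarrow> \<bar>\<tau> k\<bar> = 1"
  shows "\<bar>esym \<tau> N p\<bar> \<le> real N ^ p / fact p"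
proof -
  have "\<bar>esym \<tau> N p\<bar> \<le> (\<Sum>i\<in>tuples N p. \<bar>spin_prod \<tau> i\<bar>)"
    unfolding esym_def by (rule sum_abs)
  also have "\<dots> = real (N choose p)"
    using abs_spin_prod[OF assms] by (simp add: card_tuples)
  also have "\<dots> \<le> real N ^ p / fact p"
  proof -
    have "real ((N choose p) * fact p) \<le> real (N ^ p)"
      using binomial_fact_pow[of N p] by (simp only: of_nat_le_iff)
    then show ?thesis by (simp add: field_simps)
  qed
  finally show ?thesis .
qed

text \<open>Multiplying \<open>esym \<tau> N (p + 1)\<close> by the sum of all the signs either adds an index to a monomial or, since
  squares of signs are \<open>1\<close>, cancels one.\<close>

lemma esym_recurrence:
  assumes "\<And>k. k \<in> {1..N} \<Longrightarrow> \<bar>\<tau> k\<bar> = 1"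
  shows "(\<Sum>k=1..N. \<tau> k) * esym \<tau> N (Suc p)
           = (real p + 2) * esym \<tau> N (p + 2) + (real N - real p) * esym \<tau> N p"
  using assms
proof (induction N arbitrary: p)
  case 0
  show ?case by (cases p) auto
next
  case (Suc N)
  define t where "t = \<tau> (Suc N)"
  define S where "S = (\<Sum>k=1..N. \<tau> k)"
  have "\<bar>t\<bar> = 1" using Suc.prems[of "Suc N"] by (simp add: t_def)
  then have tt: "t * t = 1" by (auto simp: abs_if split: if_splits)
  have IH: "S * esym \<tau> N (Suc p)
           = (real p + 2) * esym \<tau> N (p + 2) + (real N - real p) * esym \<tau> N p" for p
    unfolding S_def by (rule Suc.IH) (use Suc.prems in auto)
  have lhs: "(\<Sum>k=1..Suc N. \<tau> k) * esym \<tau> (Suc N) (Suc p)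
     = (S + t) * (esym \<tau> N (Suc p) + t * esym \<tau> N p)"
    by (simp add: S_def t_def esym_Suc_Suc)
  show ?case
  proof (cases p)
    case 0
    have S: "S = esym \<tau> N (Suc 0)" by (simp add: S_def esym_1)
    have "(S + t) * (esym \<tau> N (Suc 0) + t) = S * esym \<tau> N (Suc 0) + 2 * t * S + t * t"
      using S by (simp add: algebra_simps)
    also have "\<dots> = 2 * (esym \<tau> N (Suc (Suc 0)) + t * esym \<tau> N (Suc 0)) + (real N + 1)"
      using IH[of 0] S tt by (simp add: algebra_simps)
    finally show ?thesis using lhs 0 by (simp add: esym_Suc_Suc t_def)
  next
    case (Suc q)
    have "(S + t) * (esym \<tau> N (Suc p) + t * esym \<tau> N p)
        = S * esym \<tau> N (Suc p) + t * esym \<tau> N (Suc p) + t * (S * esym \<tau> N (Suc q)) + (t * t) * esym \<tau> N p"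
      by (simp add: algebra_simps Suc)
    also have "\<dots> = (real p + 2) * (esym \<tau> N (p + 2) + t * esym \<tau> N (Suc p))
         + (real (Suc N) - real p) * (esym \<tau> N p + t * esym \<tau> N q)"
      unfolding IH tt by (simp add: Suc algebra_simps)
    finally show ?thesis using lhs by (simp add: Suc esym_Suc_Suc t_def)
  qed
qed

lemma esym_2_ge:
  assumes sign: "\<And>k. k \<in> {1..N} \<Longrightarrow> \<bar>\<tau> k\<bar> = 1"
  shows "- (real N / 2) \<le> esym \<tau> N 2"
proof -
  have "(\<Sum>k=1..N. \<tau> k) * esym \<tau> N (Suc 0)
           = (real 0 + 2) * esym \<tau> N (0 + 2) + (real N - real 0) * esym \<tau> N 0"
    by (rule esym_recurrence[of N \<tau> 0]) (use sign in auto)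
  then have "2 * esym \<tau> N 2 = (\<Sum>k=1..N. \<tau> k)\<^sup>2 - real N"
    by (simp add: esym_1 power2_eq_square numeral_2_eq_2)
  moreover have "0 \<le> (\<Sum>k=1..N. \<tau> k)\<^sup>2" by simp
  ultimately show ?thesis by linarith
qed

text \<open>A sum over ordered \<open>p\<close>-tuples without repetition, divided by the number \<open>N ^ p\<close> of all \<open>p\<close>-tuples. With
  repetitions allowed it would be the power \<open>x ^ p\<close> of the mean sign \<open>x\<close>.\<close>

definition nsym :: "(nat \<Rightarrow> real) \<Rightarrow> nat \<Rightarrow> nat \<Rightarrow> real" where
  "nsym \<tau> N p = esym \<tau> N p * fact p / real N ^ p"

context
  fixes \<tau> :: "nat \<Rightarrow> real" and N :: nat and x :: real
  assumes sign: "\<And>k. k \<in> {1..N} \<Longrightarrow> \<bar>\<tau> k\<bar> = 1"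
    and N: "0 < N"
  defines "x \<equiv> (\<Sum>k=1..N. \<tau> k) / real N"
begin

lemma abs_mean_sign_le: "\<bar>x\<bar> \<le> 1"
proof -
  have "\<bar>\<Sum>k=1..N. \<tau> k\<bar> \<le> (\<Sum>k=1..N. \<bar>\<tau> k\<bar>)" by (rule sum_abs)
  also have "\<dots> = real N" using sign by simp
  finally show ?thesis using N by (simp add: x_def)
qed

lemma abs_nsym_le: "\<bar>nsym \<tau> N p\<bar> \<le> 1"
proof -
  have "\<bar>esym \<tau> N p\<bar> * fact p \<le> real N ^ p"
    using abs_esym_le[of N \<tau>, OF sign, of p] by (simp add: field_simps)
  then show ?thesis using N by (simp add: nsym_def abs_mult divide_simps)
qed

lemma nsym_recurrence:
  "nsym \<tau> N (p + 2) = x * nsym \<tau> N (Suc p) - (real p + 1) * (real N - real p) / (real N)\<^sup>2 * nsym \<tau> N p"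
proof -
  have "(real p + 2) * esym \<tau> N (p + 2)
     = (x * real N) * esym \<tau> N (Suc p) - (real N - real p) * esym \<tau> N p"
    using esym_recurrence[of N \<tau>, OF sign, of p] N by (simp add: x_def)
  moreover have "nsym \<tau> N (p + 2) = (real p + 2) * esym \<tau> N (p + 2) * ((real p + 1) * fact p / real N ^ (p + 2))"
    by (simp add: nsym_def field_simps)
  moreover have "x * nsym \<tau> N (Suc p) = (x * real N) * esym \<tau> N (Suc p) * ((real p + 1) * fact p / real N ^ (p + 2))"
    using N by (simp add: nsym_def field_simps)
  moreover have "(real p + 1) * (real N - real p) / (real N)\<^sup>2 * nsym \<tau> N p
     = (real N - real p) * esym \<tau> N p * ((real p + 1) * fact p / real N ^ (p + 2))"
    using N by (simp add: nsym_def field_simps power2_eq_square)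
  ultimately show ?thesis by (simp add: left_diff_distrib diff_divide_distrib del: add_2_eq_Suc')
qed

lemma nsym_step: "\<bar>nsym \<tau> N (p + 2) - x * nsym \<tau> N (Suc p)\<bar> \<le> (real p + 1) / real N * \<bar>nsym \<tau> N p\<bar>"
proof (cases "p \<le> N")
  case True
  have "\<bar>nsym \<tau> N (p + 2) - x * nsym \<tau> N (Suc p)\<bar>
      = (real p + 1) * (real N - real p) / (real N)\<^sup>2 * \<bar>nsym \<tau> N p\<bar>"
    using True by (simp add: nsym_recurrence abs_mult del: add_2_eq_Suc')
  also have "\<dots> \<le> (real p + 1) * real N / (real N)\<^sup>2 * \<bar>nsym \<tau> N p\<bar>"
    using N by (intro mult_right_mono divide_right_mono mult_left_mono) auto
  finally show ?thesis using N by (simp add: power2_eq_square)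
next
  case False
  then have "nsym \<tau> N p = 0" by (simp add: nsym_def esym_def tuples_empty)
  then show ?thesis by (simp add: nsym_recurrence del: add_2_eq_Suc')
qed

lemma nsym_le: "\<bar>nsym \<tau> N (Suc p)\<bar> \<le> \<bar>x\<bar> + real p / real N"
proof (cases p)
  case 0
  then show ?thesis by (simp add: nsym_def esym_1 x_def)
next
  case (Suc q)
  have "\<bar>nsym \<tau> N (q + 2)\<bar> \<le> \<bar>x * nsym \<tau> N (Suc q)\<bar> + (real q + 1) / real N * \<bar>nsym \<tau> N q\<bar>"
    using nsym_step[of q] by linarith
  also have "\<dots> \<le> \<bar>x\<bar> * 1 + (real q + 1) / real N * 1"
    unfolding abs_mult by (intro add_mono mult_left_mono abs_nsym_le) auto
  finally show ?thesis by (simp add: Suc add.commute)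
qed

lemma nsym_power_step:
  "\<bar>nsym \<tau> N (p + 2) - x ^ (p + 2)\<bar>
     \<le> \<bar>x\<bar> * \<bar>nsym \<tau> N (Suc p) - x ^ Suc p\<bar> + (real p + 1) / real N * \<bar>nsym \<tau> N p\<bar>"
proof -
  have "nsym \<tau> N (p + 2) - x ^ (p + 2)
      = (nsym \<tau> N (p + 2) - x * nsym \<tau> N (Suc p)) + x * (nsym \<tau> N (Suc p) - x ^ Suc p)"
    by (simp add: algebra_simps)
  also have "\<bar>\<dots>\<bar> \<le> \<bar>nsym \<tau> N (p + 2) - x * nsym \<tau> N (Suc p)\<bar> + \<bar>x\<bar> * \<bar>nsym \<tau> N (Suc p) - x ^ Suc p\<bar>"
    unfolding abs_mult[symmetric] by (rule abs_triangle_ineq)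
  finally show ?thesis using nsym_step[of p] by linarith
qed

text \<open>The gap is at most the probability that one of the \<open>p * (p - 1) / 2\<close> pairs in a random \<open>p\<close>-tuple
  coincides. Multiplied by \<open>N * (\<theta> p)\<^sup>2 / fact p\<close>, it becomes the term of a convergent series.\<close>

lemma nsym_power: "\<bar>nsym \<tau> N p - x ^ p\<bar> \<le> real p * (real p - 1) / (2 * real N)"
proof (induction p rule: induct_nat_012)
  case (ge2 p)
  have "\<bar>nsym \<tau> N (p + 2) - x ^ (p + 2)\<bar>
     \<le> \<bar>x\<bar> * \<bar>nsym \<tau> N (Suc p) - x ^ Suc p\<bar> + (real p + 1) / real N * \<bar>nsym \<tau> N p\<bar>"
    by (rule nsym_power_step)
  also have "\<dots> \<le> 1 * (real (Suc p) * (real (Suc p) - 1) / (2 * real N)) + (real p + 1) / real N * 1"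
    using abs_mean_sign_le ge2 by (intro add_mono mult_mono abs_nsym_le) auto
  also have "\<dots> = real (Suc (Suc p)) * (real (Suc (Suc p)) - 1) / (2 * real N)"
    using N by (simp add: field_simps)
  finally show ?case by simp
qed (simp_all add: nsym_def esym_1 x_def)

text \<open>For \<open>p \<ge> 3\<close> both errors in the recurrence are small when \<open>x\<close> is: the gap at \<open>p - 1\<close> is multiplied by
  \<open>x\<close>, and \<open>nsym \<tau> N (p - 2)\<close> is itself small. For \<open>p = 2\<close> the latter is \<open>1\<close>.\<close>

lemma nsym_power_small:
  assumes "3 \<le> p"
  shows "\<bar>nsym \<tau> N p - x ^ p\<bar> \<le> real p * (real p - 1) / (2 * real N) * (\<bar>x\<bar> + real p / real N)"
proof -
  obtain q where q: "p = Suc q + 2" using assms by (metis Suc_eq_plus1 add.commute add_2_eq_Suc' le_Suc_ex numeral_3_eq_3 add_Suc_right add_Suc)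
  define P where "P = Suc q"
  have p: "p = P + 2" "P = Suc q" "1 \<le> P" by (auto simp: q P_def)
  have "\<bar>nsym \<tau> N p - x ^ p\<bar>
     \<le> \<bar>x\<bar> * \<bar>nsym \<tau> N (Suc P) - x ^ Suc P\<bar> + (real P + 1) / real N * \<bar>nsym \<tau> N P\<bar>"
    unfolding p(1) by (rule nsym_power_step)
  also have "\<dots> \<le> \<bar>x\<bar> * (real (Suc P) * (real (Suc P) - 1) / (2 * real N))
       + (real P + 1) / real N * (\<bar>x\<bar> + real q / real N)"
    using nsym_le[of q] unfolding p(2)
    by (intro add_mono mult_left_mono nsym_power) auto
  also have "\<dots> \<le> \<bar>x\<bar> * (real (Suc P) * (real (Suc P) - 1) / (2 * real N))
       + (real P + 1) / real N * (\<bar>x\<bar> + (real P + 2) / 2 * ((real P + 2) / real N))"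
  proof -
    have "real q * 1 \<le> (real P + 2) / 2 * (real P + 2)"
      by (simp add: p(2) field_simps)
    then have "real q / real N \<le> (real P + 2) / 2 * (real P + 2) / real N"
      by (intro divide_right_mono) auto
    then show ?thesis by (intro add_mono mult_left_mono) auto
  qed
  also have "\<dots> = real p * (real p - 1) / (2 * real N) * (\<bar>x\<bar> + real p / real N)"
    using N by (simp add: p field_simps)
  finally show ?thesis .
qed

end

section \<open>Spin configurations and overlaps of two replicas\<close>

definition spin_weight :: "real \<Rightarrow> real \<Rightarrow> real" where
  "spin_weight h s = exp (h * s) / (exp h + exp (- h))"

lemma spin_weight_nonneg: "0 \<le> spin_weight h s"
  by (simp add: spin_weight_def add_nonneg_nonneg)

lemma spin_weight_pos: "0 < spin_weight h s"
  by (simp add: spin_weight_def add_pos_pos)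

lemma pmf_spin:
  assumes "s \<in> {-1, 1}"
  shows "pmf (spin_pmf h) s = spin_weight h s"
proof -
  let ?p = "exp h / (exp h + exp (- h))"
  have pos: "0 < exp h + exp (- h)" by (simp add: add_pos_pos)
  have p: "0 \<le> ?p" "?p \<le> 1" using pos by simp_all
  have inj: "inj (\<lambda>b. if b then 1 else - 1 :: real)" by (auto simp: inj_def)
  have "pmf (spin_pmf h) (if b then 1 else - 1) = pmf (bernoulli_pmf ?p) b" for b
    unfolding spin_pmf_def by (rule pmf_map_inj'[OF inj])
  from this[of True] this[of False] show ?thesis
    using assms p pos by (auto simp: spin_weight_def field_simps)
qed

lemma set_spin_pmf: "set_pmf (spin_pmf h) \<subseteq> {-1, 1}"
  by (auto simp: spin_pmf_def)

lemma finite_configs: "finite (configs N)"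
  by (auto simp: configs_def intro!: finite_PiE)

lemma configs_values: "\<sigma> \<in> configs N \<Longrightarrow> k \<in> {1..N} \<Longrightarrow> \<sigma> k \<in> {-1, 1}"
  by (auto simp: configs_def)

lemma expectation_config:
  "measure_pmf.expectation (config_pmf N h) f
     = (\<Sum>\<sigma>\<in>configs N. (\<Prod>k=1..N. spin_weight h (\<sigma> k)) * f \<sigma>)" for f :: "_ \<Rightarrow> real"
proof -
  have "measure_pmf.expectation (config_pmf N h) f = (\<Sum>\<sigma>\<in>configs N. pmf (config_pmf N h) \<sigma> *\<^sub>R f \<sigma>)"
  proof (rule integral_measure_pmf[OF finite_configs])
    fix \<sigma> assume "\<sigma> \<in> set_pmf (config_pmf N h)"
    then have "\<sigma> \<in> PiE_dflt {1..N} undefined (set_pmf \<circ> (\<lambda>_. spin_pmf h))"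
      by (simp add: config_pmf_def set_Pi_pmf)
    then show "\<sigma> \<in> configs N"
      using set_spin_pmf[of h] by (fastforce simp: configs_def PiE_dflt_def PiE_iff extensional_def)
  qed
  also have "\<dots> = (\<Sum>\<sigma>\<in>configs N. (\<Prod>k=1..N. spin_weight h (\<sigma> k)) * f \<sigma>)"
  proof (rule sum.cong[OF refl])
    fix \<sigma> assume s: "\<sigma> \<in> configs N"
    have "pmf (config_pmf N h) \<sigma> = (\<Prod>k=1..N. pmf (spin_pmf h) (\<sigma> k))"
      unfolding config_pmf_def using s
      by (intro pmf_Pi') (auto simp: configs_def PiE_iff extensional_def)
    also have "\<dots> = (\<Prod>k=1..N. spin_weight h (\<sigma> k))"
      using configs_values[OF s] by (intro prod.cong pmf_spin) auto
    finally show "pmf (config_pmf N h) \<sigma> *\<^sub>R f \<sigma> = (\<Prod>k=1..N. spin_weight h (\<sigma> k)) * f \<sigma>" by simp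
  qed
  finally show ?thesis .
qed

text \<open>The two replicas enter the second moment only through the signs \<open>\<sigma> k * \<sigma>' k\<close>.\<close>

definition overlap_expectation :: "nat \<Rightarrow> real \<Rightarrow> ((nat \<Rightarrow> real) \<Rightarrow> real) \<Rightarrow> real" where
  "overlap_expectation N h F = (\<Sum>\<sigma>\<in>configs N. \<Sum>\<sigma>'\<in>configs N.
     (\<Prod>k=1..N. spin_weight h (\<sigma> k)) * (\<Prod>k=1..N. spin_weight h (\<sigma>' k)) * F (\<lambda>k. \<sigma> k * \<sigma>' k))"

lemma overlap_expectation_mono:
  assumes "\<And>\<tau>. (\<And>k. k \<in> {1..N} \<Longrightarrow> \<bar>\<tau> k\<bar> = 1) \<Longrightarrow> F \<tau> \<le> G \<tau>"
  shows "overlap_expectation N h F \<le> overlap_expectation N h G"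
  unfolding overlap_expectation_def
proof (intro sum_mono mult_left_mono assms mult_nonneg_nonneg prod_nonneg ballI spin_weight_nonneg)
  fix \<sigma> \<sigma>' k assume "\<sigma> \<in> configs N" "\<sigma>' \<in> configs N" "k \<in> {1..N}"
  then show "\<bar>\<sigma> k * \<sigma>' k\<bar> = 1" using configs_values[of \<sigma> N k] configs_values[of \<sigma>' N k]
    by (auto simp: abs_mult)
qed

lemma overlap_expectation_add:
  "overlap_expectation N h (\<lambda>\<tau>. F \<tau> + G \<tau>) = overlap_expectation N h F + overlap_expectation N h G"
  by (simp add: overlap_expectation_def algebra_simps sum.distrib)

lemma overlap_expectation_cmult:
  "overlap_expectation N h (\<lambda>\<tau>. c * F \<tau>) = c * overlap_expectation N h F"
  by (simp add: overlap_expectation_def sum_distrib_left mult_ac)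

lemma overlap_expectation_sum:
  "overlap_expectation N h (\<lambda>\<tau>. \<Sum>x\<in>X. F x \<tau>) = (\<Sum>x\<in>X. overlap_expectation N h (F x))"
proof (induction X rule: infinite_finite_induct)
  case (insert x X)
  then show ?case by (simp add: overlap_expectation_add)
qed (simp_all add: overlap_expectation_def)

text \<open>Under \<open>overlap_expectation N h\<close> the signs are independent; as products of two independent spins of mean
  \<open>tanh h\<close> they have mean \<open>(tanh h)\<^sup>2\<close>.\<close>

lemma overlap_expectation_prod:
  "overlap_expectation N h (\<lambda>\<tau>. \<Prod>k=1..N. f (\<tau> k))
     = ((1 + (tanh h)\<^sup>2) / 2 * f 1 + (1 - (tanh h)\<^sup>2) / 2 * f (-1)) ^ N"
proof -
  let ?w = "spin_weight h"
  have "overlap_expectation N h (\<lambda>\<tau>. \<Prod>k=1..N. f (\<tau> k))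
     = (\<Sum>\<sigma>\<in>configs N. \<Sum>\<sigma>'\<in>configs N. \<Prod>k=1..N. ?w (\<sigma> k) * ?w (\<sigma>' k) * f (\<sigma> k * \<sigma>' k))"
    by (simp add: overlap_expectation_def prod.distrib)
  also have "\<dots> = (\<Sum>\<sigma>\<in>configs N. \<Prod>k=1..N. \<Sum>b\<in>{-1,1}. ?w (\<sigma> k) * ?w b * f (\<sigma> k * b))"
    unfolding configs_def
    by (intro sum.cong refl, subst prod_sum_PiE) auto
  also have "\<dots> = (\<Prod>k=1..N. \<Sum>a\<in>{-1,1}. \<Sum>b\<in>{-1,1}. ?w a * ?w b * f (a * b))"
    unfolding configs_def by (subst prod_sum_PiE) auto
  also have "\<dots> = (\<Sum>a\<in>{-1,1}. \<Sum>b\<in>{-1,1}. ?w a * ?w b * f (a * b)) ^ N" by simp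
  also have "(\<Sum>a\<in>{-1,1}. \<Sum>b\<in>{-1,1}. ?w a * ?w b * f (a * b))
     = ((?w 1)\<^sup>2 + (?w (-1))\<^sup>2) * f 1 + 2 * ?w 1 * ?w (-1) * f (-1)"
    by (simp add: algebra_simps power2_eq_square)
  also have "(?w 1)\<^sup>2 + (?w (-1))\<^sup>2 = (1 + (tanh h)\<^sup>2) / 2"
  proof -
    have "exp h + exp (- h) \<noteq> 0" by (smt (verit) exp_gt_zero)
    then show ?thesis
      by (simp add: spin_weight_def tanh_def sinh_def cosh_def divide_simps)
         (simp add: power2_eq_square algebra_simps)
  qed
  also have "2 * ?w 1 * ?w (-1) = (1 - (tanh h)\<^sup>2) / 2"
  proof -
    define a b where "a = exp h" and "b = exp (- h)"
    have "a * b = 1" by (simp add: a_def b_def exp_add[symmetric])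
    moreover have "a + b \<noteq> 0" unfolding a_def b_def by (smt (verit) exp_gt_zero)
    note nz = this
    then have "1 - ((a - b) / (a + b))\<^sup>2 = 4 * (a * b) / (a + b)\<^sup>2"
      by (simp add: divide_simps) (simp add: power2_eq_square algebra_simps)
    moreover have "tanh h = (a - b) / (a + b)"
      using nz by (simp add: tanh_def sinh_def cosh_def a_def b_def divide_simps)
         (simp add: algebra_simps)
    ultimately show ?thesis
      by (simp add: spin_weight_def a_def b_def power2_eq_square)
  qed
  finally show ?thesis .
qed

text \<open>Completing the square.\<close>

lemma gaussian_exp_quadratic:
  fixes r b :: real
  assumes "r < 1"
  shows "has_bochner_integral lborel (\<lambda>g. std_normal_density g * exp (r * g\<^sup>2 / 2 + b * g))
           (exp (b\<^sup>2 / (2 * (1 - r))) / sqrt (1 - r))"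
proof -
  define c where "c = exp (b\<^sup>2 / (2 * (1 - r))) / sqrt (1 - r)"
  have r: "0 < 1 - r" using assms by simp
  have "std_normal_density g * exp (r * g\<^sup>2 / 2 + b * g)
      = c * normal_density (b / (1 - r)) (1 / sqrt (1 - r)) g" for g
  proof -
    have sq: "(1 / sqrt (1 - r))\<^sup>2 = 1 / (1 - r)" using r by (simp add: power_divide)
    have "- (g - b / (1 - r))\<^sup>2 / (2 * (1 / sqrt (1 - r))\<^sup>2) + b\<^sup>2 / (2 * (1 - r))
       = - g\<^sup>2 / 2 + (r * g\<^sup>2 / 2 + b * g)"
    proof -
      define s where "s = 1 - r"
      have s: "0 < s" "r = 1 - s" using r by (auto simp: s_def)
      then show ?thesis
        unfolding sq unfolding s(2) using s(1) by (simp add: field_simps power2_eq_square)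
    qed
    then have e: "exp (b\<^sup>2 / (2 * (1 - r))) * exp (- (g - b / (1 - r))\<^sup>2 / (2 * (1 / sqrt (1 - r))\<^sup>2))
       = exp (- g\<^sup>2 / 2) * exp (r * g\<^sup>2 / 2 + b * g)"
      by (simp add: exp_add[symmetric] add.commute)
    have "sqrt (2 * pi * (1 / sqrt (1 - r))\<^sup>2) = sqrt (2 * pi) / sqrt (1 - r)"
      unfolding sq by (simp add: real_sqrt_divide)
    then have "c * normal_density (b / (1 - r)) (1 / sqrt (1 - r)) g
       = 1 / sqrt (2 * pi) * (exp (b\<^sup>2 / (2 * (1 - r))) * exp (- (g - b / (1 - r))\<^sup>2 / (2 * (1 / sqrt (1 - r))\<^sup>2)))"
      using r by (simp add: c_def normal_density_def)
    then show ?thesis unfolding e by (simp add: std_normal_density_def)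
  qed
  moreover have "has_bochner_integral lborel
      (\<lambda>g. c * normal_density (b / (1 - r)) (1 / sqrt (1 - r)) g) (c * 1)"
    using r by (intro has_bochner_integral_mult_right)
      (auto simp: has_bochner_integral_iff)
  ultimately show ?thesis by (simp add: c_def)
qed

text \<open>The Gaussian linearization \<open>exp (a\<^sup>2 / 2) = E exp (a g)\<close> decouples the signs; Hoeffding's lemma
  bounds the factor of each, and a Gaussian integral is left.\<close>

lemma overlap_expectation_exp_square:
  fixes r :: real
  assumes r: "0 \<le> r" "r < 1" and N: "0 < N"
  shows "overlap_expectation N h (\<lambda>\<tau>. exp (r * (\<Sum>k=1..N. \<tau> k)\<^sup>2 / (2 * real N)))
           \<le> exp (r * (real N * (tanh h)^4) / (2 * (1 - r))) / sqrt (1 - r)"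
proof -
  define m where "m = (tanh h)\<^sup>2"
  define a where "a = sqrt (r / real N)"
  let ?\<phi> = "std_normal_density"
  have m: "\<bar>m\<bar> \<le> 1"
    using tanh_real_bounds[of h] by (auto simp: m_def abs_square_le_1 abs_le_iff)
  have a: "a\<^sup>2 = r / real N" using r N by (simp add: a_def)
  have lin: "has_bochner_integral lborel (\<lambda>g. ?\<phi> g * exp (a * S * g)) (exp (r * S\<^sup>2 / (2 * real N)))" for S
    using gaussian_exp_quadratic[of 0 "a * S"] by (simp add: power_mult_distrib a mult_ac)
  have 1: "has_bochner_integral lborel
     (\<lambda>g. overlap_expectation N h (\<lambda>\<tau>. ?\<phi> g * exp (a * (\<Sum>k=1..N. \<tau> k) * g)))
     (overlap_expectation N h (\<lambda>\<tau>. exp (r * (\<Sum>k=1..N. \<tau> k)\<^sup>2 / (2 * real N))))"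
    unfolding overlap_expectation_def
    by (intro has_bochner_integral_sum has_bochner_integral_mult_right lin)
  have le: "overlap_expectation N h (\<lambda>\<tau>. ?\<phi> g * exp (a * (\<Sum>k=1..N. \<tau> k) * g))
      \<le> ?\<phi> g * exp (r * g\<^sup>2 / 2 + (real N * m * a) * g)" for g
  proof -
    have "overlap_expectation N h (\<lambda>\<tau>. ?\<phi> g * exp (a * (\<Sum>k=1..N. \<tau> k) * g))
       = ?\<phi> g * overlap_expectation N h (\<lambda>\<tau>. \<Prod>k=1..N. exp (a * g * \<tau> k))"
      by (simp add: overlap_expectation_cmult exp_sum[symmetric] sum_distrib_left sum_distrib_right mult_ac)
    also have "overlap_expectation N h (\<lambda>\<tau>. \<Prod>k=1..N. exp (a * g * \<tau> k))
       = (cosh (a * g) + m * sinh (a * g)) ^ N"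
      by (subst overlap_expectation_prod) (simp add: m_def cosh_def sinh_def field_simps)
    also have "\<dots> \<le> exp (m * (a * g) + (a * g)\<^sup>2 / 2) ^ N"
    proof (intro power_mono biased_sign_mgf_le m)
      have "\<bar>m * sinh (a * g)\<bar> \<le> 1 * cosh (a * g)"
        unfolding abs_mult using m sinh_le_cosh_real[of "a * g"] sinh_le_cosh_real[of "- (a * g)"]
        by (intro mult_mono) (simp_all add: abs_le_iff)
      then show "0 \<le> cosh (a * g) + m * sinh (a * g)" by linarith
    qed
    also have "\<dots> = exp (r * g\<^sup>2 / 2 + (real N * m * a) * g)"
      using N by (simp add: exp_of_nat_mult[symmetric] power_mult_distrib a field_simps)
    finally show ?thesis by (simp add: mult_left_mono)
  qed
  have 2: "has_bochner_integral lborel (\<lambda>g. ?\<phi> g * exp (r * g\<^sup>2 / 2 + (real N * m * a) * g))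
     (exp ((real N * m * a)\<^sup>2 / (2 * (1 - r))) / sqrt (1 - r))"
    by (rule gaussian_exp_quadratic[OF r(2)])
  have "overlap_expectation N h (\<lambda>\<tau>. exp (r * (\<Sum>k=1..N. \<tau> k)\<^sup>2 / (2 * real N)))
     \<le> exp ((real N * m * a)\<^sup>2 / (2 * (1 - r))) / sqrt (1 - r)"
    unfolding has_bochner_integral_integral_eq[OF 1, symmetric] has_bochner_integral_integral_eq[OF 2, symmetric]
    by (rule integral_mono) (use 1 2 le in \<open>auto simp: has_bochner_integral_iff\<close>)
  also have "(real N * m * a)\<^sup>2 = r * (real N * (tanh h)^4)"
  proof -
    have "(real N * m * a)\<^sup>2 = (real N * a\<^sup>2) * (real N * m\<^sup>2)"
      by (simp add: power_mult_distrib power2_eq_square)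
    also have "real N * a\<^sup>2 = r" using N by (simp add: a)
    also have "m\<^sup>2 = (tanh h)^4" by (simp add: m_def)
    finally show ?thesis .
  qed
  finally show ?thesis .
qed

text \<open>If the signs have mean \<open>x\<close>, then \<open>exp (N * I x)\<close> is their likelihood ratio between bias \<open>x\<close> and no
  bias. A likelihood ratio has expectation \<open>1\<close> without bias and not much more with the small bias
  \<open>(tanh h)\<^sup>2\<close>, and at most \<open>2 * N + 1\<close> values of \<open>x\<close> occur.\<close>

lemma exp_entropy_eq_likelihood:
  assumes sign: "\<And>k. k \<in> {1..N} \<Longrightarrow> \<bar>\<tau> k\<bar> = 1" and N: "0 < N"
  defines "x \<equiv> (\<Sum>k=1..N. \<tau> k) / real N"
  shows "exp (real N * binary_entropy x) = (\<Prod>k=1..N. 1 + x * \<tau> k)"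
proof -
  define P where "P = {k\<in>{1..N}. \<tau> k = 1}"
  define Q where "Q = {k\<in>{1..N}. \<tau> k = -1}"
  have t: "\<tau> k = 1 \<or> \<tau> k = -1" if "k \<in> {1..N}" for k
    using sign[OF that] by (auto simp: abs_if split: if_splits)
  have "{1..N} = P \<union> Q" using t unfolding P_def Q_def by blast
  moreover have "P \<inter> Q = {}" "finite P" "finite Q" by (auto simp: P_def Q_def)
  ultimately have PQ: "{1..N} = P \<union> Q" "P \<inter> Q = {}" "finite P" "finite Q" by blast+
  have "real (card {1..N}) = real (card P) + real (card Q)"
    unfolding PQ(1) using PQ by (simp add: card_Un_disjoint)
  moreover have "(\<Sum>k=1..N. \<tau> k) = real (card P) - real (card Q)"
    unfolding PQ(1) using PQ by (simp add: sum.union_disjoint P_def Q_def)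
  moreover have xN: "x * real N = (\<Sum>k=1..N. \<tau> k)" using N by (simp add: x_def)
  ultimately have c: "real (card P) = real N * (1 + x) / 2" "real (card Q) = real N * (1 - x) / 2"
    using xN by (auto simp: field_simps)
  have prod: "(\<Prod>k=1..N. 1 + x * \<tau> k) = (1 + x) ^ card P * (1 - x) ^ card Q"
    unfolding PQ(1) using PQ by (simp add: prod.union_disjoint P_def Q_def)
  have pow: "y ^ n = exp (real n * ln y)" if "0 \<le> y" "y = 0 \<Longrightarrow> n = 0" for y :: real and n
    using that by (cases "y = 0") (auto simp: exp_of_nat_mult)
  have "0 \<le> real N * (1 + x) / 2" "0 \<le> real N * (1 - x) / 2" unfolding c[symmetric] by auto
  then have x: "0 \<le> 1 + x" "0 \<le> 1 - x" using N by (auto simp: zero_le_mult_iff)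
  have "(1 + x) ^ card P = exp (real (card P) * ln (1 + x))"
    by (rule pow) (use x c N in auto)
  moreover have "(1 - x) ^ card Q = exp (real (card Q) * ln (1 - x))"
    by (rule pow) (use x c N in auto)
  ultimately show ?thesis
    unfolding prod c by (simp add: exp_add[symmetric] binary_entropy_def field_simps)
qed

lemma overlap_expectation_exp_entropy:
  assumes N: "0 < N"
  shows "overlap_expectation N h (\<lambda>\<tau>. exp (real N * binary_entropy ((\<Sum>k=1..N. \<tau> k) / real N)))
           \<le> (2 * real N + 1) * exp (real N * (tanh h)\<^sup>2)"
proof -
  define X where "X = (\<lambda>j. real_of_int j / real N) ` {- int N..int N}"
  have X1: "\<bar>x\<bar> \<le> 1" if "x \<in> X" for x
    using that N by (auto simp: X_def abs_le_iff field_simps)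
  have fin: "finite X" by (simp add: X_def)
  have "overlap_expectation N h (\<lambda>\<tau>. exp (real N * binary_entropy ((\<Sum>k=1..N. \<tau> k) / real N)))
     \<le> overlap_expectation N h (\<lambda>\<tau>. \<Sum>x\<in>X. \<Prod>k=1..N. 1 + x * \<tau> k)"
  proof (rule overlap_expectation_mono)
    fix \<tau> :: "nat \<Rightarrow> real" assume sign: "\<And>k. k \<in> {1..N} \<Longrightarrow> \<bar>\<tau> k\<bar> = 1"
    let ?x = "(\<Sum>k=1..N. \<tau> k) / real N"
    have t: "\<tau> k = 1 \<or> \<tau> k = -1" if "k \<in> {1..N}" for k
      using sign[OF that] by (auto simp: abs_if split: if_splits)
    have "?x \<in> X"
    proof -
      have "(\<Sum>k=1..N. \<tau> k) \<in> \<int>"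
      proof (rule Ints_sum)
        fix k assume "k \<in> {1..N}"
        then show "\<tau> k \<in> \<int>" using t[of k] by auto
      qed
      then obtain j where j: "(\<Sum>k=1..N. \<tau> k) = real_of_int j" by (auto elim: Ints_cases)
      have "\<bar>?x\<bar> \<le> 1" using abs_mean_sign_le[OF sign N] .
      then have "\<bar>real_of_int j\<bar> \<le> real N" using N j by (simp add: abs_mult field_simps)
      then have "j \<in> {- int N..int N}" by auto
      then show ?thesis unfolding X_def j by (rule imageI)
    qed
    moreover have "0 \<le> (\<Prod>k=1..N. 1 + x * \<tau> k)" if "x \<in> X" for x
    proof (rule prod_nonneg)
      fix k assume "k \<in> {1..N}"
      then show "0 \<le> 1 + x * \<tau> k" using t[of k] X1[OF that] by auto
    qed
    ultimately have "(\<Prod>k=1..N. 1 + ?x * \<tau> k) \<le> (\<Sum>x\<in>X. \<Prod>k=1..N. 1 + x * \<tau> k)"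
      by (intro member_le_sum[of ?x X "\<lambda>x. \<Prod>k=1..N. 1 + x * \<tau> k"] fin) auto
    then show "exp (real N * binary_entropy ?x) \<le> (\<Sum>x\<in>X. \<Prod>k=1..N. 1 + x * \<tau> k)"
      using exp_entropy_eq_likelihood[OF sign N] by simp
  qed
  also have "\<dots> = (\<Sum>x\<in>X. (1 + x * (tanh h)\<^sup>2) ^ N)"
  proof -
    have "overlap_expectation N h (\<lambda>\<tau>. \<Prod>k=1..N. 1 + x * \<tau> k) = (1 + x * (tanh h)\<^sup>2) ^ N" for x
    proof -
      have "(1 + (tanh h)\<^sup>2) / 2 * (1 + x * 1) + (1 - (tanh h)\<^sup>2) / 2 * (1 + x * - 1)
        = 1 + x * (tanh h)\<^sup>2" by (simp add: field_simps)
      then show ?thesis by (subst overlap_expectation_prod) simp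
    qed
    then show ?thesis by (simp add: overlap_expectation_sum)
  qed
  also have "\<dots> \<le> (\<Sum>x\<in>X. exp (real N * (tanh h)\<^sup>2))"
  proof (rule sum_mono)
    fix x assume x: "x \<in> X"
    have m: "0 \<le> (tanh h)\<^sup>2" "(tanh h)\<^sup>2 \<le> 1"
      using tanh_real_bounds[of h] by (auto simp: abs_square_le_1 abs_le_iff)
    have xm: "\<bar>x * (tanh h)\<^sup>2\<bar> \<le> 1 * (tanh h)\<^sup>2"
      unfolding abs_mult using X1[OF x] by (intro mult_mono) auto
    have "(1 + x * (tanh h)\<^sup>2) ^ N \<le> exp ((tanh h)\<^sup>2) ^ N"
    proof (rule power_mono)
      show "1 + x * (tanh h)\<^sup>2 \<le> exp ((tanh h)\<^sup>2)"
        using exp_ge_add_one_self[of "(tanh h)\<^sup>2"] xm by linarith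
      show "0 \<le> 1 + x * (tanh h)\<^sup>2" using xm m by linarith
    qed
    then show "(1 + x * (tanh h)\<^sup>2) ^ N \<le> exp (real N * (tanh h)\<^sup>2)"
      by (simp add: exp_of_nat_mult)
  qed
  also have "\<dots> = real (card X) * exp (real N * (tanh h)\<^sup>2)" by simp
  also have "\<dots> \<le> (2 * real N + 1) * exp (real N * (tanh h)\<^sup>2)"
  proof (rule mult_right_mono)
    have "card X \<le> card {- int N..int N}" unfolding X_def by (rule card_image_le) simp
    then show "real (card X) \<le> 2 * real N + 1" by simp
  qed simp
  finally show ?thesis .
qed

section \<open>The energy of an overlap\<close>

lemma sum_shift_2: "(\<Sum>p=2..N. f p) = (\<Sum>k<N - 1. f (k + 2))" for f :: "nat \<Rightarrow> real"
proof -
  have "{2..N} = (\<lambda>k. k + 2) ` {..<N - 1}"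
  proof (intro equalityI subsetI)
    fix p assume "p \<in> {2..N}"
    then show "p \<in> (\<lambda>k. k + 2) ` {..<N - 1}" by (intro image_eqI[of _ _ "p - 2"]) auto
  qed auto
  then show ?thesis by (simp add: sum.reindex o_def del: add_2_eq_Suc')
qed

locale spin_coeffs =
  fixes \<theta> :: "nat \<Rightarrow> real"
  assumes coeffs_summable: "summable (\<lambda>k. (\<theta> (k + 2))\<^sup>2 / fact k)"
begin

definition coeff_sum :: real where
  "coeff_sum = (\<Sum>k. (\<theta> (k + 2))\<^sup>2 / fact k)"

lemma sum_coeffs_le:
  assumes "finite A"
  shows "(\<Sum>k\<in>A. (\<theta> (k + 2))\<^sup>2 / fact k) \<le> coeff_sum"
  unfolding coeff_sum_def by (rule sum_le_suminf[OF coeffs_summable assms]) auto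

lemma coeff_le: "(\<theta> (k + 2))\<^sup>2 \<le> coeff_sum * fact k"
  using sum_coeffs_le[of "{k}"] by (simp add: field_simps)

lemma coeff_sum_nonneg: "0 \<le> coeff_sum"
  using sum_coeffs_le[of "{}"] by simp

lemma summable_xi:
  assumes "0 \<le> x" "x \<le> 1"
  shows "summable (\<lambda>k. (\<theta> (k + 2))\<^sup>2 / fact (k + 2) * x ^ (k + 2))"
proof (rule summable_comparison_test'[OF coeffs_summable])
  fix k :: nat
  have "(\<theta> (k + 2))\<^sup>2 / fact (k + 2) * x ^ (k + 2) \<le> (\<theta> (k + 2))\<^sup>2 / fact k * 1"
    using assms by (intro mult_mono divide_left_mono power_le_one fact_mono mult_pos_pos) auto
  moreover have "0 \<le> (\<theta> (k + 2))\<^sup>2 / fact (k + 2) * x ^ (k + 2)" using assms by auto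
  ultimately show "norm ((\<theta> (k + 2))\<^sup>2 / fact (k + 2) * x ^ (k + 2)) \<le> (\<theta> (k + 2))\<^sup>2 / fact k"
    by simp
qed

lemma partial_xi_le:
  assumes "0 \<le> x" "x \<le> 1"
  shows "(\<Sum>p=2..N. (\<theta> p)\<^sup>2 / fact p * x ^ p) \<le> xi \<theta> x"
  unfolding xi_def sum_shift_2
  by (rule sum_le_suminf[OF summable_xi[OF assms]]) (use assms in auto)

lemma xi_1_nonneg: "0 \<le> xi \<theta> 1"
  using partial_xi_le[of 1 0] by simp

text \<open>The gap between sampling with and without replacement costs the energy half the coefficient whose
  summability is assumed.\<close>

lemma coeff_gap:
  assumes "0 < N" "2 \<le> p"
  shows "real N * ((\<theta> p)\<^sup>2 / fact p) * (real p * (real p - 1) / (2 * real N)) = (\<theta> p)\<^sup>2 / fact (p - 2) / 2"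
proof -
  obtain k where "p = k + 2" using assms(2) by (metis add.commute le_Suc_ex)
  moreover have "fact (k + 2) = (real k + 2) * (real k + 1) * fact k" by (simp add: algebra_simps)
  ultimately show ?thesis using assms(1) by (simp add: divide_simps) (simp add: algebra_simps)
qed

end

locale below_beta_f = spin_coeffs +
  fixes \<beta> :: real
  assumes beta_pos: "0 < \<beta>" and beta_less: "\<beta> < beta_f (xi \<theta>)"
begin

text \<open>By definition of \<open>beta_f\<close>, \<open>\<beta>\<^sup>2 * \<xi> x\<close> is at most \<open>ratio\<close> times the entropy of \<open>x\<close>.\<close>

definition ratio :: real where
  "ratio = \<beta>\<^sup>2 / (beta_f (xi \<theta>))\<^sup>2"

lemma beta_f_pos: "0 < beta_f (xi \<theta>)"
  using beta_pos beta_less by linarith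

lemma ratio_bounds: "0 < ratio" "ratio < 1"
  using beta_pos beta_less beta_f_pos by (auto simp: ratio_def power_strict_mono)

lemma beta_sq: "\<beta>\<^sup>2 = ratio * (beta_f (xi \<theta>))\<^sup>2"
  using beta_f_pos by (simp add: ratio_def)

lemma xi_le_entropy:
  assumes "0 < x" "x < 1"
  shows "(beta_f (xi \<theta>))\<^sup>2 * xi \<theta> x \<le> binary_entropy x"
proof -
  have nn: "0 \<le> xi \<theta> y" "0 \<le> binary_entropy y" if "0 < y" "y < 1" for y
  proof -
    show "0 \<le> xi \<theta> y" using partial_xi_le[of y 0] that by simp
    have "0 \<le> y\<^sup>2 / 6" by simp
    also have "\<dots> \<le> binary_entropy y" using that by (intro binary_entropy_ge) auto
    finally show "0 \<le> binary_entropy y" .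
  qed
  have le: "beta_f (xi \<theta>) \<le> sqrt (binary_entropy x / xi \<theta> x)"
    unfolding beta_f_def
  proof (rule cINF_lower)
    show "bdd_below ((\<lambda>x. sqrt (binary_entropy x / xi \<theta> x)) ` {0<..<1})"
      using nn by (intro bdd_belowI[of _ 0]) auto
  qed (use assms in auto)
  then have "(beta_f (xi \<theta>))\<^sup>2 \<le> (sqrt (binary_entropy x / xi \<theta> x))\<^sup>2"
    using beta_f_pos by (intro power_mono) auto
  also have "\<dots> = binary_entropy x / xi \<theta> x" using nn[OF assms] by simp
  finally have "(beta_f (xi \<theta>))\<^sup>2 \<le> binary_entropy x / xi \<theta> x" .
  \<comment> \<open>Division by \<open>0\<close> would make \<open>beta_f\<close> nonpositive.\<close>
  moreover have "xi \<theta> x \<noteq> 0" using le beta_f_pos by auto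
  ultimately show ?thesis using nn[OF assms] by (simp add: field_simps)
qed

text \<open>Truncated at \<open>p = N\<close>, the structure function is a polynomial, so the inequality extends by continuity
  to the endpoint \<open>1\<close>, and to negative \<open>x\<close> because its coefficients are nonnegative.\<close>

lemma partial_xi_le_entropy:
  assumes "\<bar>x\<bar> \<le> 1"
  shows "(beta_f (xi \<theta>))\<^sup>2 * (\<Sum>p=2..N. (\<theta> p)\<^sup>2 / fact p * x ^ p) \<le> binary_entropy x"
proof -
  define q where "q = (\<lambda>x. (beta_f (xi \<theta>))\<^sup>2 * (\<Sum>p=2..N. (\<theta> p)\<^sup>2 / fact p * x ^ p))"
  have lt1: "q y \<le> binary_entropy y" if "0 \<le> y" "y < 1" for y
  proof (cases "y = 0")
    case True
    then show ?thesis by (simp add: q_def binary_entropy_def power_0_left)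
  next
    case False
    have "q y \<le> (beta_f (xi \<theta>))\<^sup>2 * xi \<theta> y"
      unfolding q_def using that by (intro mult_left_mono partial_xi_le) auto
    also have "\<dots> \<le> binary_entropy y" using that False by (intro xi_le_entropy) auto
    finally show ?thesis .
  qed
  have "q 1 \<le> binary_entropy 1"
  proof (rule tendsto_upperbound)
    have "isCont q 1" unfolding q_def by (intro continuous_intros)
    then show "(q \<longlongrightarrow> q 1) (at_left 1)"
      by (simp add: isCont_def filterlim_at_split)
    show "\<forall>\<^sub>F y in at_left 1. q y \<le> binary_entropy 1"
      using eventually_at_left_real[of 0 "1::real"]
    proof (rule eventually_mono)
      show "(0::real) < 1" by simp
      fix y :: real assume "y \<in> {0<..<1}"
      then show "q y \<le> binary_entropy 1"
        using lt1[of y] binary_entropy_le_1[of y] by auto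
    qed
  qed simp
  then have "q \<bar>x\<bar> \<le> binary_entropy x"
    using lt1[of "\<bar>x\<bar>"] assms by (cases "\<bar>x\<bar> = 1") (auto, metis binary_entropy_abs)
  moreover have "q x \<le> q \<bar>x\<bar>"
    unfolding q_def
  proof (intro mult_left_mono sum_mono)
    fix p show "x ^ p \<le> \<bar>x\<bar> ^ p" using abs_ge_self[of "x ^ p"] by (simp add: power_abs)
  qed auto
  ultimately show ?thesis by (simp add: q_def)
qed

text \<open>The limit \<open>x \<rightarrow> 0\<close> of the inequality between the entropy and the structure function.\<close>

lemma theta_2_le: "(beta_f (xi \<theta>))\<^sup>2 * (\<theta> 2)\<^sup>2 \<le> 1"
proof (rule field_le_epsilon)
  fix e :: real assume e: "0 < e"
  define x where "x = min e (1/2)"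
  have x: "0 < x" "x < 1" "x \<le> e" using e by (auto simp: x_def)
  have "(beta_f (xi \<theta>))\<^sup>2 * ((\<theta> 2)\<^sup>2 / fact 2 * x\<^sup>2) \<le> binary_entropy x"
    using partial_xi_le_entropy[of x 2] x by simp
  also have "\<dots> \<le> x\<^sup>2 / 2 + x^3 / 3" using x by (intro binary_entropy_le) auto
  also have "\<dots> = x\<^sup>2 * (1 / 2 + x / 3)" by (simp add: power2_eq_square power3_eq_cube algebra_simps)
  finally have "x\<^sup>2 * ((beta_f (xi \<theta>))\<^sup>2 * (\<theta> 2)\<^sup>2 / 2) \<le> x\<^sup>2 * (1 / 2 + x / 3)"
    by (simp add: mult_ac)
  then have "(beta_f (xi \<theta>))\<^sup>2 * (\<theta> 2)\<^sup>2 / 2 \<le> 1 / 2 + x / 3"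
    using x by (simp add: mult_le_cancel_left)
  then show "(beta_f (xi \<theta>))\<^sup>2 * (\<theta> 2)\<^sup>2 \<le> 1 + e" using x by simp
qed

text \<open>The exponent of the second moment for two replicas whose products of spins are the signs \<open>\<tau>\<close>, when
  \<open>tanh\<close> is replaced by its argument.\<close>

definition overlap_energy :: "nat \<Rightarrow> (nat \<Rightarrow> real) \<Rightarrow> real" where
  "overlap_energy N \<tau> = (\<Sum>p=2..N. \<beta>\<^sup>2 * (\<theta> p)\<^sup>2 / real N ^ (p - 1) * esym \<tau> N p)"

lemma overlap_energy_term:
  assumes "0 < N" "2 \<le> p"
  shows "\<beta>\<^sup>2 * (\<theta> p)\<^sup>2 / real N ^ (p - 1) * esym \<tau> N p
           = \<beta>\<^sup>2 * (real N * ((\<theta> p)\<^sup>2 / fact p) * nsym \<tau> N p)"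
proof -
  obtain k where "p = Suc k" using assms by (cases p) auto
  then show ?thesis using assms by (simp add: nsym_def del: fact_Suc)
qed

text \<open>Useful away from overlap \<open>0\<close>, where a bounded error does not matter.\<close>

lemma overlap_energy_le_entropy:
  assumes sign: "\<And>k. k \<in> {1..N} \<Longrightarrow> \<bar>\<tau> k\<bar> = 1" and N: "0 < N"
  defines "x \<equiv> (\<Sum>k=1..N. \<tau> k) / real N"
  shows "overlap_energy N \<tau> \<le> ratio * (real N * binary_entropy x) + \<beta>\<^sup>2 * coeff_sum"
proof -
  have "overlap_energy N \<tau> \<le> (\<Sum>p=2..N. \<beta>\<^sup>2 * (real N * ((\<theta> p)\<^sup>2 / fact p * x ^ p) + (\<theta> p)\<^sup>2 / fact (p - 2)))"
    unfolding overlap_energy_def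
  proof (rule sum_mono)
    fix p assume p: "p \<in> {2..N}"
    have "nsym \<tau> N p \<le> x ^ p + real p * (real p - 1) / (2 * real N)"
      using nsym_power[where \<tau> = \<tau> and N = N and p = p, OF sign N] unfolding x_def by linarith
    then have "real N * ((\<theta> p)\<^sup>2 / fact p) * nsym \<tau> N p
       \<le> real N * ((\<theta> p)\<^sup>2 / fact p) * (x ^ p + real p * (real p - 1) / (2 * real N))"
      by (intro mult_left_mono) auto
    also have "\<dots> = real N * ((\<theta> p)\<^sup>2 / fact p * x ^ p) + (\<theta> p)\<^sup>2 / fact (p - 2) / 2"
      using coeff_gap[of N p] N p by (simp add: distrib_left)
    also have "\<dots> \<le> real N * ((\<theta> p)\<^sup>2 / fact p * x ^ p) + (\<theta> p)\<^sup>2 / fact (p - 2)"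
      using zero_le_power2[of "\<theta> p"] by (simp add: divide_simps)
    finally have le: "real N * ((\<theta> p)\<^sup>2 / fact p) * nsym \<tau> N p
       \<le> real N * ((\<theta> p)\<^sup>2 / fact p * x ^ p) + (\<theta> p)\<^sup>2 / fact (p - 2)" .
    show "\<beta>\<^sup>2 * (\<theta> p)\<^sup>2 / real N ^ (p - 1) * esym \<tau> N p
        \<le> \<beta>\<^sup>2 * (real N * ((\<theta> p)\<^sup>2 / fact p * x ^ p) + (\<theta> p)\<^sup>2 / fact (p - 2))"
    proof -
      have p2: "2 \<le> p" using p by simp
      show ?thesis unfolding overlap_energy_term[OF N p2]
        by (rule mult_left_mono[OF le]) simp
    qed
  qed
  also have "\<dots> = real N * ratio * ((beta_f (xi \<theta>))\<^sup>2 * (\<Sum>p=2..N. (\<theta> p)\<^sup>2 / fact p * x ^ p))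
      + \<beta>\<^sup>2 * (\<Sum>p=2..N. (\<theta> p)\<^sup>2 / fact (p - 2))"
    by (simp add: sum_distrib_left sum.distrib distrib_left beta_sq mult_ac)
  also have "\<dots> \<le> real N * ratio * binary_entropy x + \<beta>\<^sup>2 * coeff_sum"
  proof (intro add_mono mult_left_mono partial_xi_le_entropy)
    show "\<bar>x\<bar> \<le> 1" unfolding x_def by (rule abs_mean_sign_le[OF sign N])
    show "(\<Sum>p=2..N. (\<theta> p)\<^sup>2 / fact (p - 2)) \<le> coeff_sum"
      unfolding sum_shift_2 using sum_coeffs_le[of "{..<N - 1}"] by simp
  qed (use ratio_bounds in auto)
  finally show ?thesis by (simp add: mult_ac)
qed

text \<open>Near overlap \<open>0\<close> even a bounded error is too much: it would enter the constant of the second moment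
  bound. For \<open>p = 2\<close> the error has the right sign; for \<open>p \<ge> 3\<close> it is a small fraction of the coefficients.
  Of the structure function only the quadratic part remains, which \<open>ratio\<close> dominates.\<close>

lemma overlap_energy_le_square:
  assumes sign: "\<And>k. k \<in> {1..N} \<Longrightarrow> \<bar>\<tau> k\<bar> = 1" and N: "0 < N"
    and d: "d \<le> 1"
  defines "x \<equiv> (\<Sum>k=1..N. \<tau> k) / real N"
  assumes small: "\<bar>x\<bar> \<le> d"
  shows "overlap_energy N \<tau> \<le> (ratio + 2 * \<beta>\<^sup>2 * d * xi \<theta> 1) * (\<Sum>k=1..N. \<tau> k)\<^sup>2 / (2 * real N)
     + \<beta>\<^sup>2 * (\<Sum>k<N - 1. (\<theta> (k + 2))\<^sup>2 / fact k * min 1 (d + real (k + 2) / real N))"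
proof -
  let ?m = "\<lambda>p. min 1 (d + real p / real N)"
  have d0: "0 \<le> d" using small by linarith
  have N2: "(\<Sum>k=1..N. \<tau> k)\<^sup>2 / (2 * real N) = real N * x\<^sup>2 / 2"
    using N by (simp add: x_def power_divide power2_eq_square)
  have each: "real N * ((\<theta> p)\<^sup>2 / fact p) * nsym \<tau> N p
      \<le> real N * x\<^sup>2 * ((if p = 2 then (\<theta> 2)\<^sup>2 / 2 else 0) + d * ((\<theta> p)\<^sup>2 / fact p)) + (\<theta> p)\<^sup>2 / fact (p - 2) * ?m p"
    if p: "p \<in> {2..N}" for p
  proof (cases "p = 2")
    case True
    have "nsym \<tau> N 2 \<le> x\<^sup>2"
    proof -
      have "nsym \<tau> N (0 + 2) = x * nsym \<tau> N (Suc 0) - (real 0 + 1) * (real N - real 0) / (real N)\<^sup>2 * nsym \<tau> N 0"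
        unfolding x_def by (rule nsym_recurrence[where \<tau> = \<tau> and N = N and p = 0, OF sign N])
      also have "nsym \<tau> N (Suc 0) = x" by (simp add: nsym_def esym_1 x_def)
      also have "x * x - (real 0 + 1) * (real N - real 0) / (real N)\<^sup>2 * nsym \<tau> N 0 \<le> x\<^sup>2"
        by (simp add: nsym_def power2_eq_square)
      finally show ?thesis by (simp add: numeral_2_eq_2)
    qed
    then have "real N * ((\<theta> 2)\<^sup>2 / 2) * nsym \<tau> N 2 \<le> real N * ((\<theta> 2)\<^sup>2 / 2) * x\<^sup>2"
      by (intro mult_left_mono) auto
    moreover have "0 \<le> real N * x\<^sup>2 * (d * ((\<theta> 2)\<^sup>2 / 2)) + (\<theta> 2)\<^sup>2 * ?m 2"
      using d0 by (intro add_nonneg_nonneg mult_nonneg_nonneg) auto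
    ultimately show ?thesis unfolding True by (simp add: algebra_simps)
  next
    case False
    have a: "nsym \<tau> N p \<le> x ^ p + real p * (real p - 1) / (2 * real N) * ?m p"
    proof -
      have "0 \<le> real p * (real p - 1) / (2 * real N)" using p by simp
      then have "real p * (real p - 1) / (2 * real N) * (\<bar>x\<bar> + real p / real N)
         \<le> real p * (real p - 1) / (2 * real N) * (d + real p / real N)"
        using small by (intro mult_left_mono) auto
      moreover have "3 \<le> p" using p False by simp
      then have "\<bar>nsym \<tau> N p - x ^ p\<bar> \<le> real p * (real p - 1) / (2 * real N) * (\<bar>x\<bar> + real p / real N)"
        using nsym_power_small[of N \<tau> p] sign N unfolding x_def by blast
      moreover have "\<bar>nsym \<tau> N p - x ^ p\<bar> \<le> real p * (real p - 1) / (2 * real N)"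
        using nsym_power[of N \<tau> p] sign N unfolding x_def by blast
      ultimately show ?thesis
        by (cases "1 \<le> d + real p / real N") (auto simp: min_def)
    qed
    have b: "x ^ p \<le> d * x\<^sup>2"
    proof -
      have "x ^ p \<le> \<bar>x\<bar> ^ p" using abs_ge_self[of "x ^ p"] by (simp add: power_abs)
      also have "\<dots> \<le> \<bar>x\<bar> ^ 3" using p False small d by (intro power_decreasing) auto
      also have "\<dots> = \<bar>x\<bar> * x\<^sup>2" by (simp add: power3_eq_cube power2_eq_square)
      also have "\<dots> \<le> d * x\<^sup>2" using small by (intro mult_right_mono) auto
      finally show ?thesis .
    qed
    have "real N * ((\<theta> p)\<^sup>2 / fact p) * nsym \<tau> N p
      \<le> real N * ((\<theta> p)\<^sup>2 / fact p) * (d * x\<^sup>2 + real p * (real p - 1) / (2 * real N) * ?m p)"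
      using a b by (intro mult_left_mono) auto
    also have "\<dots> = real N * x\<^sup>2 * (d * ((\<theta> p)\<^sup>2 / fact p)) + real N * ((\<theta> p)\<^sup>2 / fact p) * (real p * (real p - 1) / (2 * real N)) * ?m p"
      by (simp add: distrib_left mult_ac)
    also have "\<dots> = real N * x\<^sup>2 * (d * ((\<theta> p)\<^sup>2 / fact p)) + (\<theta> p)\<^sup>2 / fact (p - 2) / 2 * ?m p"
      using coeff_gap[of N p] N p by simp
    also have "\<dots> \<le> real N * x\<^sup>2 * (d * ((\<theta> p)\<^sup>2 / fact p)) + (\<theta> p)\<^sup>2 / fact (p - 2) * ?m p"
    proof -
      have "(\<theta> p)\<^sup>2 / fact (p - 2) / 2 \<le> (\<theta> p)\<^sup>2 / fact (p - 2)"
        using zero_le_power2[of "\<theta> p"] by (simp add: divide_simps)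
      then show ?thesis using d0 by (intro add_left_mono mult_right_mono) auto
    qed
    finally show ?thesis using False by simp
  qed
  have "overlap_energy N \<tau> \<le> (\<Sum>p=2..N. \<beta>\<^sup>2 * (real N * x\<^sup>2 * ((if p = 2 then (\<theta> 2)\<^sup>2 / 2 else 0) + d * ((\<theta> p)\<^sup>2 / fact p)) + (\<theta> p)\<^sup>2 / fact (p - 2) * ?m p))"
    unfolding overlap_energy_def
  proof (rule sum_mono)
    fix p assume p: "p \<in> {2..N}"
    then have p2: "2 \<le> p" by simp
    show "\<beta>\<^sup>2 * (\<theta> p)\<^sup>2 / real N ^ (p - 1) * esym \<tau> N p
      \<le> \<beta>\<^sup>2 * (real N * x\<^sup>2 * ((if p = 2 then (\<theta> 2)\<^sup>2 / 2 else 0) + d * ((\<theta> p)\<^sup>2 / fact p)) + (\<theta> p)\<^sup>2 / fact (p - 2) * ?m p)"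
      unfolding overlap_energy_term[OF N p2] by (rule mult_left_mono[OF each[OF p]]) simp
  qed
  also have "\<dots> = \<beta>\<^sup>2 * (real N * x\<^sup>2 * ((\<Sum>p=2..N. if p = 2 then (\<theta> 2)\<^sup>2 / 2 else 0) + d * (\<Sum>p=2..N. (\<theta> p)\<^sup>2 / fact p)))
     + \<beta>\<^sup>2 * (\<Sum>p=2..N. (\<theta> p)\<^sup>2 / fact (p - 2) * ?m p)"
    by (simp only: sum_distrib_left sum.distrib distrib_left)
  also have "\<dots> \<le> \<beta>\<^sup>2 * (real N * x\<^sup>2 * ((\<theta> 2)\<^sup>2 / 2 + d * xi \<theta> 1))
     + \<beta>\<^sup>2 * (\<Sum>p=2..N. (\<theta> p)\<^sup>2 / fact (p - 2) * ?m p)"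
  proof (intro add_right_mono mult_left_mono add_mono)
    show "(\<Sum>p=2..N. if p = 2 then (\<theta> 2)\<^sup>2 / 2 else 0) \<le> (\<theta> 2)\<^sup>2 / 2"
      by (simp add: sum.delta)
    show "(\<Sum>p=2..N. (\<theta> p)\<^sup>2 / fact p) \<le> xi \<theta> 1"
      using partial_xi_le[of 1 N] by simp
  qed (use d0 in auto)
  also have "\<beta>\<^sup>2 * (real N * x\<^sup>2 * ((\<theta> 2)\<^sup>2 / 2 + d * xi \<theta> 1)) = (\<beta>\<^sup>2 * (\<theta> 2)\<^sup>2 + 2 * \<beta>\<^sup>2 * d * xi \<theta> 1) * (real N * x\<^sup>2 / 2)"
    by (simp add: field_simps)
  also have "\<dots> \<le> (ratio + 2 * \<beta>\<^sup>2 * d * xi \<theta> 1) * (real N * x\<^sup>2 / 2)"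
  proof (intro mult_right_mono add_right_mono)
    have "ratio * ((beta_f (xi \<theta>))\<^sup>2 * (\<theta> 2)\<^sup>2) \<le> ratio * 1"
      using ratio_bounds by (intro mult_left_mono theta_2_le) auto
    then show "\<beta>\<^sup>2 * (\<theta> 2)\<^sup>2 \<le> ratio" by (simp add: beta_sq mult_ac)
  qed auto
  finally have "overlap_energy N \<tau> \<le> (ratio + 2 * \<beta>\<^sup>2 * d * xi \<theta> 1) * ((\<Sum>k=1..N. \<tau> k)\<^sup>2 / (2 * real N))
     + \<beta>\<^sup>2 * (\<Sum>p=2..N. (\<theta> p)\<^sup>2 / fact (p - 2) * ?m p)"
    unfolding N2 by simp
  then show ?thesis unfolding sum_shift_2 times_divide_eq_right[of _ _ "2 * real N"] by simp
qed

text \<open>The weights tend to \<open>0\<close> for each \<open>k\<close>, and the coefficients are summable.\<close>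

lemma weighted_coeffs_small:
  assumes "0 < e"
  shows "\<exists>d0>0. \<forall>d\<in>{0<..d0}. \<forall>\<^sub>F N in sequentially.
           (\<Sum>k<N - 1. (\<theta> (k + 2))\<^sup>2 / fact k * min 1 (d + real (k + 2) / real N)) \<le> e"
proof -
  let ?c = "\<lambda>k. (\<theta> (k + 2))\<^sup>2 / fact k"
  have "(\<lambda>n. \<Sum>k<n. ?c k) \<longlonglongrightarrow> coeff_sum"
    using summable_LIMSEQ[OF coeffs_summable] by (simp add: coeff_sum_def)
  then have "\<forall>\<^sub>F n in sequentially. coeff_sum - e / 2 < (\<Sum>k<n. ?c k)"
    using assms by (intro order_tendstoD(1)) auto
  then obtain P where P: "coeff_sum - e / 2 < (\<Sum>k<P. ?c k)"
    by (auto simp: eventually_sequentially)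
  define d0 where "d0 = e / 4 / (coeff_sum + 1)"
  have K: "0 < coeff_sum + 1" using coeff_sum_nonneg by linarith
  show ?thesis
  proof (intro exI[of _ d0] conjI ballI)
    show "0 < d0" using assms K by (simp add: d0_def)
    fix d assume d: "d \<in> {0<..d0}"
    have "(\<lambda>N. coeff_sum * (real (P + 2) / real N)) \<longlonglongrightarrow> coeff_sum * 0"
      by (intro tendsto_mult tendsto_const lim_const_over_n)
    then have "\<forall>\<^sub>F N in sequentially. coeff_sum * (real (P + 2) / real N) < e / 4"
      using assms by (intro order_tendstoD(2)) auto
    then show "\<forall>\<^sub>F N in sequentially. (\<Sum>k<N - 1. ?c k * min 1 (d + real (k + 2) / real N)) \<le> e"
    proof (rule eventually_mono)
      fix N assume N: "coeff_sum * (real (P + 2) / real N) < e / 4"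
      define D where "D = d + real (P + 2) / real N"
      have D: "0 \<le> D" using d by (simp add: D_def)
      have "(\<Sum>k<N - 1. ?c k * min 1 (d + real (k + 2) / real N))
         \<le> (\<Sum>k<N - 1. ?c k * D + (if P \<le> k then ?c k else 0))"
      proof (rule sum_mono)
        fix k
        show "?c k * min 1 (d + real (k + 2) / real N) \<le> ?c k * D + (if P \<le> k then ?c k else 0)"
        proof (cases "P \<le> k")
          case True
          have "?c k * min 1 (d + real (k + 2) / real N) \<le> ?c k * 1" by (intro mult_left_mono) auto
          moreover have "0 \<le> ?c k * D" using D by simp
          ultimately show ?thesis using True by simp
        next
          case False
          then have "min 1 (d + real (k + 2) / real N) \<le> D"
            unfolding D_def by (intro min.coboundedI2 add_left_mono divide_right_mono) auto
          then have "?c k * min 1 (d + real (k + 2) / real N) \<le> ?c k * D"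
            by (intro mult_left_mono) auto
          then show ?thesis using False by simp
        qed
      qed
      also have "\<dots> = (\<Sum>k<N - 1. ?c k) * D + (\<Sum>k\<in>{P..<N - 1}. ?c k)"
      proof -
        have "(\<Sum>k<N - 1. if P \<le> k then ?c k else 0) = (\<Sum>k\<in>{P..<N - 1}. ?c k)"
          by (rule sum.mono_neutral_cong_right) auto
        then show ?thesis by (simp add: sum.distrib sum_distrib_right)
      qed
      also have "\<dots> \<le> coeff_sum * D + e / 2"
      proof (rule add_mono)
        show "(\<Sum>k<N - 1. ?c k) * D \<le> coeff_sum * D"
          by (intro mult_right_mono sum_coeffs_le D) auto
        have "(\<Sum>k\<in>{..<P} \<union> {P..<N - 1}. ?c k) \<le> coeff_sum" by (intro sum_coeffs_le) auto
        moreover have "(\<Sum>k\<in>{..<P} \<union> {P..<N - 1}. ?c k) = (\<Sum>k<P. ?c k) + (\<Sum>k\<in>{P..<N - 1}. ?c k)"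
          by (intro sum.union_disjoint) auto
        ultimately show "(\<Sum>k\<in>{P..<N - 1}. ?c k) \<le> e / 2" using P by linarith
      qed
      also have "coeff_sum * D = coeff_sum * d + coeff_sum * (real (P + 2) / real N)"
        by (simp add: D_def distrib_left)
      also have "coeff_sum * d \<le> e / 4"
      proof -
        have "coeff_sum * d \<le> (coeff_sum + 1) * d0"
          using d coeff_sum_nonneg by (intro mult_mono) auto
        also have "\<dots> = e / 4" using K unfolding d0_def by (subst nonzero_mult_div_cancel_left[symmetric, of "coeff_sum + 1" "e / 4"]) auto
        finally show ?thesis .
      qed
      finally show "(\<Sum>k<N - 1. ?c k * min 1 (d + real (k + 2) / real N)) \<le> e" using N by linarith
    qed
  qed
qed

lemma overlap_energy_near_0:
  assumes "ratio < r" "0 < e"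
  obtains d where "0 < d"
    and "\<forall>\<^sub>F N in sequentially. \<forall>\<tau>. (\<forall>k\<in>{1..N}. \<bar>\<tau> k\<bar> = 1) \<longrightarrow> \<bar>(\<Sum>k=1..N. \<tau> k) / real N\<bar> \<le> d \<longrightarrow>
           overlap_energy N \<tau> \<le> r * (\<Sum>k=1..N. \<tau> k)\<^sup>2 / (2 * real N) + e"
proof -
  have e: "0 < e / \<beta>\<^sup>2" using assms(2) beta_pos by simp
  obtain d0 where d0: "0 < d0"
    "\<forall>d\<in>{0<..d0}. \<forall>\<^sub>F N in sequentially.
       (\<Sum>k<N - 1. (\<theta> (k + 2))\<^sup>2 / fact k * min 1 (d + real (k + 2) / real N)) \<le> e / \<beta>\<^sup>2"
    using weighted_coeffs_small[OF e] by blast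
  define X where "X = 2 * \<beta>\<^sup>2 * xi \<theta> 1 + 1"
  have X: "0 < X" unfolding X_def using xi_1_nonneg by (intro add_nonneg_pos mult_nonneg_nonneg) auto
  define d where "d = min 1 (min d0 ((r - ratio) / X))"
  have d: "0 < d" "d \<le> 1" "d \<in> {0<..d0}" using d0 assms X by (auto simp: d_def)
  have "d \<le> (r - ratio) / X" by (simp add: d_def)
  then have "d * X \<le> r - ratio" using X by (simp add: pos_le_divide_eq)
  then have r: "ratio + 2 * \<beta>\<^sup>2 * d * xi \<theta> 1 \<le> r"
    using d(1) by (simp add: X_def algebra_simps)
  have ev: "\<forall>\<^sub>F N in sequentially. (\<Sum>k<N - 1. (\<theta> (k + 2))\<^sup>2 / fact k * min 1 (d + real (k + 2) / real N)) \<le> e / \<beta>\<^sup>2"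
    using d0(2) d(3) by blast
  show ?thesis
  proof (rule that[OF d(1)], use ev eventually_gt_at_top[of 0] in eventually_elim, intro allI impI)
    fix N \<tau> assume *: "(\<Sum>k<N - 1. (\<theta> (k + 2))\<^sup>2 / fact k * min 1 (d + real (k + 2) / real N)) \<le> e / \<beta>\<^sup>2"
      "0 < N" "\<forall>k\<in>{1..N}. \<bar>\<tau> k\<bar> = 1" "\<bar>(\<Sum>k=1..N. \<tau> k) / real N\<bar> \<le> d"
    have "overlap_energy N \<tau> \<le> (ratio + 2 * \<beta>\<^sup>2 * d * xi \<theta> 1) * (\<Sum>k=1..N. \<tau> k)\<^sup>2 / (2 * real N)
     + \<beta>\<^sup>2 * (\<Sum>k<N - 1. (\<theta> (k + 2))\<^sup>2 / fact k * min 1 (d + real (k + 2) / real N))"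
      by (rule overlap_energy_le_square) (use * d in auto)
    also have "\<dots> \<le> r * (\<Sum>k=1..N. \<tau> k)\<^sup>2 / (2 * real N) + \<beta>\<^sup>2 * (e / \<beta>\<^sup>2)"
      using * r by (intro add_mono divide_right_mono mult_right_mono mult_left_mono) auto
    finally show "overlap_energy N \<tau> \<le> r * (\<Sum>k=1..N. \<tau> k)\<^sup>2 / (2 * real N) + e"
      using beta_pos by simp
  qed
qed

end

section \<open>Moments of the couplings\<close>

definition index_set :: "nat \<Rightarrow> nat list set" where
  "index_set N = (\<Union>p\<in>{2..N}. tuples N p)"

lemma finite_index_set: "finite (index_set N)"
  by (simp add: index_set_def finite_tuples)

lemma index_set_subset: "index_set N \<subseteq> all_tuples"
  by (force simp: index_set_def all_tuples_def)

lemma length_tuples: "i \<in> tuples N p \<Longrightarrow> length i = p"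
  by (simp add: tuples_def)

lemma sum_index_set: "(\<Sum>i\<in>index_set N. f i) = (\<Sum>p=2..N. \<Sum>i\<in>tuples N p. f i)"
  unfolding index_set_def
  by (rule sum.UNION_disjoint) (auto simp: finite_tuples dest: length_tuples)

lemma prod_index_set: "(\<Prod>i\<in>index_set N. f i) = (\<Prod>p=2..N. \<Prod>i\<in>tuples N p. f i)"
  unfolding index_set_def
  by (rule prod.UNION_disjoint) (auto simp: finite_tuples dest: length_tuples)

lemma spin_prod_sign:
  assumes "\<And>k. k \<in> {1..N} \<Longrightarrow> \<bar>\<tau> k\<bar> = 1" "i \<in> index_set N"
  shows "\<bar>spin_prod \<tau> i\<bar> = 1"
proof -
  obtain p where "i \<in> tuples N p" using assms(2) by (auto simp: index_set_def)
  then show ?thesis using abs_spin_prod[of N \<tau> i p] assms(1) by blast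
qed

lemma spin_prod_mult: "spin_prod (\<lambda>k. \<sigma> k * \<sigma>' k) i = spin_prod \<sigma> i * spin_prod \<sigma>' i"
  by (simp add: spin_prod_def prod.distrib)

lemma configs_sign: "\<sigma> \<in> configs N \<Longrightarrow> k \<in> {1..N} \<Longrightarrow> \<bar>\<sigma> k\<bar> = 1"
  using configs_values[of \<sigma> N k] by auto

lemma borel_measurable_tanh_scaled [measurable]: "(\<lambda>x :: real. tanh (c * x)) \<in> borel_measurable borel"
  by (intro borel_measurable_continuous_onI continuous_intros) (simp add: cosh_real_nonzero)

definition coupling :: "(nat \<Rightarrow> real) \<Rightarrow> real \<Rightarrow> nat \<Rightarrow> nat \<Rightarrow> real" where
  "coupling \<theta> \<beta> N p = \<beta> * \<theta> p / real N powr ((real p - 1) / 2)"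

lemma coupling_sq:
  assumes "0 < N" "2 \<le> p"
  shows "(coupling \<theta> \<beta> N p)\<^sup>2 = \<beta>\<^sup>2 * (\<theta> p)\<^sup>2 / real N ^ (p - 1)"
proof -
  have "(real N powr ((real p - 1) / 2))\<^sup>2 = real N powr (real p - 1)"
    by (simp add: power2_eq_square powr_add[symmetric])
  also have "\<dots> = real N ^ (p - 1)"
    using assms powr_realpow[of "real N" "p - 1"] by (simp add: of_nat_diff)
  finally show ?thesis by (simp add: coupling_def power_divide power_mult_distrib)
qed

sublocale mixed_p_spin \<subseteq> spin_coeffs \<theta>
  by unfold_locales (rule theta_summable)

context mixed_p_spin
begin

abbreviation ref_tuple :: "nat list" where
  "ref_tuple \<equiv> [1, 2]"

lemma ref_tuple: "ref_tuple \<in> all_tuples"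
proof -
  have "ref_tuple \<in> tuples 2 2" by (auto simp: tuples_def)
  then show ?thesis unfolding all_tuples_def by blast
qed

lemma J_measurable [measurable]: "i \<in> all_tuples \<Longrightarrow> J i \<in> borel_measurable M"
  using J_indep by (simp add: indep_vars_def)

lemma integrable_J_power:
  assumes i: "i \<in> all_tuples" and n: "n \<le> 4"
  shows "integrable M (\<lambda>\<omega>. J i \<omega> ^ n)"
proof (rule Bochner_Integration.integrable_bound)
  show "integrable M (\<lambda>\<omega>. 1 + J i \<omega> ^ 4)"
    using J_fourth_moment[OF i] by simp
  show "(\<lambda>\<omega>. J i \<omega> ^ n) \<in> borel_measurable M" using i by measurable
  show "AE \<omega> in M. norm (J i \<omega> ^ n) \<le> norm (1 + J i \<omega> ^ 4)"
  proof (rule AE_I2)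
    fix \<omega>
    have "\<bar>J i \<omega>\<bar> ^ n \<le> 1 + \<bar>J i \<omega>\<bar> ^ 4"
    proof (cases "\<bar>J i \<omega>\<bar> \<le> 1")
      case True
      then have "\<bar>J i \<omega>\<bar> ^ n \<le> 1" by (intro power_le_one) auto
      then show ?thesis by (simp add: add_increasing2)
    next
      case False
      then have "\<bar>J i \<omega>\<bar> ^ n \<le> \<bar>J i \<omega>\<bar> ^ 4" using n by (intro power_increasing) auto
      then show ?thesis by simp
    qed
    then show "norm (J i \<omega> ^ n) \<le> norm (1 + J i \<omega> ^ 4)" by (simp add: power_abs)
  qed
qed

text \<open>All moments of couplings can be computed at one fixed tuple.\<close>

lemma expectation_ident:
  assumes "i \<in> all_tuples" and [measurable]: "g \<in> borel_measurable borel"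
  shows "expectation (\<lambda>\<omega>. g (J i \<omega>)) = expectation (\<lambda>\<omega>. g (J ref_tuple \<omega>) :: real)"
proof -
  have "expectation (\<lambda>\<omega>. g (J i \<omega>)) = integral\<^sup>L (distr M borel (J i)) g"
    using assms by (subst integral_distr) auto
  also have "\<dots> = integral\<^sup>L (distr M borel (J ref_tuple)) g"
    using J_ident[OF assms(1) ref_tuple] by simp
  also have "\<dots> = expectation (\<lambda>\<omega>. g (J ref_tuple \<omega>))"
    using ref_tuple by (subst integral_distr) auto
  finally show ?thesis .
qed

definition fourth_moment :: real where
  "fourth_moment = expectation (\<lambda>\<omega>. J ref_tuple \<omega> ^ 4)"

lemma fourth_moment: "i \<in> all_tuples \<Longrightarrow> expectation (\<lambda>\<omega>. J i \<omega> ^ 4) = fourth_moment"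
  unfolding fourth_moment_def by (rule expectation_ident) auto

lemma fourth_moment_nonneg: "0 \<le> fourth_moment"
  unfolding fourth_moment_def by (rule integral_nonneg_AE) simp

lemma second_moment: "i \<in> all_tuples \<Longrightarrow> expectation (\<lambda>\<omega>. (J i \<omega>)\<^sup>2) = 1"
  using J_variance[of i] J_mean[of i] by simp

lemma integrable_bounded_J:
  assumes "i \<in> all_tuples" and [measurable]: "g \<in> borel_measurable borel"
    and "\<And>x. \<bar>g x\<bar> \<le> (c :: real)"
  shows "integrable M (\<lambda>\<omega>. g (J i \<omega>))"
  using assms by (intro integrable_const_bound[of _ c]) auto

lemma expectation_prod_J:
  assumes [measurable]: "\<And>i. i \<in> index_set N \<Longrightarrow> g i \<in> borel_measurable borel"
    and bound: "\<And>i x. i \<in> index_set N \<Longrightarrow> \<bar>g i x\<bar> \<le> (c :: real)"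
  shows "expectation (\<lambda>\<omega>. \<Prod>i\<in>index_set N. g i (J i \<omega>)) = (\<Prod>i\<in>index_set N. expectation (\<lambda>\<omega>. g i (J i \<omega>)))"
    and "integrable M (\<lambda>\<omega>. \<Prod>i\<in>index_set N. g i (J i \<omega>))"
proof -
  have ind: "indep_vars (\<lambda>_. borel) (\<lambda>i \<omega>. g i (J i \<omega>)) (index_set N)"
    by (rule indep_vars_compose2[OF indep_vars_subset[OF J_indep index_set_subset]]) simp
  have int: "integrable M (\<lambda>\<omega>. g i (J i \<omega>))" if "i \<in> index_set N" for i
    using that index_set_subset by (intro integrable_bounded_J[of i "g i" c] bound) auto
  show "expectation (\<lambda>\<omega>. \<Prod>i\<in>index_set N. g i (J i \<omega>)) = (\<Prod>i\<in>index_set N. expectation (\<lambda>\<omega>. g i (J i \<omega>)))"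
    by (rule indep_vars_lebesgue_integral[OF finite_index_set ind int])
  show "integrable M (\<lambda>\<omega>. \<Prod>i\<in>index_set N. g i (J i \<omega>))"
    by (rule indep_vars_integrable[OF finite_index_set ind int])
qed

lemma integrable_tanh_J:
  assumes "i \<in> all_tuples"
  shows "integrable M (\<lambda>\<omega>. tanh (c * J i \<omega>))" "integrable M (\<lambda>\<omega>. (tanh (c * J i \<omega>))\<^sup>2)"
  using assms abs_tanh_le_1 tanh_sq_le_1
  by (auto intro!: integrable_bounded_J[of i "\<lambda>x. tanh (c * x)" 1] integrable_bounded_J[of i "\<lambda>x. (tanh (c * x))\<^sup>2" 1])

text \<open>Symmetry removes the terms linear in \<open>tanh\<close> from the mean and from the second moment of \<open>Z_hat\<close>.\<close>

lemma expectation_tanh_J: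
  assumes i: "i \<in> all_tuples"
  shows "expectation (\<lambda>\<omega>. tanh (c * J i \<omega>)) = 0"
proof -
  have "expectation (\<lambda>\<omega>. tanh (c * J i \<omega>)) = integral\<^sup>L (distr M borel (J i)) (\<lambda>x. tanh (c * x))"
    using i by (subst integral_distr) auto
  also have "\<dots> = integral\<^sup>L (distr M borel (\<lambda>\<omega>. - J i \<omega>)) (\<lambda>x. tanh (c * x))"
    using J_symmetric[OF i] by simp
  also have "\<dots> = expectation (\<lambda>\<omega>. tanh (c * (- J i \<omega>)))"
    using i by (subst integral_distr) auto
  also have "\<dots> = - expectation (\<lambda>\<omega>. tanh (c * J i \<omega>))"
    by simp
  finally show ?thesis by simp
qed

definition tanh_moment :: "real \<Rightarrow> real" where
  "tanh_moment c = expectation (\<lambda>\<omega>. (tanh (c * J ref_tuple \<omega>))\<^sup>2)"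

lemma tanh_moment: "i \<in> all_tuples \<Longrightarrow> expectation (\<lambda>\<omega>. (tanh (c * J i \<omega>))\<^sup>2) = tanh_moment c"
  unfolding tanh_moment_def by (rule expectation_ident) auto

lemma tanh_moment_bounds: "0 \<le> tanh_moment c" "tanh_moment c \<le> 1" "tanh_moment c \<le> c\<^sup>2"
    "c\<^sup>2 - c^4 * fourth_moment \<le> tanh_moment c"
proof -
  note int = integrable_tanh_J(2)[OF ref_tuple, of c] integrable_J_power[OF ref_tuple, of 2]
    J_fourth_moment[OF ref_tuple]
  show "0 \<le> tanh_moment c" unfolding tanh_moment_def by (rule integral_nonneg_AE) simp
  have "tanh_moment c \<le> expectation (\<lambda>_. 1)"
    unfolding tanh_moment_def by (intro integral_mono int tanh_sq_le_1) auto
  then show "tanh_moment c \<le> 1" by (simp add: prob_space)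
  have "tanh_moment c \<le> expectation (\<lambda>\<omega>. (c * J ref_tuple \<omega>)\<^sup>2)"
    unfolding tanh_moment_def
    by (intro integral_mono int tanh_sq_le) (use int in \<open>auto simp: power_mult_distrib\<close>)
  then show "tanh_moment c \<le> c\<^sup>2" using second_moment[OF ref_tuple] by (simp add: power_mult_distrib)
  have "expectation (\<lambda>\<omega>. (c * J ref_tuple \<omega>)\<^sup>2 - (c * J ref_tuple \<omega>)^4) \<le> tanh_moment c"
    unfolding tanh_moment_def
    by (intro integral_mono int tanh_sq_ge) (use int in \<open>auto simp: power_mult_distrib\<close>)
  moreover have "expectation (\<lambda>\<omega>. (c * J ref_tuple \<omega>)\<^sup>2 - (c * J ref_tuple \<omega>)^4) = c\<^sup>2 - c^4 * fourth_moment"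
    using int second_moment[OF ref_tuple] fourth_moment[OF ref_tuple] by (simp add: power_mult_distrib)
  ultimately show "c\<^sup>2 - c^4 * fourth_moment \<le> tanh_moment c" by simp
qed

section \<open>The second moment\<close>

lemma Z_hat_eq:
  "Z_hat J \<theta> N \<beta> h \<omega> = (\<Sum>\<sigma>\<in>configs N. (\<Prod>k=1..N. spin_weight h (\<sigma> k)) *
     (\<Prod>i\<in>index_set N. 1 + spin_prod \<sigma> i * tanh (coupling \<theta> \<beta> N (length i) * J i \<omega>)))"
  unfolding Z_hat_def expectation_config prod_index_set
  by (intro sum.cong arg_cong2[where f = "(*)"] prod.cong refl) (auto simp: coupling_def dest: length_tuples)

lemma Z_hat_factor_bound:
  assumes "\<sigma> \<in> configs N" "i \<in> index_set N"
  shows "0 < 1 + spin_prod \<sigma> i * tanh y" "\<bar>1 + spin_prod \<sigma> i * tanh y\<bar> \<le> 2"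
proof -
  have "\<bar>spin_prod \<sigma> i\<bar> = 1" using spin_prod_sign[of N \<sigma> i] configs_sign[OF assms(1)] assms(2) by blast
  then have "\<bar>spin_prod \<sigma> i * tanh y\<bar> < 1"
    using tanh_real_bounds[of y] by (auto simp: abs_mult)
  then show "0 < 1 + spin_prod \<sigma> i * tanh y" "\<bar>1 + spin_prod \<sigma> i * tanh y\<bar> \<le> 2" by linarith+
qed

lemma Z_hat_pos: "0 < Z_hat J \<theta> N \<beta> h \<omega>"
  unfolding Z_hat_eq
proof (rule sum_pos)
  show "finite (configs N)" by (rule finite_configs)
  show "configs N \<noteq> {}" by (auto simp: configs_def PiE_eq_empty_iff)
  fix \<sigma> assume "\<sigma> \<in> configs N"
  then show "0 < (\<Prod>k=1..N. spin_weight h (\<sigma> k)) *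
     (\<Prod>i\<in>index_set N. 1 + spin_prod \<sigma> i * tanh (coupling \<theta> \<beta> N (length i) * J i \<omega>))"
    by (intro mult_pos_pos prod_pos spin_weight_pos Z_hat_factor_bound ballI) auto
qed

lemma expectation_Z_hat:
  "integrable M (Z_hat J \<theta> N \<beta> h)" "expectation (Z_hat J \<theta> N \<beta> h) = 1"
proof -
  let ?c = "\<lambda>i. coupling \<theta> \<beta> N (length i)"
  have P: "integrable M (\<lambda>\<omega>. \<Prod>i\<in>index_set N. 1 + spin_prod \<sigma> i * tanh (?c i * J i \<omega>))"
    "expectation (\<lambda>\<omega>. \<Prod>i\<in>index_set N. 1 + spin_prod \<sigma> i * tanh (?c i * J i \<omega>)) = 1"
    if \<sigma>: "\<sigma> \<in> configs N" for \<sigma>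
  proof -
    note * = expectation_prod_J[of N "\<lambda>i x. 1 + spin_prod \<sigma> i * tanh (?c i * x)" 2,
        OF _ Z_hat_factor_bound(2)[OF \<sigma>]]
    show "integrable M (\<lambda>\<omega>. \<Prod>i\<in>index_set N. 1 + spin_prod \<sigma> i * tanh (?c i * J i \<omega>))"
      by (rule *(2)) auto
    have "expectation (\<lambda>\<omega>. \<Prod>i\<in>index_set N. 1 + spin_prod \<sigma> i * tanh (?c i * J i \<omega>))
       = (\<Prod>i\<in>index_set N. expectation (\<lambda>\<omega>. 1 + spin_prod \<sigma> i * tanh (?c i * J i \<omega>)))"
      by (rule *(1)) auto
    also have "\<dots> = (\<Prod>i\<in>index_set N. 1)"
    proof (rule prod.cong[OF refl])
      fix i assume "i \<in> index_set N"
      then have "i \<in> all_tuples" using index_set_subset by auto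
      then show "expectation (\<lambda>\<omega>. 1 + spin_prod \<sigma> i * tanh (?c i * J i \<omega>)) = 1"
        using integrable_tanh_J(1)[of i "?c i"] by (simp add: expectation_tanh_J prob_space)
    qed
    finally show "expectation (\<lambda>\<omega>. \<Prod>i\<in>index_set N. 1 + spin_prod \<sigma> i * tanh (?c i * J i \<omega>)) = 1"
      by simp
  qed
  show "integrable M (Z_hat J \<theta> N \<beta> h)"
    unfolding Z_hat_eq[abs_def] by (intro Bochner_Integration.integrable_sum integrable_mult_right P)
  have "expectation (Z_hat J \<theta> N \<beta> h) = (\<Sum>\<sigma>\<in>configs N. (\<Prod>k=1..N. spin_weight h (\<sigma> k)) * 1)"
    unfolding Z_hat_eq[abs_def]
    by (subst Bochner_Integration.integral_sum) (auto simp: P)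
  also have "\<dots> = 1"
    using expectation_config[of N h "\<lambda>_. 1"] by simp
  finally show "expectation (Z_hat J \<theta> N \<beta> h) = 1" .
qed

text \<open>Linear terms in \<open>tanh\<close> average out, and the quadratic ones carry \<open>spin_prod \<sigma> i * spin_prod \<sigma>' i\<close>.\<close>

lemma second_moment_Z_hat:
  "integrable M (\<lambda>\<omega>. (Z_hat J \<theta> N \<beta> h \<omega>)\<^sup>2)"
  "expectation (\<lambda>\<omega>. (Z_hat J \<theta> N \<beta> h \<omega>)\<^sup>2)
     = overlap_expectation N h (\<lambda>\<tau>. \<Prod>i\<in>index_set N. 1 + spin_prod \<tau> i * tanh_moment (coupling \<theta> \<beta> N (length i)))"
proof -
  let ?c = "\<lambda>i. coupling \<theta> \<beta> N (length i)"
  let ?g = "\<lambda>\<sigma> \<sigma>' i x. (1 + spin_prod \<sigma> i * tanh (?c i * x)) * (1 + spin_prod \<sigma>' i * tanh (?c i * x))"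
  let ?W = "\<lambda>\<sigma>. \<Prod>k=1..N. spin_weight h (\<sigma> k)"
  have sq: "(Z_hat J \<theta> N \<beta> h \<omega>)\<^sup>2 = (\<Sum>\<sigma>\<in>configs N. \<Sum>\<sigma>'\<in>configs N.
      ?W \<sigma> * ?W \<sigma>' * (\<Prod>i\<in>index_set N. ?g \<sigma> \<sigma>' i (J i \<omega>)))" for \<omega>
    unfolding Z_hat_eq power2_eq_square sum_product
    by (intro sum.cong refl) (simp add: prod.distrib mult_ac)
  have P: "integrable M (\<lambda>\<omega>. \<Prod>i\<in>index_set N. ?g \<sigma> \<sigma>' i (J i \<omega>))"
    "expectation (\<lambda>\<omega>. \<Prod>i\<in>index_set N. ?g \<sigma> \<sigma>' i (J i \<omega>))
       = (\<Prod>i\<in>index_set N. 1 + spin_prod (\<lambda>k. \<sigma> k * \<sigma>' k) i * tanh_moment (?c i))"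
    if \<sigma>: "\<sigma> \<in> configs N" "\<sigma>' \<in> configs N" for \<sigma> \<sigma>'
  proof -
    have bd: "\<bar>?g \<sigma> \<sigma>' i x\<bar> \<le> 4" if "i \<in> index_set N" for i x
    proof -
      have "\<bar>?g \<sigma> \<sigma>' i x\<bar> \<le> 2 * 2" unfolding abs_mult
        by (intro mult_mono Z_hat_factor_bound(2)[where N = N] that \<sigma>) auto
      then show ?thesis by simp
    qed
    note * = expectation_prod_J[of N "?g \<sigma> \<sigma>'" 4, OF _ bd]
    show "integrable M (\<lambda>\<omega>. \<Prod>i\<in>index_set N. ?g \<sigma> \<sigma>' i (J i \<omega>))"
      by (rule *(2)) auto
    have "expectation (\<lambda>\<omega>. \<Prod>i\<in>index_set N. ?g \<sigma> \<sigma>' i (J i \<omega>))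
       = (\<Prod>i\<in>index_set N. expectation (\<lambda>\<omega>. ?g \<sigma> \<sigma>' i (J i \<omega>)))"
      by (rule *(1)) auto
    also have "\<dots> = (\<Prod>i\<in>index_set N. 1 + spin_prod (\<lambda>k. \<sigma> k * \<sigma>' k) i * tanh_moment (?c i))"
    proof (rule prod.cong[OF refl])
      fix i assume "i \<in> index_set N"
      then have i: "i \<in> all_tuples" using index_set_subset by auto
      let ?t = "\<lambda>\<omega>. tanh (?c i * J i \<omega>)"
      have "?g \<sigma> \<sigma>' i (J i \<omega>) = 1 + (spin_prod \<sigma> i + spin_prod \<sigma>' i) * ?t \<omega> + spin_prod \<sigma> i * spin_prod \<sigma>' i * (?t \<omega>)\<^sup>2" for \<omega>
        by (simp add: algebra_simps power2_eq_square)
      then have "expectation (\<lambda>\<omega>. ?g \<sigma> \<sigma>' i (J i \<omega>))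
         = expectation (\<lambda>\<omega>. 1 + (spin_prod \<sigma> i + spin_prod \<sigma>' i) * ?t \<omega> + spin_prod \<sigma> i * spin_prod \<sigma>' i * (?t \<omega>)\<^sup>2)"
        by simp
      also have "\<dots> = 1 + spin_prod \<sigma> i * spin_prod \<sigma>' i * tanh_moment (?c i)"
        using integrable_tanh_J[OF i, of "?c i"]
        by (simp add: expectation_tanh_J[OF i] tanh_moment[OF i] prob_space)
      finally show "expectation (\<lambda>\<omega>. ?g \<sigma> \<sigma>' i (J i \<omega>)) = 1 + spin_prod (\<lambda>k. \<sigma> k * \<sigma>' k) i * tanh_moment (?c i)"
        by (simp add: spin_prod_mult)
    qed
    finally show "expectation (\<lambda>\<omega>. \<Prod>i\<in>index_set N. ?g \<sigma> \<sigma>' i (J i \<omega>))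
       = (\<Prod>i\<in>index_set N. 1 + spin_prod (\<lambda>k. \<sigma> k * \<sigma>' k) i * tanh_moment (?c i))" .
  qed
  show "integrable M (\<lambda>\<omega>. (Z_hat J \<theta> N \<beta> h \<omega>)\<^sup>2)"
    unfolding sq by (intro Bochner_Integration.integrable_sum integrable_mult_right P)
  have "expectation (\<lambda>\<omega>. (Z_hat J \<theta> N \<beta> h \<omega>)\<^sup>2) = (\<Sum>\<sigma>\<in>configs N. \<Sum>\<sigma>'\<in>configs N.
      ?W \<sigma> * ?W \<sigma>' * expectation (\<lambda>\<omega>. \<Prod>i\<in>index_set N. ?g \<sigma> \<sigma>' i (J i \<omega>)))"
    unfolding sq using P(1)
    by (subst Bochner_Integration.integral_sum, intro Bochner_Integration.integrable_sum integrable_mult_right, assumption+)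
       (intro sum.cong refl, subst Bochner_Integration.integral_sum, auto intro!: integrable_mult_right)
  also have "\<dots> = overlap_expectation N h (\<lambda>\<tau>. \<Prod>i\<in>index_set N. 1 + spin_prod \<tau> i * tanh_moment (?c i))"
    unfolding overlap_expectation_def by (intro sum.cong refl) (simp add: P(2))
  finally show "expectation (\<lambda>\<omega>. (Z_hat J \<theta> N \<beta> h \<omega>)\<^sup>2)
     = overlap_expectation N h (\<lambda>\<tau>. \<Prod>i\<in>index_set N. 1 + spin_prod \<tau> i * tanh_moment (?c i))" .
qed

end

lemma fact_le_power: "1 \<le> k \<Longrightarrow> k \<le> N \<Longrightarrow> (fact k :: real) \<le> real N ^ (k - 1)"
proof (induction k rule: dec_induct)
  case (step k)
  have "(fact (Suc k) :: real) = real (Suc k) * fact k" by simp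
  also have "\<dots> \<le> real N * real N ^ (k - 1)"
    using step by (intro mult_mono) auto
  also have "\<dots> = real N ^ (Suc k - 1)" using step by (cases k) auto
  finally show ?case .
qed simp

lemma exp_linear_decay:
  fixes a b c :: real
  assumes "0 < c" "0 \<le> b"
  shows "(\<lambda>N. exp (a - c * real N) * ((2 * real N + 1) * exp (b * sqrt (real N)))) \<longlonglongrightarrow> 0"
proof -
  define x where "x = exp (- c / 2)"
  have x: "norm x < 1" using assms by (simp add: x_def)
  define K where "K = exp (a + b\<^sup>2 / (2 * c))"
  have "(\<lambda>N. K * (2 * (real N * x ^ N) + x ^ N)) \<longlonglongrightarrow> K * (2 * 0 + 0)"
    by (intro tendsto_mult tendsto_add tendsto_const powser_times_n_limit_0 LIMSEQ_power_zero x)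
  then have lim: "(\<lambda>N. K * (2 * (real N * x ^ N) + x ^ N)) \<longlonglongrightarrow> 0" by simp
  show ?thesis
  proof (rule tendsto_sandwich[OF _ _ tendsto_const lim])
    show "\<forall>\<^sub>F N in sequentially. exp (a - c * real N) * ((2 * real N + 1) * exp (b * sqrt (real N)))
        \<le> K * (2 * (real N * x ^ N) + x ^ N)"
    proof (rule always_eventually, rule allI)
      fix N
      \<comment> \<open>Half of the linear decay absorbs the square root.\<close>
      have "0 \<le> (b - c * sqrt (real N))\<^sup>2 / (2 * c)" using assms by simp
      also have "\<dots> = b\<^sup>2 / (2 * c) - b * sqrt (real N) + c / 2 * real N"
        using assms by (simp add: power2_eq_square field_simps)
      finally have "a - c * real N + b * sqrt (real N) \<le> (a + b\<^sup>2 / (2 * c)) + real N * (- c / 2)"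
        by (simp add: field_simps)
      then have "exp (a - c * real N) * exp (b * sqrt (real N)) \<le> K * x ^ N"
        unfolding K_def x_def exp_of_nat_mult[symmetric] exp_add[symmetric] by simp
      then have "(2 * real N + 1) * (exp (a - c * real N) * exp (b * sqrt (real N))) \<le> (2 * real N + 1) * (K * x ^ N)"
        by (intro mult_left_mono) auto
      then show "exp (a - c * real N) * ((2 * real N + 1) * exp (b * sqrt (real N)))
        \<le> K * (2 * (real N * x ^ N) + x ^ N)" by (simp add: algebra_simps)
    qed
  qed auto
qed

context mixed_p_spin
begin

text \<open>By summability, \<open>\<theta> p ^ 4\<close> is at most \<open>coeff_sum * fact (p - 2) * (\<theta> p)\<^sup>2\<close>, and the powers of \<open>N\<close>
  absorb the factorial.\<close>

lemma coupling_fourth_le: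
  assumes "2 \<le> p" "p \<le> N"
  shows "(coupling \<theta> \<beta> N p)^4 * (real N ^ p / fact p) \<le> \<beta>^4 * coeff_sum * ((\<theta> p)\<^sup>2 / fact p)"
    and "3 \<le> p \<Longrightarrow> (coupling \<theta> \<beta> N p)^4 * (real N ^ p / fact p) \<le> \<beta>^4 * coeff_sum * ((\<theta> p)\<^sup>2 / fact p) / real N"
proof -
  obtain k where k: "p = k + 2" using assms(1) by (metis add.commute le_Suc_ex)
  have N: "0 < N" using assms by simp
  have "(coupling \<theta> \<beta> N p)^4 = ((coupling \<theta> \<beta> N p)\<^sup>2)\<^sup>2" by simp
  also have "\<dots> = (\<beta>\<^sup>2 * (\<theta> p)\<^sup>2 / real N ^ (p - 1))\<^sup>2" unfolding coupling_sq[OF N assms(1)] ..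
  also have "\<dots> = \<beta>^4 * (\<theta> p)^4 / (real N ^ (p - 1) * real N ^ (p - 1))"
    by (simp add: power_divide power_mult_distrib power2_eq_square power4_eq_xxxx)
  finally have "(coupling \<theta> \<beta> N p)^4 * (real N ^ p / fact p)
     = \<beta>^4 * ((\<theta> p)\<^sup>2 * (\<theta> p)\<^sup>2) / (real N ^ (p - 1) * real N ^ (p - 1)) * (real N ^ p / fact p)"
    by (simp add: power2_eq_square power4_eq_xxxx mult.assoc)
  also have "\<dots> = \<beta>^4 * (\<theta> p)\<^sup>2 * ((\<theta> p)\<^sup>2 / fact p) / real N ^ k"
    using N by (simp add: k field_simps)
  finally have eq: "(coupling \<theta> \<beta> N p)^4 * (real N ^ p / fact p)
     = \<beta>^4 * (\<theta> p)\<^sup>2 * ((\<theta> p)\<^sup>2 / fact p) / real N ^ k" .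
  also have "\<dots> \<le> \<beta>^4 * (coeff_sum * fact k) * ((\<theta> p)\<^sup>2 / fact p) / real N ^ k"
    using coeff_le[of k] unfolding k
    by (intro divide_right_mono mult_right_mono mult_left_mono) auto
  finally have le: "(coupling \<theta> \<beta> N p)^4 * (real N ^ p / fact p)
     \<le> \<beta>^4 * coeff_sum * ((\<theta> p)\<^sup>2 / fact p) * (fact k / real N ^ k)" by (simp add: mult_ac)
  have nn: "0 \<le> \<beta>^4 * coeff_sum * ((\<theta> p)\<^sup>2 / fact p)"
    using coeff_sum_nonneg by auto
  have "(fact k :: real) / real N ^ k \<le> 1"
  proof (cases "k = 0")
    case False
    then have "(fact k :: real) \<le> real N ^ (k - 1)" using assms k by (intro fact_le_power) auto
    also have "\<dots> \<le> real N ^ k" using N by (intro power_increasing) auto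
    finally show ?thesis using N by simp
  qed simp
  from mult_left_mono[OF this nn] le
  show "(coupling \<theta> \<beta> N p)^4 * (real N ^ p / fact p) \<le> \<beta>^4 * coeff_sum * ((\<theta> p)\<^sup>2 / fact p)" by simp
  assume p: "3 \<le> p"
  then obtain q where q: "k = Suc q" using k by (cases k) auto
  have "(fact k :: real) / real N ^ k \<le> real N ^ (k - 1) / real N ^ k"
    using p assms k by (intro divide_right_mono fact_le_power) auto
  also have "\<dots> = 1 / real N" using N by (simp add: q)
  finally have "(fact k :: real) / real N ^ k \<le> 1 / real N" .
  from mult_left_mono[OF this nn] le
  show "(coupling \<theta> \<beta> N p)^4 * (real N ^ p / fact p) \<le> \<beta>^4 * coeff_sum * ((\<theta> p)\<^sup>2 / fact p) / real N"
    by simp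
qed

lemma sum_coeff_fact_le: "(\<Sum>p=2..N. (\<theta> p)\<^sup>2 / fact p) \<le> xi \<theta> 1"
  using partial_xi_le[of 1 N] by simp

definition moment_error :: "real \<Rightarrow> real" where
  "moment_error \<beta> = fourth_moment * \<beta>^4 * coeff_sum * xi \<theta> 1"

text \<open>Replacing \<open>tanh\<^sup>2\<close> by the square costs \<open>O(1 / N)\<close>: for \<open>p = 2\<close> because a negative \<open>esym \<tau> N 2\<close> is only
  of order \<open>N\<close>, for \<open>p \<ge> 3\<close> because the fourth powers of the couplings are small enough.\<close>

lemma tanh_moment_esym_le:
  assumes sign: "\<And>k. k \<in> {1..N} \<Longrightarrow> \<bar>\<tau> k\<bar> = 1" and p: "2 \<le> p" "p \<le> N"
  shows "tanh_moment (coupling \<theta> \<beta> N p) * esym \<tau> N p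
    \<le> \<beta>\<^sup>2 * (\<theta> p)\<^sup>2 / real N ^ (p - 1) * esym \<tau> N p
      + fourth_moment * (\<beta>^4 * coeff_sum * ((\<theta> p)\<^sup>2 / fact p) / real N)"
proof -
  define c where "c = coupling \<theta> \<beta> N p"
  have N: "0 < N" using p by simp
  have err: "0 \<le> fourth_moment * (\<beta>^4 * coeff_sum * ((\<theta> p)\<^sup>2 / fact p) / real N)"
    using fourth_moment_nonneg coeff_sum_nonneg by auto
  have csq: "\<beta>\<^sup>2 * (\<theta> p)\<^sup>2 / real N ^ (p - 1) = c\<^sup>2" using coupling_sq[OF N p(1)] by (simp add: c_def)
  have "(c\<^sup>2 - tanh_moment c) * - esym \<tau> N p
     \<le> fourth_moment * (\<beta>^4 * coeff_sum * ((\<theta> p)\<^sup>2 / fact p) / real N)"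
  proof (cases "esym \<tau> N p \<le> 0")
    case True
    then have "(c\<^sup>2 - tanh_moment c) * - esym \<tau> N p \<le> (c^4 * fourth_moment) * - esym \<tau> N p"
      using tanh_moment_bounds(4)[of c] by (intro mult_right_mono) auto
    also have "\<dots> = fourth_moment * (c^4 * - esym \<tau> N p)" by simp
    also have "\<dots> \<le> fourth_moment * (\<beta>^4 * coeff_sum * ((\<theta> p)\<^sup>2 / fact p) / real N)"
    proof (rule mult_left_mono[OF _ fourth_moment_nonneg])
      show "c^4 * - esym \<tau> N p \<le> \<beta>^4 * coeff_sum * ((\<theta> p)\<^sup>2 / fact p) / real N"
      proof (cases "p = 2")
        case True
        have "c^4 * - esym \<tau> N p \<le> c^4 * (real N ^ p / fact p / real N)"
        proof (rule mult_left_mono)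
          have "- esym \<tau> N 2 \<le> real N / 2" using esym_2_ge[of N \<tau>] sign by fastforce
          then show "- esym \<tau> N p \<le> real N ^ p / fact p / real N"
            using N by (simp add: True power2_eq_square)
        qed simp
        also have "\<dots> = c^4 * (real N ^ p / fact p) / real N" by simp
        also have "\<dots> \<le> \<beta>^4 * coeff_sum * ((\<theta> p)\<^sup>2 / fact p) / real N"
          using coupling_fourth_le(1)[OF p] unfolding c_def by (intro divide_right_mono) auto
        finally show ?thesis .
      next
        case False
        have "- esym \<tau> N p \<le> real N ^ p / fact p" using abs_esym_le[of N \<tau> p] sign by fastforce
        then have "c^4 * - esym \<tau> N p \<le> c^4 * (real N ^ p / fact p)" by (intro mult_left_mono) auto
        also have "\<dots> \<le> \<beta>^4 * coeff_sum * ((\<theta> p)\<^sup>2 / fact p) / real N"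
          using coupling_fourth_le(2)[OF p] p False unfolding c_def by auto
        finally show ?thesis .
      qed
    qed
    finally show ?thesis .
  next
    case False
    then have "(c\<^sup>2 - tanh_moment c) * - esym \<tau> N p \<le> 0"
      using tanh_moment_bounds(3)[of c] by (intro mult_nonneg_nonpos) auto
    then show ?thesis using err by linarith
  qed
  then have "tanh_moment c * esym \<tau> N p \<le> c\<^sup>2 * esym \<tau> N p
      + fourth_moment * (\<beta>^4 * coeff_sum * ((\<theta> p)\<^sup>2 / fact p) / real N)"
    by (simp add: algebra_simps)
  then show ?thesis unfolding csq unfolding c_def .
qed

lemma overlap_product_le:
  assumes sign: "\<And>k. k \<in> {1..N} \<Longrightarrow> \<bar>\<tau> k\<bar> = 1" and "below_beta_f \<theta> \<beta>"
  shows "(\<Prod>i\<in>index_set N. 1 + spin_prod \<tau> i * tanh_moment (coupling \<theta> \<beta> N (length i)))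
    \<le> exp (below_beta_f.overlap_energy \<theta> \<beta> N \<tau> + moment_error \<beta> / real N)"
proof -
  interpret below_beta_f \<theta> \<beta> by fact
  let ?a = "\<lambda>i. tanh_moment (coupling \<theta> \<beta> N (length i))"
  have "(\<Prod>i\<in>index_set N. 1 + spin_prod \<tau> i * ?a i) \<le> (\<Prod>i\<in>index_set N. exp (spin_prod \<tau> i * ?a i))"
  proof (rule prod_mono)
    fix i assume i: "i \<in> index_set N"
    have "\<bar>spin_prod \<tau> i * ?a i\<bar> \<le> 1"
      using spin_prod_sign[of N \<tau> i] sign i tanh_moment_bounds(1,2)[of "coupling \<theta> \<beta> N (length i)"]
      by (simp add: abs_mult)
    then show "0 \<le> 1 + spin_prod \<tau> i * ?a i \<and> 1 + spin_prod \<tau> i * ?a i \<le> exp (spin_prod \<tau> i * ?a i)"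
      using exp_ge_add_one_self[of "spin_prod \<tau> i * ?a i"] by linarith
  qed
  also have "\<dots> = exp (\<Sum>i\<in>index_set N. spin_prod \<tau> i * ?a i)"
    by (simp add: exp_sum finite_index_set)
  also have "(\<Sum>i\<in>index_set N. spin_prod \<tau> i * ?a i) = (\<Sum>p=2..N. tanh_moment (coupling \<theta> \<beta> N p) * esym \<tau> N p)"
    unfolding sum_index_set esym_def sum_distrib_left
    by (intro sum.cong refl) (auto dest: length_tuples)
  also have "\<dots> \<le> (\<Sum>p=2..N. \<beta>\<^sup>2 * (\<theta> p)\<^sup>2 / real N ^ (p - 1) * esym \<tau> N p
      + fourth_moment * (\<beta>^4 * coeff_sum * ((\<theta> p)\<^sup>2 / fact p) / real N))"
    by (intro sum_mono tanh_moment_esym_le) (use sign in auto)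
  also have "\<dots> = overlap_energy N \<tau> + fourth_moment * \<beta>^4 * coeff_sum / real N * (\<Sum>p=2..N. (\<theta> p)\<^sup>2 / fact p)"
    by (simp add: sum.distrib overlap_energy_def sum_distrib_left sum_divide_distrib mult_ac)
  also have "\<dots> \<le> overlap_energy N \<tau> + fourth_moment * \<beta>^4 * coeff_sum / real N * xi \<theta> 1"
    using fourth_moment_nonneg coeff_sum_nonneg
    by (intro add_left_mono mult_left_mono sum_coeff_fact_le) auto
  finally show ?thesis by (simp add: moment_error_def)
qed

text \<open>The field enters only through the mean \<open>(tanh h)\<^sup>2\<close> of the overlap signs, of order at most \<open>N powr (-1/2)\<close>:
  visible on the Gaussian scale of the overlaps near \<open>0\<close>, and too weak to compensate the exponential decay
  away from \<open>0\<close>. Any \<open>r'\<close> slightly above \<open>r\<close> can absorb what the structure function adds to its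
  quadratic part near \<open>0\<close>; the exponent \<open>r / (2 * (1 - r))\<close> of the Gaussian integral is below \<open>r / (1 - r)\<close>,
  so there is room for this.\<close>

lemma second_moment_bound:
  fixes h :: "nat \<Rightarrow> real"
  assumes "below_beta_f \<theta> \<beta>"
    and \<rho>: "0 < \<rho>" and h: "\<And>N. 0 < N \<Longrightarrow> real N * h N ^ 4 \<le> \<rho> ^ 4"
  defines "r \<equiv> below_beta_f.ratio \<theta> \<beta>"
  shows "\<forall>\<^sub>F N in sequentially.
     expectation (\<lambda>\<omega>. (Z_hat J \<theta> N \<beta> (h N) \<omega>)\<^sup>2) \<le> 2 / sqrt (1 - r) * exp (\<rho>^4 * r / (1 - r))"
proof -
  interpret below_beta_f \<theta> \<beta> by fact
  have r: "0 < r" "r < 1" using ratio_bounds by (auto simp: r_def)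
  define B where "B = exp (\<rho>^4 * r / (1 - r)) / sqrt (1 - r)"
  have B1: "1 \<le> B"
  proof -
    have "1 \<le> exp (\<rho>^4 * r / (1 - r))" using r by simp
    moreover have "sqrt (1 - r) \<le> 1" using r by simp
    ultimately have "sqrt (1 - r) \<le> exp (\<rho>^4 * r / (1 - r))" by linarith
    then show ?thesis using r by (simp add: B_def)
  qed
  obtain r' where r': "r < r'" "r' < 1"
    "exp (r' * \<rho>^4 / (2 * (1 - r'))) / sqrt (1 - r') < 5/4 * B"
  proof -
    let ?f = "\<lambda>s. exp (s * \<rho>^4 / (2 * (1 - s))) / sqrt (1 - s)"
    have "isCont ?f r" using r by (intro continuous_intros) auto
    then have lim: "(?f \<longlongrightarrow> ?f r) (at_right r)" by (simp add: isCont_def filterlim_at_split)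
    have "?f r \<le> B"
    proof -
      have "r * \<rho>^4 / (2 * (1 - r)) \<le> \<rho>^4 * r / (1 - r)" using r \<rho> by (simp add: field_simps)
      then show ?thesis unfolding B_def using r by (intro divide_right_mono) auto
    qed
    then have "?f r < 5/4 * B" using B1 by linarith
    then have "\<forall>\<^sub>F s in at_right r. ?f s < 5/4 * B" by (rule order_tendstoD(2)[OF lim])
    moreover have "\<forall>\<^sub>F s in at_right r. s \<in> {r<..<1}" using r(2) by (rule eventually_at_right_real)
    ultimately have "\<forall>\<^sub>F s in at_right r. ?f s < 5/4 * B \<and> s \<in> {r<..<1}" by (rule eventually_conj)
    then obtain s where "?f s < 5/4 * B \<and> s \<in> {r<..<1}"
      using eventually_happens trivial_limit_at_right_real by blast
    then show ?thesis by (intro that[of s]) auto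
  qed
  \<comment> \<open>\<open>6/5 * 5/4 = 3/2\<close> leaves \<open>1/2\<close> for the overlaps away from \<open>0\<close>; \<open>e\<close> is spent twice, on the energy near \<open>0\<close>
    and on replacing \<open>tanh\<close> by its argument.\<close>
  define e where "e = ln (6/5 :: real) / 2"
  have e: "0 < e" by (simp add: e_def)
  have exp2e: "exp (e + e) = 6/5" by (simp add: e_def)
  obtain d where d: "0 < d"
    and near: "\<forall>\<^sub>F N in sequentially. \<forall>\<tau>. (\<forall>k\<in>{1..N}. \<bar>\<tau> k\<bar> = 1) \<longrightarrow> \<bar>(\<Sum>k=1..N. \<tau> k) / real N\<bar> \<le> d \<longrightarrow>
           overlap_energy N \<tau> \<le> r' * (\<Sum>k=1..N. \<tau> k)\<^sup>2 / (2 * real N) + e"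
    using overlap_energy_near_0[of r' e] r' e r_def by blast
  define a where "a = \<beta>\<^sup>2 * coeff_sum + e"
  define c where "c = (1 - r) * (d\<^sup>2 / 6)"
  have c: "0 < c" using r d by (simp add: c_def)
  let ?far = "\<lambda>N. exp (a - c * real N) * ((2 * real N + 1) * exp (\<rho>\<^sup>2 * sqrt (real N)))"
  have far: "\<forall>\<^sub>F N in sequentially. ?far N < 1/2"
    using exp_linear_decay[OF c, of "\<rho>\<^sup>2" a] by (intro order_tendstoD(2)[of _ 0]) auto
  have small: "\<forall>\<^sub>F N in sequentially. moment_error \<beta> / real N < e"
    by (intro order_tendstoD(2)[OF lim_const_over_n] e)
  show ?thesis
    using near far small eventually_gt_at_top[of 0]
  proof eventually_elim
    case (elim N)
    note near = elim(1) and far = elim(2) and small = elim(3) and N = elim(4)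
    let ?S = "\<lambda>\<tau>. \<Sum>k=1..N. \<tau> k"
    have tanh4: "real N * (tanh (h N))^4 \<le> \<rho>^4"
    proof -
      have "(tanh (h N))^4 \<le> h N ^ 4"
        using power_mono[OF tanh_sq_le[of "h N"], of 2] by simp
      then have "real N * (tanh (h N))^4 \<le> real N * h N ^ 4" by (intro mult_left_mono) auto
      then show ?thesis using h[OF N] by linarith
    qed
    have tanh2: "real N * (tanh (h N))\<^sup>2 \<le> \<rho>\<^sup>2 * sqrt (real N)"
    proof -
      have "(real N * (tanh (h N))\<^sup>2)\<^sup>2 = real N * (real N * (tanh (h N))^4)"
        by (simp add: power2_eq_square power4_eq_xxxx)
      also have "\<dots> \<le> real N * \<rho>^4" using tanh4 by (intro mult_left_mono) auto
      also have "\<dots> = (\<rho>\<^sup>2 * sqrt (real N))\<^sup>2" by (simp add: power_mult_distrib)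
      finally show ?thesis by (rule power2_le_imp_le) simp
    qed
    have "expectation (\<lambda>\<omega>. (Z_hat J \<theta> N \<beta> (h N) \<omega>)\<^sup>2)
      \<le> overlap_expectation N (h N) (\<lambda>\<tau>. 6/5 * exp (r' * (?S \<tau>)\<^sup>2 / (2 * real N))
           + exp (a - c * real N) * exp (real N * binary_entropy (?S \<tau> / real N)))"
      unfolding second_moment_Z_hat(2)
    proof (rule overlap_expectation_mono)
      fix \<tau> :: "nat \<Rightarrow> real" assume sign: "\<And>k. k \<in> {1..N} \<Longrightarrow> \<bar>\<tau> k\<bar> = 1"
      let ?P = "\<Prod>i\<in>index_set N. 1 + spin_prod \<tau> i * tanh_moment (coupling \<theta> \<beta> N (length i))"
      have P: "?P \<le> exp (overlap_energy N \<tau> + e)"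
      proof -
        have "?P \<le> exp (overlap_energy N \<tau> + moment_error \<beta> / real N)"
          by (rule overlap_product_le[OF sign]) (use assms in auto)
        also have "\<dots> \<le> exp (overlap_energy N \<tau> + e)" using small by simp
        finally show ?thesis .
      qed
      show "?P \<le> 6/5 * exp (r' * (?S \<tau>)\<^sup>2 / (2 * real N))
           + exp (a - c * real N) * exp (real N * binary_entropy (?S \<tau> / real N))"
      proof (cases "\<bar>?S \<tau> / real N\<bar> \<le> d")
        case True
        have "overlap_energy N \<tau> \<le> r' * (?S \<tau>)\<^sup>2 / (2 * real N) + e"
          using near True sign by blast
        then have "exp (overlap_energy N \<tau> + e) \<le> exp ((e + e) + r' * (?S \<tau>)\<^sup>2 / (2 * real N))" by simp
        also have "\<dots> = 6/5 * exp (r' * (?S \<tau>)\<^sup>2 / (2 * real N))" unfolding exp_add[of "e + e"] exp2e ..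
        finally have "?P \<le> 6/5 * exp (r' * (?S \<tau>)\<^sup>2 / (2 * real N))" using P by linarith
        then show ?thesis by (rule add_increasing2[rotated]) simp
      next
        case False
        let ?x = "?S \<tau> / real N"
        have "\<bar>?x\<bar> \<le> 1" using abs_mean_sign_le[of N \<tau>] sign N by blast
        then have "?x\<^sup>2 / 6 \<le> binary_entropy ?x" by (rule binary_entropy_ge)
        moreover have "d\<^sup>2 \<le> ?x\<^sup>2" using False d by (simp add: abs_le_square_iff[symmetric])
        ultimately have "d\<^sup>2 / 6 \<le> binary_entropy ?x" by linarith
        then have "(1 - r) * (d\<^sup>2 / 6) * real N \<le> (1 - r) * binary_entropy ?x * real N"
          using r by (intro mult_right_mono mult_left_mono) auto
        then have "c * real N \<le> real N * binary_entropy ?x - r * (real N * binary_entropy ?x)"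
          by (simp add: c_def algebra_simps)
        moreover have "overlap_energy N \<tau> \<le> r * (real N * binary_entropy ?x) + \<beta>\<^sup>2 * coeff_sum"
          unfolding r_def by (rule overlap_energy_le_entropy[OF sign N])
        ultimately have "overlap_energy N \<tau> + e \<le> (a - c * real N) + real N * binary_entropy ?x"
          unfolding a_def by linarith
        then have "exp (overlap_energy N \<tau> + e) \<le> exp (a - c * real N) * exp (real N * binary_entropy ?x)"
          unfolding exp_add[symmetric] by simp
        then have "?P \<le> exp (a - c * real N) * exp (real N * binary_entropy ?x)" using P by linarith
        then show ?thesis by (rule add_increasing[rotated]) simp
      qed
    qed
    also have "\<dots> = 6/5 * overlap_expectation N (h N) (\<lambda>\<tau>. exp (r' * (?S \<tau>)\<^sup>2 / (2 * real N)))
       + exp (a - c * real N) * overlap_expectation N (h N) (\<lambda>\<tau>. exp (real N * binary_entropy (?S \<tau> / real N)))"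
      by (simp only: overlap_expectation_add overlap_expectation_cmult)
    also have "\<dots> \<le> 6/5 * (5/4 * B) + ?far N"
    proof (intro add_mono mult_left_mono)
      have "overlap_expectation N (h N) (\<lambda>\<tau>. exp (r' * (?S \<tau>)\<^sup>2 / (2 * real N)))
          \<le> exp (r' * (real N * (tanh (h N))^4) / (2 * (1 - r'))) / sqrt (1 - r')"
        by (rule overlap_expectation_exp_square) (use r r' N in auto)
      also have "\<dots> \<le> exp (r' * \<rho>^4 / (2 * (1 - r'))) / sqrt (1 - r')"
      proof -
        have "r' * (real N * (tanh (h N))^4) / (2 * (1 - r')) \<le> r' * \<rho>^4 / (2 * (1 - r'))"
          using tanh4 r r' by (intro divide_right_mono mult_left_mono) auto
        then show ?thesis using r' by (intro divide_right_mono) auto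
      qed
      also have "\<dots> \<le> 5/4 * B" using r' by simp
      finally show "overlap_expectation N (h N) (\<lambda>\<tau>. exp (r' * (?S \<tau>)\<^sup>2 / (2 * real N))) \<le> 5/4 * B" .
      have "overlap_expectation N (h N) (\<lambda>\<tau>. exp (real N * binary_entropy (?S \<tau> / real N)))
          \<le> (2 * real N + 1) * exp (real N * (tanh (h N))\<^sup>2)"
        by (rule overlap_expectation_exp_entropy[OF N])
      also have "\<dots> \<le> (2 * real N + 1) * exp (\<rho>\<^sup>2 * sqrt (real N))"
        using tanh2 by (intro mult_left_mono) auto
      finally show "overlap_expectation N (h N) (\<lambda>\<tau>. exp (real N * binary_entropy (?S \<tau> / real N)))
          \<le> (2 * real N + 1) * exp (\<rho>\<^sup>2 * sqrt (real N))" .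
    qed auto
    also have "\<dots> \<le> 2 * B" using far B1 by linarith
    finally show ?case by (simp add: B_def)
  qed
qed

end

section \<open>Variance of coordinatewise Lipschitz functions\<close>

locale unit_second_moment_law = prob_space \<mu> for \<mu> :: "real measure" +
  assumes sets_law [measurable_cong]: "sets \<mu> = sets borel"
    and integrable_square: "integrable \<mu> (\<lambda>x. x\<^sup>2)"
    and second_moment_1: "(\<integral>x. x\<^sup>2 \<partial>\<mu>) = 1"
begin

definition coord_lipschitz :: "'i set \<Rightarrow> ('i \<Rightarrow> real) \<Rightarrow> (('i \<Rightarrow> real) \<Rightarrow> real) \<Rightarrow> bool" where
  "coord_lipschitz I c F \<longleftrightarrow> F \<in> borel_measurable (Pi\<^sub>M I (\<lambda>_. \<mu>)) \<and>
     (\<forall>x\<in>space (Pi\<^sub>M I (\<lambda>_. \<mu>)). \<forall>i\<in>I. \<forall>a b. \<bar>F (x(i := a)) - F (x(i := b))\<bar> \<le> c i * \<bar>a - b\<bar>)"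

lemma space_law [simp]: "space \<mu> = UNIV"
  using sets_eq_imp_space_eq[OF sets_law] by simp

lemma prob_law_UNIV [simp]: "prob UNIV = 1"
  using prob_space by simp

lemma prob_space_power: "prob_space (Pi\<^sub>M I (\<lambda>_. \<mu>))"
proof -
  interpret product_prob_space "\<lambda>_. \<mu>" I
    by unfold_locales
  show ?thesis by unfold_locales
qed

lemma integrable_coordinate_square:
  assumes "i \<in> I"
  shows "integrable (Pi\<^sub>M I (\<lambda>_. \<mu>)) (\<lambda>x. (x i)\<^sup>2)"
proof -
  have "distr (Pi\<^sub>M I (\<lambda>_. \<mu>)) \<mu> (\<lambda>\<omega>. \<omega> i) = \<mu>"
    using assms by (intro distr_PiM_component) unfold_locales
  then have "integrable (distr (Pi\<^sub>M I (\<lambda>_. \<mu>)) \<mu> (\<lambda>\<omega>. \<omega> i)) (\<lambda>x. x\<^sup>2)"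
    using integrable_square by simp
  then show ?thesis using assms by (subst (asm) integrable_distr_eq) auto
qed

text \<open>Such a function grows at most linearly in the coordinates, hence is square integrable.\<close>

lemma coord_lipschitz_growth:
  assumes fin: "finite A" and F: "coord_lipschitz I c F" and x: "x \<in> space (Pi\<^sub>M I (\<lambda>_. \<mu>))" and A: "A \<subseteq> I"
  shows "\<bar>F x - F (\<lambda>i. if i \<in> A then 0 else x i)\<bar> \<le> (\<Sum>i\<in>A. c i * \<bar>x i\<bar>)"
  using fin A
proof (induction A rule: finite_induct)
  case (insert j A)
  define y where "y = (\<lambda>i. if i \<in> A then 0 else x i)"
  have y: "y \<in> space (Pi\<^sub>M I (\<lambda>_. \<mu>))"
    using x insert.prems by (auto simp: y_def space_PiM PiE_iff extensional_def)
  have eq: "y = y(j := x j)" "(\<lambda>i. if i \<in> insert j A then 0 else x i) = y(j := 0)"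
    using insert.hyps by (auto simp: y_def)
  have "\<bar>F (y(j := x j)) - F (y(j := 0))\<bar> \<le> c j * \<bar>x j - 0\<bar>"
    using F y insert.prems unfolding coord_lipschitz_def by blast
  then have "\<bar>F y - F (\<lambda>i. if i \<in> insert j A then 0 else x i)\<bar> \<le> c j * \<bar>x j\<bar>"
    using eq by simp
  moreover have "\<bar>F x - F y\<bar> \<le> (\<Sum>i\<in>A. c i * \<bar>x i\<bar>)"
    unfolding y_def using insert by auto
  ultimately show ?case using insert.hyps by simp
qed simp

lemma coord_lipschitz_square_integrable:
  assumes fin: "finite I" and F: "coord_lipschitz I c F"
  shows "integrable (Pi\<^sub>M I (\<lambda>_. \<mu>)) (\<lambda>x. (F x - d)\<^sup>2)"
proof -
  interpret P: prob_space "Pi\<^sub>M I (\<lambda>_. \<mu>)" by (rule prob_space_power)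
  define z where "z = (\<lambda>i. if i \<in> I then 0 else undefined :: real)"
  define K where "K = F z - d"
  have [measurable]: "F \<in> borel_measurable (Pi\<^sub>M I (\<lambda>_. \<mu>))" using F by (simp add: coord_lipschitz_def)
  have le: "(F x - d)\<^sup>2 \<le> 2 * (K\<^sup>2 + real (card I) * (\<Sum>i\<in>I. (c i)\<^sup>2 * (x i)\<^sup>2))"
    if x: "x \<in> space (Pi\<^sub>M I (\<lambda>_. \<mu>))" for x
  proof -
    have "(\<lambda>i. if i \<in> I then 0 else x i) = z"
      using x by (auto simp: z_def space_PiM PiE_iff extensional_def)
    then have d: "\<bar>F x - F z\<bar> \<le> (\<Sum>i\<in>I. c i * \<bar>x i\<bar>)"
      using coord_lipschitz_growth[OF fin F x order_refl] by simp
    have "(F x - d)\<^sup>2 = (K + (F x - F z))\<^sup>2" by (simp add: K_def)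
    also have "\<dots> \<le> 2 * (K\<^sup>2 + (F x - F z)\<^sup>2)"
      using zero_le_power2[of "K - (F x - F z)"] by (simp add: power2_eq_square algebra_simps)
    also have "(F x - F z)\<^sup>2 \<le> (\<Sum>i\<in>I. c i * \<bar>x i\<bar>)\<^sup>2"
      using power_mono[OF d, of 2] by simp
    also have "\<dots> \<le> (\<Sum>i\<in>I. (c i * \<bar>x i\<bar>)\<^sup>2) * real (card I)"
      using sum_squared_le_sum_of_squares[of "\<lambda>i. c i * \<bar>x i\<bar>" I] by simp
    also have "\<dots> = real (card I) * (\<Sum>i\<in>I. (c i)\<^sup>2 * (x i)\<^sup>2)"
      by (simp add: power_mult_distrib mult.commute)
    finally show ?thesis by simp
  qed
  show ?thesis
  proof (rule Bochner_Integration.integrable_bound)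
    show "integrable (Pi\<^sub>M I (\<lambda>_. \<mu>)) (\<lambda>x. 2 * (K\<^sup>2 + real (card I) * (\<Sum>i\<in>I. (c i)\<^sup>2 * (x i)\<^sup>2)))"
      by (intro integrable_mult_right Bochner_Integration.integrable_add Bochner_Integration.integrable_sum
          integrable_coordinate_square) auto
    show "AE x in Pi\<^sub>M I (\<lambda>_. \<mu>). norm ((F x - d)\<^sup>2) \<le> norm (2 * (K\<^sup>2 + real (card I) * (\<Sum>i\<in>I. (c i)\<^sup>2 * (x i)\<^sup>2)))"
    proof (rule AE_I2)
      fix x assume "x \<in> space (Pi\<^sub>M I (\<lambda>_. \<mu>))"
      from le[OF this] show "norm ((F x - d)\<^sup>2) \<le> norm (2 * (K\<^sup>2 + real (card I) * (\<Sum>i\<in>I. (c i)\<^sup>2 * (x i)\<^sup>2)))"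
        by (simp add: abs_le_iff)
    qed
  qed measurable
qed

lemma coord_lipschitz_integrable:
  assumes "finite I" and F: "coord_lipschitz I c F"
  shows "integrable (Pi\<^sub>M I (\<lambda>_. \<mu>)) F"
proof -
  interpret P: prob_space "Pi\<^sub>M I (\<lambda>_. \<mu>)" by (rule prob_space_power)
  show ?thesis
  proof (rule P.square_integrable_imp_integrable)
    show "F \<in> borel_measurable (Pi\<^sub>M I (\<lambda>_. \<mu>))" using F by (simp add: coord_lipschitz_def)
    show "integrable (Pi\<^sub>M I (\<lambda>_. \<mu>)) (\<lambda>x. (F x)\<^sup>2)"
      using coord_lipschitz_square_integrable[OF assms, of 0] by simp
  qed
qed

text \<open>One coordinate: the variance is at most the second moment about the value at \<open>0\<close>.\<close>

lemma lipschitz_variance_step: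
  fixes f :: "real \<Rightarrow> real"
  assumes [measurable]: "f \<in> borel_measurable borel" and lip: "\<And>t. \<bar>f t - f 0\<bar> \<le> c * \<bar>t\<bar>"
  shows "integrable \<mu> f" "(\<integral>t. (f t - e)\<^sup>2 \<partial>\<mu>) \<le> c\<^sup>2 + ((\<integral>t. f t \<partial>\<mu>) - e)\<^sup>2"
proof -
  have sq: "(f t - f 0)\<^sup>2 \<le> c\<^sup>2 * t\<^sup>2" for t
    using power_mono[OF lip[of t], of 2] by (simp add: power_mult_distrib)
  have int_sq: "integrable \<mu> (\<lambda>t. (f t - f 0)\<^sup>2)"
    by (rule Bochner_Integration.integrable_bound[of _ "\<lambda>t. c\<^sup>2 * t\<^sup>2"])
       (use sq integrable_square in \<open>auto intro!: AE_I2\<close>)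
  have int0: "integrable \<mu> (\<lambda>t. f t - f 0)"
    by (rule square_integrable_imp_integrable[OF _ int_sq]) measurable
  then have "integrable \<mu> (\<lambda>t. (f t - f 0) + f 0)" by (intro Bochner_Integration.integrable_add) auto
  then show int: "integrable \<mu> f" by simp
  define g where "g = (\<integral>t. f t \<partial>\<mu>)"
  have g: "(\<integral>t. f t - f 0 \<partial>\<mu>) = g - f 0" using int by (simp add: g_def prob_space)
  have "(\<integral>t. (f t - e)\<^sup>2 \<partial>\<mu>) = (\<integral>t. (f t - f 0)\<^sup>2 + (2 * (f 0 - e) * (f t - f 0) + (f 0 - e)\<^sup>2) \<partial>\<mu>)"
    by (intro Bochner_Integration.integral_cong refl) (simp add: power2_eq_square algebra_simps)
  also have "\<dots> = (\<integral>t. (f t - f 0)\<^sup>2 \<partial>\<mu>) + (2 * (f 0 - e) * (g - f 0) + (f 0 - e)\<^sup>2)"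
    using int_sq int0 by (subst Bochner_Integration.integral_add) (auto simp: g prob_space)
  also have "\<dots> = (\<integral>t. (f t - f 0)\<^sup>2 \<partial>\<mu>) - (g - f 0)\<^sup>2 + (g - e)\<^sup>2"
    by (simp add: power2_eq_square algebra_simps)
  also have "(\<integral>t. (f t - f 0)\<^sup>2 \<partial>\<mu>) \<le> (\<integral>t. c\<^sup>2 * t\<^sup>2 \<partial>\<mu>)"
    using int_sq integrable_square sq by (intro integral_mono) auto
  also have "(\<integral>t. c\<^sup>2 * t\<^sup>2 \<partial>\<mu>) = c\<^sup>2" by (simp add: second_moment_1)
  finally show "(\<integral>t. (f t - e)\<^sup>2 \<partial>\<mu>) \<le> c\<^sup>2 + ((\<integral>t. f t \<partial>\<mu>) - e)\<^sup>2"
    using zero_le_power2[of "g - f 0"] unfolding g_def[symmetric] by linarith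
qed

text \<open>The Efron--Stein inequality for Lipschitz functions, one coordinate at a time: averaging over a
  coordinate keeps the Lipschitz constants of the others.\<close>

theorem coord_lipschitz_variance:
  assumes "finite I" "coord_lipschitz I c F"
  shows "(\<integral>x. (F x - (\<integral>x. F x \<partial>Pi\<^sub>M I (\<lambda>_. \<mu>)))\<^sup>2 \<partial>Pi\<^sub>M I (\<lambda>_. \<mu>)) \<le> (\<Sum>i\<in>I. (c i)\<^sup>2)"
  using assms
proof (induction I arbitrary: F rule: finite_induct)
  case empty
  interpret P: prob_space "Pi\<^sub>M ({} :: 'a set) (\<lambda>_. \<mu>)" by (rule prob_space_power)
  define u :: "'a \<Rightarrow> real" where "u = (\<lambda>_. undefined)"
  have sp: "space (Pi\<^sub>M ({} :: 'a set) (\<lambda>_. \<mu>)) = {u}" by (simp add: space_PiM_empty u_def)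
  have "(\<integral>x. F x \<partial>Pi\<^sub>M {} (\<lambda>_. \<mu>)) = (\<integral>x. F u \<partial>Pi\<^sub>M ({} :: 'a set) (\<lambda>_. \<mu>))"
    by (intro Bochner_Integration.integral_cong refl) (simp add: sp)
  then have m: "(\<integral>x. F x \<partial>Pi\<^sub>M {} (\<lambda>_. \<mu>)) = F u" by (simp add: P.prob_space)
  have "(\<integral>x. (F x - F u)\<^sup>2 \<partial>Pi\<^sub>M {} (\<lambda>_. \<mu>)) = (\<integral>x. 0 \<partial>Pi\<^sub>M ({} :: 'a set) (\<lambda>_. \<mu>))"
    by (intro Bochner_Integration.integral_cong refl) (simp add: sp)
  then show ?case unfolding m by simp
next
  case (insert i I)
  interpret prod: product_prob_space "\<lambda>_. \<mu>" I by unfold_locales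
  let ?P = "Pi\<^sub>M I (\<lambda>_. \<mu>)" and ?P' = "Pi\<^sub>M (insert i I) (\<lambda>_. \<mu>)"
  have F [measurable]: "F \<in> borel_measurable ?P'"
    and lip: "\<And>x j a b. x \<in> space ?P' \<Longrightarrow> j \<in> insert i I \<Longrightarrow> \<bar>F (x(j := a)) - F (x(j := b))\<bar> \<le> c j * \<bar>a - b\<bar>"
    using insert.prems by (auto simp: coord_lipschitz_def)
  have upd: "y(i := t) \<in> space ?P'" if "y \<in> space ?P" for y t
    using that by (auto simp: space_PiM PiE_iff extensional_def)
  define G where "G = (\<lambda>y. \<integral>t. F (y(i := t)) \<partial>\<mu>)"
  define e where "e = (\<integral>x. F x \<partial>?P')"
  have sect [measurable]: "(\<lambda>t. F (y(i := t))) \<in> borel_measurable borel" if y: "y \<in> space ?P" for y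
  proof -
    have "(\<lambda>t. F (y(i := t))) \<in> borel_measurable \<mu>"
      using measurable_compose[OF measurable_component_update[OF y insert.hyps(2)] F] by simp
    then show ?thesis by (simp cong: measurable_cong_sets add: sets_law)
  qed
  have sect_lip: "\<bar>F (y(i := t)) - F (y(i := 0))\<bar> \<le> c i * \<bar>t\<bar>" if y: "y \<in> space ?P" for y t
    using lip[OF upd[OF y, of 0], of i t 0] by simp
  have int_sect: "integrable \<mu> (\<lambda>t. F (y(i := t)))" if y: "y \<in> space ?P" for y
    by (rule lipschitz_variance_step(1)[OF sect sect_lip]) (use y in auto)
  have "coord_lipschitz I c G"
    unfolding coord_lipschitz_def
  proof (intro conjI ballI allI)
    have "(\<lambda>(y, t). F (y(i := t))) \<in> borel_measurable (?P \<Otimes>\<^sub>M \<mu>)"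
      using measurable_compose[OF measurable_add_dim F] by (simp add: split_beta')
    then show "G \<in> borel_measurable ?P"
      unfolding G_def by (rule borel_measurable_lebesgue_integral)
    fix x j a b assume x: "x \<in> space ?P" and j: "j \<in> I"
    have ji: "j \<noteq> i" using j insert.hyps by auto
    have xa: "x(j := a) \<in> space ?P" for a
      using x j by (auto simp: space_PiM PiE_iff extensional_def)
    have "\<bar>G (x(j := a)) - G (x(j := b))\<bar> = \<bar>\<integral>t. F (x(j := a, i := t)) - F (x(j := b, i := t)) \<partial>\<mu>\<bar>"
      unfolding G_def using int_sect[OF xa] by simp
    also have "\<dots> \<le> (\<integral>t. \<bar>F (x(j := a, i := t)) - F (x(j := b, i := t))\<bar> \<partial>\<mu>)"
      by (rule integral_abs_bound)
    also have "\<dots> \<le> (\<integral>t. c j * \<bar>a - b\<bar> \<partial>\<mu>)"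
    proof (rule integral_mono)
      show "integrable \<mu> (\<lambda>t. \<bar>F (x(j := a, i := t)) - F (x(j := b, i := t))\<bar>)"
        using int_sect[OF xa] by (intro integrable_abs Bochner_Integration.integrable_diff)
      fix t
      show "\<bar>F (x(j := a, i := t)) - F (x(j := b, i := t))\<bar> \<le> c j * \<bar>a - b\<bar>"
        using lip[OF upd[OF x, of t], of j a b] j ji by (simp add: fun_upd_twist)
    qed simp
    also have "\<dots> = c j * \<bar>a - b\<bar>" by (simp add: prob_space)
    finally show "\<bar>G (x(j := a)) - G (x(j := b))\<bar> \<le> c j * \<bar>a - b\<bar>" .
  qed
  note IH = insert.IH[OF this] coord_lipschitz_square_integrable[OF insert.hyps(1) this]
  have fin: "finite (insert i I)" using insert.hyps by simp
  have e: "e = (\<integral>y. G y \<partial>?P)"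
    unfolding e_def G_def
    by (rule prod.product_integral_insert[OF insert.hyps coord_lipschitz_integrable[OF fin insert.prems]])
  have "(\<integral>x. (F x - e)\<^sup>2 \<partial>?P') = (\<integral>y. (\<integral>t. (F (y(i := t)) - e)\<^sup>2 \<partial>\<mu>) \<partial>?P)"
    by (rule prod.product_integral_insert[OF insert.hyps coord_lipschitz_square_integrable[OF fin insert.prems]])
  also have "\<dots> \<le> (\<integral>y. (c i)\<^sup>2 + (G y - e)\<^sup>2 \<partial>?P)"
  proof (rule integral_mono')
    show "integrable ?P (\<lambda>y. (c i)\<^sup>2 + (G y - e)\<^sup>2)"
      using IH(2) by (intro Bochner_Integration.integrable_add) auto
    fix y assume y: "y \<in> space ?P"
    show "(\<integral>t. (F (y(i := t)) - e)\<^sup>2 \<partial>\<mu>) \<le> (c i)\<^sup>2 + (G y - e)\<^sup>2"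
      unfolding G_def by (rule lipschitz_variance_step(2)[OF sect sect_lip]) (use y in auto)
  qed simp
  also have "\<dots> = (c i)\<^sup>2 + (\<integral>y. (G y - e)\<^sup>2 \<partial>?P)"
    using IH(2) by (subst Bochner_Integration.integral_add) (auto simp: prod.P.prob_space)
  also have "\<dots> \<le> (c i)\<^sup>2 + (\<Sum>i\<in>I. (c i)\<^sup>2)"
    using IH(1) unfolding e by simp
  finally show ?case using insert.hyps unfolding e_def by simp
qed

end

lemma log_sum_exp_lipschitz:
  fixes u v :: "'b \<Rightarrow> real"
  assumes fin: "finite S" "S \<noteq> {}" and d: "\<And>s. s \<in> S \<Longrightarrow> \<bar>u s - v s\<bar> \<le> d"
  shows "\<bar>ln (\<Sum>s\<in>S. exp (u s)) - ln (\<Sum>s\<in>S. exp (v s))\<bar> \<le> d"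
proof -
  have *: "ln (\<Sum>s\<in>S. exp (u s)) \<le> d + ln (\<Sum>s\<in>S. exp (v s))"
    if d: "\<And>s. s \<in> S \<Longrightarrow> \<bar>u s - v s\<bar> \<le> d" for u v :: "'b \<Rightarrow> real"
  proof -
    have pos: "0 < (\<Sum>s\<in>S. exp (u s))" "0 < (\<Sum>s\<in>S. exp (v s))" using fin by (auto intro!: sum_pos)
    have "(\<Sum>s\<in>S. exp (u s)) \<le> (\<Sum>s\<in>S. exp d * exp (v s))"
    proof (rule sum_mono)
      fix s assume "s \<in> S"
      then show "exp (u s) \<le> exp d * exp (v s)" using d[of s] by (simp add: exp_add[symmetric] abs_le_iff)
    qed
    also have "\<dots> = exp d * (\<Sum>s\<in>S. exp (v s))" by (simp add: sum_distrib_left)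
    finally have "ln (\<Sum>s\<in>S. exp (u s)) \<le> ln (exp d * (\<Sum>s\<in>S. exp (v s)))"
      using pos by simp
    also have "\<dots> = d + ln (\<Sum>s\<in>S. exp (v s))" using pos by (simp add: ln_mult)
    finally show ?thesis .
  qed
  have "ln (\<Sum>s\<in>S. exp (u s)) \<le> d + ln (\<Sum>s\<in>S. exp (v s))" by (rule *) (rule d)
  moreover have "ln (\<Sum>s\<in>S. exp (v s)) \<le> d + ln (\<Sum>s\<in>S. exp (u s))"
    by (rule *) (use d in \<open>simp add: abs_minus_commute\<close>)
  ultimately show ?thesis by (simp add: abs_le_iff)
qed

section \<open>The free energy\<close>

lemma ln_cosh_lipschitz: "\<bar>ln (cosh y) - ln (cosh z)\<bar> \<le> \<bar>y - z\<bar>" for y z :: real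
proof -
  have eq: "ln (cosh y) = ln (\<Sum>s\<in>{1, -1 :: real}. exp (s * y)) - ln 2" for y :: real
  proof -
    have c: "cosh y = (\<Sum>s\<in>{1, -1 :: real}. exp (s * y)) / 2" by (simp add: cosh_def)
    have "0 < (\<Sum>s\<in>{1, -1 :: real}. exp (s * y))" by (intro sum_pos) auto
    then show ?thesis unfolding c by (subst ln_div) auto
  qed
  have "\<bar>ln (\<Sum>s\<in>{1, -1 :: real}. exp (s * y)) - ln (\<Sum>s\<in>{1, -1 :: real}. exp (s * z))\<bar> \<le> \<bar>y - z\<bar>"
    by (rule log_sum_exp_lipschitz) (auto simp: right_diff_distrib[symmetric])
  then show ?thesis unfolding eq by simp
qed

lemma nsym_1:
  assumes "0 < N"
  shows "nsym (\<lambda>_. 1) N p \<le> 1" "1 - real p * (real p - 1) / (2 * real N) \<le> nsym (\<lambda>_. 1) N p"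
proof -
  show "nsym (\<lambda>_. 1) N p \<le> 1" using abs_nsym_le[of N "\<lambda>_. 1" p] assms by simp
  show "1 - real p * (real p - 1) / (2 * real N) \<le> nsym (\<lambda>_. 1) N p"
    using nsym_power[of N "\<lambda>_. 1" p] assms by simp
qed

context mixed_p_spin
begin

definition law :: "real measure" where
  "law = distr M borel (J ref_tuple)"

lemma law_of_J: "i \<in> all_tuples \<Longrightarrow> distr M borel (J i) = law"
  unfolding law_def by (rule J_ident[OF _ ref_tuple])

lemma sets_law [simp, measurable_cong]: "sets law = sets borel"
  by (simp add: law_def)

sublocale law: unit_second_moment_law law
proof -
  interpret L: prob_space law
    unfolding law_def by (rule prob_space_distr) (use ref_tuple in measurable)
  show "unit_second_moment_law law"
  proof unfold_locales
    show "sets law = sets borel" by simp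
    show "integrable law (\<lambda>x. x\<^sup>2)"
      unfolding law_def using integrable_J_power[OF ref_tuple, of 2] ref_tuple
      by (subst integrable_distr_eq) auto
    show "(\<integral>x. x\<^sup>2 \<partial>law) = 1"
      unfolding law_def using second_moment[OF ref_tuple] ref_tuple
      by (subst integral_distr) auto
  qed
qed

lemma distr_couplings:
  assumes "2 \<le> N"
  shows "distr M (\<Pi>\<^sub>M i\<in>index_set N. borel) (\<lambda>\<omega>. \<lambda>i\<in>index_set N. J i \<omega>) = (\<Pi>\<^sub>M i\<in>index_set N. law)"
proof -
  have "ref_tuple \<in> tuples N 2" using assms by (auto simp: tuples_def)
  then have ne: "index_set N \<noteq> {}" using assms by (force simp: index_set_def)
  have rv: "random_variable borel (J i)" if "i \<in> index_set N" for i
    using that index_set_subset[of N] by auto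
  have "distr M (\<Pi>\<^sub>M i\<in>index_set N. borel) (\<lambda>\<omega>. \<lambda>i\<in>index_set N. J i \<omega>)
      = (\<Pi>\<^sub>M i\<in>index_set N. distr M borel (J i))"
    using indep_vars_iff_distr_eq_PiM'[where X = J and M' = "\<lambda>_. borel", OF ne rv]
      indep_vars_subset[OF J_indep index_set_subset[of N]] by simp
  also have "\<dots> = (\<Pi>\<^sub>M i\<in>index_set N. law)"
    using index_set_subset by (intro PiM_cong law_of_J) auto
  finally show ?thesis .
qed

text \<open>Transports the variance bound from the product measure to functions of the couplings of one system.\<close>

lemma couplings_variance:
  assumes N: "2 \<le> N" and F: "law.coord_lipschitz (index_set N) c F"
  defines "X \<equiv> \<lambda>\<omega>. F (\<lambda>i\<in>index_set N. J i \<omega>)"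
  shows "random_variable borel X" "integrable M (\<lambda>\<omega>. (X \<omega>)\<^sup>2)" "variance X \<le> (\<Sum>i\<in>index_set N. (c i)\<^sup>2)"
proof -
  let ?I = "index_set N"
  let ?P = "\<Pi>\<^sub>M i\<in>?I. law" and ?B = "\<Pi>\<^sub>M i\<in>?I. (borel :: real measure)"
  let ?J = "\<lambda>\<omega>. \<lambda>i\<in>?I. J i \<omega>"
  have sets: "sets ?P = sets ?B" by (intro sets_PiM_cong) auto
  have F_meas [measurable]: "F \<in> borel_measurable ?B"
    using F by (simp add: law.coord_lipschitz_def cong: measurable_cong_sets add: sets)
  have J_meas [measurable]: "?J \<in> measurable M ?B"
    using index_set_subset[of N] by (intro measurable_restrict) auto
  show rv: "random_variable borel X" unfolding X_def by measurable
  have transfer: "(\<integral>x. g (F x) \<partial>?P) = expectation (\<lambda>\<omega>. g (X \<omega>))"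
    if [measurable]: "g \<in> borel_measurable borel" for g :: "real \<Rightarrow> real"
    unfolding X_def distr_couplings[OF N, symmetric] by (rule integral_distr) measurable
  have "integrable (distr M ?B ?J) (\<lambda>x. (F x)\<^sup>2)"
    unfolding distr_couplings[OF N]
    using law.coord_lipschitz_square_integrable[OF finite_index_set F, of 0] by simp
  then show "integrable M (\<lambda>\<omega>. (X \<omega>)\<^sup>2)"
    unfolding X_def by (subst (asm) integrable_distr_eq) auto
  have "variance X = (\<integral>x. (F x - (\<integral>x. F x \<partial>?P))\<^sup>2 \<partial>?P)"
    using transfer[of "\<lambda>x. x"] transfer[of "\<lambda>x. (x - expectation X)\<^sup>2"] by simp
  also have "\<dots> \<le> (\<Sum>i\<in>?I. (c i)\<^sup>2)"
    by (rule law.coord_lipschitz_variance[OF finite_index_set F])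
  finally show "variance X \<le> (\<Sum>i\<in>?I. (c i)\<^sup>2)" .
qed

text \<open>The sum of the squared couplings is the energy of the overlap of a configuration with itself; this is
  where \<open>\<xi> 1\<close> comes from.\<close>

lemma sum_coupling_sq: "0 < N \<Longrightarrow> (\<Sum>i\<in>index_set N. (coupling \<theta> \<beta> N (length i))\<^sup>2)
    = (\<Sum>p=2..N. \<beta>\<^sup>2 * (real N * ((\<theta> p)\<^sup>2 / fact p) * nsym (\<lambda>_. 1) N p))"
proof -
  assume N: "0 < N"
  have "(\<Sum>i\<in>tuples N p. (coupling \<theta> \<beta> N (length i))\<^sup>2)
      = \<beta>\<^sup>2 * (real N * ((\<theta> p)\<^sup>2 / fact p) * nsym (\<lambda>_. 1) N p)" if p: "p \<in> {2..N}" for p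
  proof -
    have p2: "2 \<le> p" using p by simp
    obtain k where k: "p = Suc k" using p2 by (cases p) auto
    have "(\<Sum>i\<in>tuples N p. (coupling \<theta> \<beta> N (length i))\<^sup>2) = (\<Sum>i\<in>tuples N p. \<beta>\<^sup>2 * (\<theta> p)\<^sup>2 / real N ^ (p - 1) * spin_prod (\<lambda>_. 1) i)"
      by (intro sum.cong refl) (use p2 in \<open>auto dest!: length_tuples simp: coupling_sq[OF N] spin_prod_def\<close>)
    also have "\<dots> = \<beta>\<^sup>2 * (\<theta> p)\<^sup>2 / real N ^ (p - 1) * esym (\<lambda>_. 1) N p"
      by (simp add: esym_def sum_distrib_left)
    also have "\<dots> = \<beta>\<^sup>2 * (real N * ((\<theta> p)\<^sup>2 / fact p) * nsym (\<lambda>_. 1) N p)"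
      using N by (simp add: nsym_def k del: fact_Suc)
    finally show ?thesis .
  qed
  then show ?thesis unfolding sum_index_set by (intro sum.cong refl) auto
qed

lemma sum_coupling_sq_le:
  assumes N: "0 < N"
  shows "(\<Sum>i\<in>index_set N. (coupling \<theta> \<beta> N (length i))\<^sup>2) \<le> real N * (\<beta>\<^sup>2 * xi \<theta> 1)"
proof -
  have "(\<Sum>i\<in>index_set N. (coupling \<theta> \<beta> N (length i))\<^sup>2) \<le> (\<Sum>p=2..N. \<beta>\<^sup>2 * (real N * ((\<theta> p)\<^sup>2 / fact p) * 1))"
    unfolding sum_coupling_sq[OF N] by (intro sum_mono mult_left_mono nsym_1 N) auto
  also have "\<dots> = real N * (\<beta>\<^sup>2 * (\<Sum>p=2..N. (\<theta> p)\<^sup>2 / fact p))"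
    by (simp add: sum_distrib_left mult_ac)
  also have "\<dots> \<le> real N * (\<beta>\<^sup>2 * xi \<theta> 1)" by (intro mult_left_mono sum_coeff_fact_le) auto
  finally show ?thesis .
qed

lemma sum_coupling_sq_ge:
  assumes N: "0 < N"
  shows "real N * (\<beta>\<^sup>2 * (\<Sum>p=2..N. (\<theta> p)\<^sup>2 / fact p)) - \<beta>\<^sup>2 * coeff_sum
           \<le> (\<Sum>i\<in>index_set N. (coupling \<theta> \<beta> N (length i))\<^sup>2)"
proof -
  have "real N * (\<beta>\<^sup>2 * (\<Sum>p=2..N. (\<theta> p)\<^sup>2 / fact p)) - \<beta>\<^sup>2 * coeff_sum
      \<le> real N * (\<beta>\<^sup>2 * (\<Sum>p=2..N. (\<theta> p)\<^sup>2 / fact p)) - \<beta>\<^sup>2 * (\<Sum>p=2..N. (\<theta> p)\<^sup>2 / fact (p - 2))"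
    using sum_coeffs_le[of "{..<N - 1}"] unfolding sum_shift_2 by (simp add: mult_left_mono)
  also have "\<dots> = (\<Sum>p=2..N. \<beta>\<^sup>2 * (real N * ((\<theta> p)\<^sup>2 / fact p) - (\<theta> p)\<^sup>2 / fact (p - 2)))"
    by (simp add: sum_subtractf sum_distrib_left right_diff_distrib mult_ac)
  also have "\<dots> \<le> (\<Sum>p=2..N. \<beta>\<^sup>2 * (real N * ((\<theta> p)\<^sup>2 / fact p) * nsym (\<lambda>_. 1) N p))"
  proof (intro sum_mono mult_left_mono)
    fix p assume p: "p \<in> {2..N}"
    have "real N * ((\<theta> p)\<^sup>2 / fact p) * (1 - real p * (real p - 1) / (2 * real N))
       \<le> real N * ((\<theta> p)\<^sup>2 / fact p) * nsym (\<lambda>_. 1) N p"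
      by (intro mult_left_mono nsym_1 N) auto
    moreover have "real N * ((\<theta> p)\<^sup>2 / fact p) * (1 - real p * (real p - 1) / (2 * real N))
       = real N * ((\<theta> p)\<^sup>2 / fact p) - (\<theta> p)\<^sup>2 / fact (p - 2) / 2"
      using coeff_gap[of N p] p N by (simp add: right_diff_distrib)
    moreover have "(\<theta> p)\<^sup>2 / fact (p - 2) / 2 \<le> (\<theta> p)\<^sup>2 / fact (p - 2)"
      using zero_le_power2[of "\<theta> p"] by (simp add: divide_simps)
    moreover have "a - b \<le> t" if "u \<le> t" "u = a - b / 2" "b / 2 \<le> b" for a b t u :: real
      using that by linarith
    ultimately show "real N * ((\<theta> p)\<^sup>2 / fact p) - (\<theta> p)\<^sup>2 / fact (p - 2)
       \<le> real N * ((\<theta> p)\<^sup>2 / fact p) * nsym (\<lambda>_. 1) N p" by blast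
  qed simp
  also have "\<dots> = (\<Sum>i\<in>index_set N. (coupling \<theta> \<beta> N (length i))\<^sup>2)"
    unfolding sum_coupling_sq[OF N] ..
  finally show ?thesis .
qed

lemma sum_coupling_fourth_le:
  "(\<Sum>i\<in>index_set N. (coupling \<theta> \<beta> N (length i))^4) \<le> \<beta>^4 * coeff_sum * xi \<theta> 1"
proof -
  have "(\<Sum>i\<in>index_set N. (coupling \<theta> \<beta> N (length i))^4) = (\<Sum>p=2..N. (coupling \<theta> \<beta> N p)^4 * real (N choose p))"
    unfolding sum_index_set
  proof (intro sum.cong refl)
    fix p assume "p \<in> {2..N}"
    have "(\<Sum>i\<in>tuples N p. (coupling \<theta> \<beta> N (length i))^4) = (\<Sum>i\<in>tuples N p. (coupling \<theta> \<beta> N p)^4)"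
      by (intro sum.cong refl) (auto dest: length_tuples)
    then show "(\<Sum>i\<in>tuples N p. (coupling \<theta> \<beta> N (length i))^4) = (coupling \<theta> \<beta> N p)^4 * real (N choose p)"
      by (simp add: card_tuples)
  qed
  also have "\<dots> \<le> (\<Sum>p=2..N. \<beta>^4 * coeff_sum * ((\<theta> p)\<^sup>2 / fact p))"
  proof (rule sum_mono)
    fix p assume p: "p \<in> {2..N}"
    have "real (N choose p) = esym (\<lambda>_. 1) N p" by (simp add: esym_def spin_prod_def card_tuples)
    also have "\<dots> \<le> real N ^ p / fact p" using abs_esym_le[of N "\<lambda>_. 1" p] by simp
    finally have "(coupling \<theta> \<beta> N p)^4 * real (N choose p) \<le> (coupling \<theta> \<beta> N p)^4 * (real N ^ p / fact p)"
      by (intro mult_left_mono) auto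
    also have "\<dots> \<le> \<beta>^4 * coeff_sum * ((\<theta> p)\<^sup>2 / fact p)"
      using p by (intro coupling_fourth_le) auto
    finally show "(coupling \<theta> \<beta> N p)^4 * real (N choose p) \<le> \<beta>^4 * coeff_sum * ((\<theta> p)\<^sup>2 / fact p)" .
  qed
  also have "\<dots> = \<beta>^4 * coeff_sum * (\<Sum>p=2..N. (\<theta> p)\<^sup>2 / fact p)"
    by (simp add: sum_distrib_left)
  also have "\<dots> \<le> \<beta>^4 * coeff_sum * xi \<theta> 1"
    using coeff_sum_nonneg by (intro mult_left_mono sum_coeff_fact_le) auto
  finally show ?thesis .
qed

definition log_Z_bar :: "real \<Rightarrow> nat \<Rightarrow> 'a \<Rightarrow> real" where
  "log_Z_bar \<beta> N \<omega> = (\<Sum>i\<in>index_set N. ln (cosh (coupling \<theta> \<beta> N (length i) * J i \<omega>)))"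

lemma partition_fun_eq:
  "partition_fun J \<theta> N \<beta> h \<omega> = (\<Sum>\<sigma>\<in>configs N.
     exp ((\<Sum>i\<in>index_set N. coupling \<theta> \<beta> N (length i) * J i \<omega> * spin_prod \<sigma> i) + h * (\<Sum>k=1..N. \<sigma> k)))"
proof -
  have "\<beta> * hamiltonian J \<theta> N \<omega> \<sigma> = (\<Sum>i\<in>index_set N. coupling \<theta> \<beta> N (length i) * J i \<omega> * spin_prod \<sigma> i)" for \<sigma>
    unfolding hamiltonian_def sum_index_set sum_distrib_left
    by (intro sum.cong refl) (auto dest!: length_tuples simp: coupling_def)
  then show ?thesis by (simp add: partition_fun_def)
qed

text \<open>For a sign \<open>s\<close>, \<open>exp (y * s) = cosh y * (1 + s * tanh y)\<close>.\<close>

lemma partition_fun_factor: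
  "partition_fun J \<theta> N \<beta> h \<omega> = (exp h + exp (- h)) ^ N * exp (log_Z_bar \<beta> N \<omega>) * Z_hat J \<theta> N \<beta> h \<omega>"
proof -
  let ?y = "\<lambda>i. coupling \<theta> \<beta> N (length i) * J i \<omega>"
  have pos: "exp h + exp (- h) \<noteq> 0" by (smt (verit) exp_gt_zero)
  have bar: "exp (log_Z_bar \<beta> N \<omega>) = (\<Prod>i\<in>index_set N. cosh (?y i))"
    unfolding log_Z_bar_def by (simp add: exp_sum finite_index_set)
  have "exp ((\<Sum>i\<in>index_set N. ?y i * spin_prod \<sigma> i) + h * (\<Sum>k=1..N. \<sigma> k))
     = (exp h + exp (- h)) ^ N * (\<Prod>i\<in>index_set N. cosh (?y i)) *
        ((\<Prod>k=1..N. spin_weight h (\<sigma> k)) * (\<Prod>i\<in>index_set N. 1 + spin_prod \<sigma> i * tanh (?y i)))"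
    if \<sigma>: "\<sigma> \<in> configs N" for \<sigma>
  proof -
    have "exp (\<Sum>i\<in>index_set N. ?y i * spin_prod \<sigma> i) = (\<Prod>i\<in>index_set N. cosh (?y i) * (1 + spin_prod \<sigma> i * tanh (?y i)))"
      unfolding exp_sum[OF finite_index_set]
    proof (rule prod.cong[OF refl])
      fix i assume "i \<in> index_set N"
      then have "\<bar>spin_prod \<sigma> i\<bar> = 1" using spin_prod_sign[of N \<sigma> i] configs_sign[OF \<sigma>] by blast
      then have s: "spin_prod \<sigma> i = 1 \<or> spin_prod \<sigma> i = -1" by linarith
      have "cosh (?y i) * (1 + spin_prod \<sigma> i * tanh (?y i)) = cosh (?y i) + spin_prod \<sigma> i * sinh (?y i)"
        by (simp add: tanh_def distrib_left)
      also have "\<dots> = exp (?y i * spin_prod \<sigma> i)"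
        using s by (auto simp: cosh_plus_sinh cosh_minus_sinh)
      finally show "exp (?y i * spin_prod \<sigma> i) = cosh (?y i) * (1 + spin_prod \<sigma> i * tanh (?y i))" ..
    qed
    moreover have "exp (h * (\<Sum>k=1..N. \<sigma> k)) = (exp h + exp (- h)) ^ N * (\<Prod>k=1..N. spin_weight h (\<sigma> k))"
      using pos by (simp add: sum_distrib_left exp_sum spin_weight_def prod_dividef)
    ultimately show ?thesis by (simp add: exp_add prod.distrib mult_ac)
  qed
  then show ?thesis
    unfolding partition_fun_eq bar Z_hat_eq sum_distrib_left by (intro sum.cong refl)
qed

lemma ln_partition_fun:
  "ln (partition_fun J \<theta> N \<beta> h \<omega>)
     = real N * ln (exp h + exp (- h)) + log_Z_bar \<beta> N \<omega> + ln (Z_hat J \<theta> N \<beta> h \<omega>)"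
proof -
  have "0 < exp h + exp (- h)" by (simp add: add_pos_pos)
  then show ?thesis unfolding partition_fun_factor
    using Z_hat_pos[of N \<beta> h \<omega>] by (simp add: ln_mult ln_realpow)
qed

text \<open>The derivative of \<open>ln Z\<close> with respect to a coupling variable is its coefficient times a Gibbs average of a
  sign, so the squared Lipschitz constants add up to order \<open>N\<close>.\<close>

lemma ln_partition_fun_variance:
  fixes \<beta> h :: real
  assumes N: "2 \<le> N"
  defines "X \<equiv> \<lambda>\<omega>. ln (partition_fun J \<theta> N \<beta> h \<omega>)"
  shows "random_variable borel X" "integrable M (\<lambda>\<omega>. (X \<omega>)\<^sup>2)" "variance X \<le> real N * (\<beta>\<^sup>2 * xi \<theta> 1)"
proof -
  let ?I = "index_set N" and ?c = "\<lambda>i. coupling \<theta> \<beta> N (length i)"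
  define F where "F = (\<lambda>x. ln (\<Sum>\<sigma>\<in>configs N. exp ((\<Sum>i\<in>?I. ?c i * x i * spin_prod \<sigma> i) + h * (\<Sum>k=1..N. \<sigma> k))))"
  have F: "law.coord_lipschitz ?I (\<lambda>i. \<bar>?c i\<bar>) F"
    unfolding law.coord_lipschitz_def
  proof (intro conjI ballI allI)
    show "F \<in> borel_measurable (Pi\<^sub>M ?I (\<lambda>_. law))" unfolding F_def by measurable
    fix x :: "nat list \<Rightarrow> real" and j a b assume j: "j \<in> ?I"
    show "\<bar>F (x(j := a)) - F (x(j := b))\<bar> \<le> \<bar>?c j\<bar> * \<bar>a - b\<bar>"
      unfolding F_def
    proof (rule log_sum_exp_lipschitz)
      show "finite (configs N)" by (rule finite_configs)
      show "configs N \<noteq> {}" by (auto simp: configs_def PiE_eq_empty_iff)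
      fix \<sigma> assume \<sigma>: "\<sigma> \<in> configs N"
      have "\<bar>spin_prod \<sigma> j\<bar> = 1" using spin_prod_sign[of N \<sigma> j] configs_sign[OF \<sigma>] j by blast
      moreover have "(\<Sum>i\<in>?I. ?c i * (x(j := t)) i * spin_prod \<sigma> i)
         = ?c j * t * spin_prod \<sigma> j + (\<Sum>i\<in>?I - {j}. ?c i * x i * spin_prod \<sigma> i)" for t
        using j by (simp add: sum.remove[OF finite_index_set])
      ultimately show "\<bar>(\<Sum>i\<in>?I. ?c i * (x(j := a)) i * spin_prod \<sigma> i) + h * (\<Sum>k=1..N. \<sigma> k)
         - ((\<Sum>i\<in>?I. ?c i * (x(j := b)) i * spin_prod \<sigma> i) + h * (\<Sum>k=1..N. \<sigma> k))\<bar> \<le> \<bar>?c j\<bar> * \<bar>a - b\<bar>"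
        by (simp add: left_diff_distrib[symmetric] right_diff_distrib[symmetric] abs_mult)
    qed
  qed
  have X: "X = (\<lambda>\<omega>. F (\<lambda>i\<in>?I. J i \<omega>))"
    unfolding X_def F_def partition_fun_eq by (simp cong: sum.cong)
  note V = couplings_variance[OF N F]
  show "random_variable borel X" "integrable M (\<lambda>\<omega>. (X \<omega>)\<^sup>2)" unfolding X using V by auto
  have "variance X \<le> (\<Sum>i\<in>?I. (\<bar>?c i\<bar>)\<^sup>2)" unfolding X by (rule V(3))
  also have "\<dots> = (\<Sum>i\<in>?I. (?c i)\<^sup>2)" by simp
  also have "\<dots> \<le> real N * (\<beta>\<^sup>2 * xi \<theta> 1)" by (rule sum_coupling_sq_le) (use N in simp)
  finally show "variance X \<le> real N * (\<beta>\<^sup>2 * xi \<theta> 1)" .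
qed

lemma log_Z_bar_variance:
  assumes N: "2 \<le> N"
  shows "random_variable borel (log_Z_bar \<beta> N)" "integrable M (\<lambda>\<omega>. (log_Z_bar \<beta> N \<omega>)\<^sup>2)"
    "variance (log_Z_bar \<beta> N) \<le> real N * (\<beta>\<^sup>2 * xi \<theta> 1)"
proof -
  let ?I = "index_set N" and ?c = "\<lambda>i. coupling \<theta> \<beta> N (length i)"
  define F where "F = (\<lambda>x. \<Sum>i\<in>?I. ln (cosh (?c i * x i)))"
  have F: "law.coord_lipschitz ?I (\<lambda>i. \<bar>?c i\<bar>) F"
    unfolding law.coord_lipschitz_def
  proof (intro conjI ballI allI)
    show "F \<in> borel_measurable (Pi\<^sub>M ?I (\<lambda>_. law))" unfolding F_def cosh_def by measurable
    fix x :: "nat list \<Rightarrow> real" and j a b assume j: "j \<in> ?I"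
    have "F (x(j := t)) = ln (cosh (?c j * t)) + (\<Sum>i\<in>?I - {j}. ln (cosh (?c i * x i)))" for t
      unfolding F_def using j by (simp add: sum.remove[OF finite_index_set])
    then have "\<bar>F (x(j := a)) - F (x(j := b))\<bar> \<le> \<bar>?c j * a - ?c j * b\<bar>"
      using ln_cosh_lipschitz by simp
    then show "\<bar>F (x(j := a)) - F (x(j := b))\<bar> \<le> \<bar>?c j\<bar> * \<bar>a - b\<bar>"
      by (simp add: right_diff_distrib[symmetric] abs_mult)
  qed
  have X: "log_Z_bar \<beta> N = (\<lambda>\<omega>. F (\<lambda>i\<in>?I. J i \<omega>))"
    unfolding F_def log_Z_bar_def[abs_def] by (simp cong: sum.cong)
  note V = couplings_variance[OF N F]
  show "random_variable borel (log_Z_bar \<beta> N)" "integrable M (\<lambda>\<omega>. (log_Z_bar \<beta> N \<omega>)\<^sup>2)" unfolding X using V by auto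
  have "variance (log_Z_bar \<beta> N) \<le> (\<Sum>i\<in>?I. (\<bar>?c i\<bar>)\<^sup>2)" unfolding X by (rule V(3))
  also have "\<dots> = (\<Sum>i\<in>?I. (?c i)\<^sup>2)" by simp
  also have "\<dots> \<le> real N * (\<beta>\<^sup>2 * xi \<theta> 1)" by (rule sum_coupling_sq_le) (use N in simp)
  finally show "variance (log_Z_bar \<beta> N) \<le> real N * (\<beta>\<^sup>2 * xi \<theta> 1)" .
qed

lemma expectation_ln_cosh:
  assumes i: "i \<in> all_tuples"
  shows "integrable M (\<lambda>\<omega>. ln (cosh (c * J i \<omega>)))"
    "expectation (\<lambda>\<omega>. ln (cosh (c * J i \<omega>))) \<le> c\<^sup>2 / 2"
    "c\<^sup>2 / 2 - c^4 * fourth_moment / 2 \<le> expectation (\<lambda>\<omega>. ln (cosh (c * J i \<omega>)))"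
proof -
  note [measurable] = J_measurable[OF i]
  have i2: "integrable M (\<lambda>\<omega>. (c * J i \<omega>)\<^sup>2 / 2)"
    using integrable_J_power[OF i, of 2] by (simp add: power_mult_distrib)
  have i4: "integrable M (\<lambda>\<omega>. (c * J i \<omega>)^4 / 2)"
    using J_fourth_moment[OF i] by (simp add: power_mult_distrib)
  show int: "integrable M (\<lambda>\<omega>. ln (cosh (c * J i \<omega>)))"
  proof (rule Bochner_Integration.integrable_bound[OF i2])
    show "(\<lambda>\<omega>. ln (cosh (c * J i \<omega>))) \<in> borel_measurable M" unfolding cosh_def by measurable
    show "AE \<omega> in M. norm (ln (cosh (c * J i \<omega>))) \<le> norm ((c * J i \<omega>)\<^sup>2 / 2)"
      using ln_cosh_le ln_cosh_nonneg by (intro AE_I2) simp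
  qed
  have "expectation (\<lambda>\<omega>. ln (cosh (c * J i \<omega>))) \<le> expectation (\<lambda>\<omega>. (c * J i \<omega>)\<^sup>2 / 2)"
    by (intro integral_mono int i2 ln_cosh_le)
  then show "expectation (\<lambda>\<omega>. ln (cosh (c * J i \<omega>))) \<le> c\<^sup>2 / 2"
    using second_moment[OF i] by (simp add: power_mult_distrib)
  have "expectation (\<lambda>\<omega>. (c * J i \<omega>)\<^sup>2 / 2 - (c * J i \<omega>)^4 / 2) \<le> expectation (\<lambda>\<omega>. ln (cosh (c * J i \<omega>)))"
    by (intro integral_mono int ln_cosh_ge Bochner_Integration.integrable_diff i2 i4)
  also have "expectation (\<lambda>\<omega>. (c * J i \<omega>)\<^sup>2 / 2 - (c * J i \<omega>)^4 / 2) = c\<^sup>2 / 2 - c^4 * fourth_moment / 2"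
    using i2 i4 second_moment[OF i] fourth_moment[OF i] by (simp add: power_mult_distrib)
  finally show "c\<^sup>2 / 2 - c^4 * fourth_moment / 2 \<le> expectation (\<lambda>\<omega>. ln (cosh (c * J i \<omega>)))" by simp
qed

text \<open>Since \<open>ln (cosh y)\<close> is \<open>y\<^sup>2 / 2\<close> up to \<open>y^4\<close>, the mean is half the sum of the squared couplings up to
  the bounded sum of their fourth powers.\<close>

lemma expectation_log_Z_bar:
  "(\<lambda>N. expectation (log_Z_bar \<beta> N) / real N) \<longlonglongrightarrow> \<beta>\<^sup>2 * xi \<theta> 1 / 2"
proof -
  let ?c = "\<lambda>N i. coupling \<theta> \<beta> N (length i)"
  let ?q = "\<lambda>N. \<Sum>p=2..N. (\<theta> p)\<^sup>2 / fact p"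
  define K where "K = \<beta>\<^sup>2 * coeff_sum + \<beta>^4 * coeff_sum * xi \<theta> 1 * fourth_moment"
  have X: "0 \<le> \<beta>\<^sup>2 * coeff_sum" and Y: "0 \<le> \<beta>^4 * coeff_sum * xi \<theta> 1 * fourth_moment"
    using fourth_moment_nonneg coeff_sum_nonneg xi_1_nonneg by auto
  have E: "expectation (log_Z_bar \<beta> N) = (\<Sum>i\<in>index_set N. expectation (\<lambda>\<omega>. ln (cosh (?c N i * J i \<omega>))))" for N
    unfolding log_Z_bar_def[abs_def] using index_set_subset
    by (intro Bochner_Integration.integral_sum expectation_ln_cosh) auto
  have upper: "expectation (log_Z_bar \<beta> N) / real N \<le> \<beta>\<^sup>2 * xi \<theta> 1 / 2" if N: "0 < N" for N
  proof -
    have "expectation (log_Z_bar \<beta> N) \<le> (\<Sum>i\<in>index_set N. (?c N i)\<^sup>2 / 2)"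
      unfolding E using index_set_subset by (intro sum_mono expectation_ln_cosh) auto
    also have "\<dots> = (\<Sum>i\<in>index_set N. (?c N i)\<^sup>2) / 2" by (simp add: sum_divide_distrib)
    also have "\<dots> \<le> real N * (\<beta>\<^sup>2 * xi \<theta> 1) / 2" by (intro divide_right_mono sum_coupling_sq_le N) auto
    finally show ?thesis using N by (simp add: field_simps)
  qed
  have lower: "\<beta>\<^sup>2 * ?q N / 2 - K / real N \<le> expectation (log_Z_bar \<beta> N) / real N" if N: "0 < N" for N
  proof -
    have "real N * (\<beta>\<^sup>2 * ?q N) - \<beta>\<^sup>2 * coeff_sum - \<beta>^4 * coeff_sum * xi \<theta> 1 * fourth_moment
       \<le> (\<Sum>i\<in>index_set N. (?c N i)\<^sup>2) - (\<Sum>i\<in>index_set N. (?c N i)^4) * fourth_moment"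
      using sum_coupling_sq_ge[OF N, where \<beta> = \<beta>] mult_right_mono[OF sum_coupling_fourth_le[where N = N and \<beta> = \<beta>] fourth_moment_nonneg]
      by linarith
    also have "\<dots> = 2 * (\<Sum>i\<in>index_set N. (?c N i)\<^sup>2 / 2 - (?c N i)^4 * fourth_moment / 2)"
      by (simp add: sum_subtractf sum_distrib_left sum_distrib_right right_diff_distrib)
    also have "\<dots> \<le> 2 * expectation (log_Z_bar \<beta> N)"
      unfolding E using index_set_subset by (intro mult_left_mono sum_mono expectation_ln_cosh) auto
    finally have "real N * (\<beta>\<^sup>2 * ?q N) / 2 - K \<le> expectation (log_Z_bar \<beta> N)"
      using X Y unfolding K_def by linarith
    then have "(real N * (\<beta>\<^sup>2 * ?q N) / 2 - K) / real N \<le> expectation (log_Z_bar \<beta> N) / real N"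
      by (intro divide_right_mono) auto
    then show ?thesis using N by (simp add: diff_divide_distrib)
  qed
  have q: "?q \<longlonglongrightarrow> xi \<theta> 1"
  proof -
    have "(\<lambda>n. \<Sum>k<n. (\<theta> (k + 2))\<^sup>2 / fact (k + 2) * 1 ^ (k + 2)) \<longlonglongrightarrow> xi \<theta> 1"
      unfolding xi_def by (rule summable_LIMSEQ[OF summable_xi]) auto
    then have "(\<lambda>n. \<Sum>k<n. (\<theta> (k + 2))\<^sup>2 / fact (k + 2)) \<longlonglongrightarrow> xi \<theta> 1" by simp
    moreover have "filterlim (\<lambda>N. N - 1 :: nat) at_top at_top" by (rule filterlim_minus_const_nat_at_top)
    ultimately show ?thesis unfolding sum_shift_2 by (rule filterlim_compose)
  qed
  show ?thesis
  proof (rule tendsto_sandwich)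
    have "(\<lambda>N. \<beta>\<^sup>2 * ?q N / 2 - K / real N) \<longlonglongrightarrow> \<beta>\<^sup>2 * xi \<theta> 1 / 2 - 0"
      by (intro tendsto_diff tendsto_divide tendsto_mult tendsto_const q lim_const_over_n) auto
    then show "(\<lambda>N. \<beta>\<^sup>2 * ?q N / 2 - K / real N) \<longlonglongrightarrow> \<beta>\<^sup>2 * xi \<theta> 1 / 2" by simp
    show "\<forall>\<^sub>F N in sequentially. \<beta>\<^sup>2 * ?q N / 2 - K / real N \<le> expectation (log_Z_bar \<beta> N) / real N"
      using eventually_gt_at_top[of 0] by (rule eventually_mono) (rule lower)
    show "\<forall>\<^sub>F N in sequentially. expectation (log_Z_bar \<beta> N) / real N \<le> \<beta>\<^sup>2 * xi \<theta> 1 / 2"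
      using eventually_gt_at_top[of 0] by (rule eventually_mono) (rule upper)
  qed (rule tendsto_const)
qed

end

section \<open>Convergence in probability\<close>

text \<open>Paley--Zygmund, with \<open>z \<le> z\<^sup>2 / (4 * s) + s\<close> in place of the Cauchy--Schwarz inequality.\<close>

lemma (in prob_space) prob_less_half_le:
  assumes X: "integrable M X" "integrable M (\<lambda>\<omega>. (X \<omega>)\<^sup>2)"
    and mean: "expectation X = 1" and s: "0 < s" "expectation (\<lambda>\<omega>. (X \<omega>)\<^sup>2) \<le> s"
  shows "prob {\<omega>\<in>space M. X \<omega> < 1/2} \<le> 1 - 1 / (4 * s)"
proof -
  have [measurable]: "random_variable borel X" using X by auto
  define A where "A = {\<omega>\<in>space M. 1/2 \<le> X \<omega>}"
  have A [measurable]: "A \<in> sets M" unfolding A_def by measurable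
  have pt: "X \<omega> \<le> 1/2 + ((X \<omega>)\<^sup>2 / (4 * s) + s * indicator A \<omega>)" if \<omega>: "\<omega> \<in> space M" for \<omega>
  proof (cases "\<omega> \<in> A")
    case True
    have "0 \<le> (X \<omega> - 2 * s)\<^sup>2 / (4 * s)" using s by simp
    also have "\<dots> = (X \<omega>)\<^sup>2 / (4 * s) + s - X \<omega>"
      using s by (simp add: power2_eq_square field_simps)
    finally show ?thesis using True by simp
  next
    case False
    then have "X \<omega> < 1/2" using \<omega> by (auto simp: A_def)
    moreover have "0 \<le> (X \<omega>)\<^sup>2 / (4 * s)" using s by simp
    ultimately show ?thesis using False by simp
  qed
  have int: "integrable M (\<lambda>\<omega>. (X \<omega>)\<^sup>2 / (4 * s))" "integrable M (\<lambda>\<omega>. s * indicator A \<omega> :: real)"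
    using X by (auto intro!: integrable_real_indicator simp: less_top[symmetric])
  have "1 = expectation X" using mean by simp
  also have "\<dots> \<le> expectation (\<lambda>\<omega>. 1/2 + ((X \<omega>)\<^sup>2 / (4 * s) + s * indicator A \<omega>))"
    by (intro integral_mono pt X Bochner_Integration.integrable_add int) auto
  also have "\<dots> = 1/2 + (expectation (\<lambda>\<omega>. (X \<omega>)\<^sup>2) / (4 * s) + s * prob A)"
    using int by (simp add: prob_space)
  also have "expectation (\<lambda>\<omega>. (X \<omega>)\<^sup>2) / (4 * s) \<le> s / (4 * s)" using s by (intro divide_right_mono) auto
  also have "s / (4 * s) = 1/4" using s by simp
  finally have "1 / (4 * s) \<le> prob A" using s by (simp add: field_simps)
  moreover have "{\<omega>\<in>space M. X \<omega> < 1/2} = space M - A" by (auto simp: A_def)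
  ultimately show ?thesis using prob_compl[OF A] by simp
qed

context mixed_p_spin
begin

lemma prob_deviation_le:
  assumes N: "2 \<le> N" and X: "random_variable borel X" "integrable M (\<lambda>\<omega>. (X \<omega>)\<^sup>2)"
    and V: "variance X \<le> real N * v" and e: "0 < e"
  shows "prob {\<omega>\<in>space M. e * real N \<le> \<bar>X \<omega> - expectation X\<bar>} \<le> v / e\<^sup>2 / real N"
proof -
  have "prob {\<omega>\<in>space M. e * real N \<le> \<bar>X \<omega> - expectation X\<bar>} \<le> variance X / (e * real N)\<^sup>2"
    using Chebyshev_inequality[OF X, of "e * real N"] N e by simp
  also have "\<dots> \<le> real N * v / (e * real N)\<^sup>2" using V by (intro divide_right_mono) auto
  also have "\<dots> = v / e\<^sup>2 / real N" using N by (simp add: power2_eq_square)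
  finally show ?thesis .
qed

text \<open>The second moment only makes \<open>Z_hat \<ge> 1/2\<close> an event of probability bounded below. Since the free
  energy concentrates, one typical point in this event already locates its mean.\<close>

lemma expectation_free_energy_near:
  fixes h :: "nat \<Rightarrow> real"
  assumes h: "(\<lambda>N. ln (exp (h N) + exp (- h N))) \<longlonglongrightarrow> ln 2"
    and s: "0 < s" "\<forall>\<^sub>F N in sequentially. expectation (\<lambda>\<omega>. (Z_hat J \<theta> N \<beta> (h N) \<omega>)\<^sup>2) \<le> s"
    and e: "0 < e"
  shows "\<forall>\<^sub>F N in sequentially.
    \<bar>expectation (\<lambda>\<omega>. ln (partition_fun J \<theta> N \<beta> (h N) \<omega>)) / real N - (ln 2 + \<beta>\<^sup>2 * xi \<theta> 1 / 2)\<bar> \<le> 5 * e"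
proof -
  define v where "v = \<beta>\<^sup>2 * xi \<theta> 1"
  let ?p = "\<lambda>N. v / e\<^sup>2 / real N + v / e\<^sup>2 / real N + exp (- e) ^ N + (1 - 1 / (4 * s))"
  have "?p \<longlonglongrightarrow> 0 + 0 + 0 + (1 - 1 / (4 * s))"
    using e by (intro tendsto_add tendsto_const lim_const_over_n LIMSEQ_power_zero) simp
  then have p: "\<forall>\<^sub>F N in sequentially. ?p N < 1"
    by (rule order_tendstoD(2)) (use s in simp)
  have lh: "\<forall>\<^sub>F N in sequentially. \<bar>ln (exp (h N) + exp (- h N)) - ln 2\<bar> < e"
    using tendstoD[OF h e] by (simp add: dist_real_def)
  have lb: "\<forall>\<^sub>F N in sequentially. \<bar>expectation (log_Z_bar \<beta> N) / real N - \<beta>\<^sup>2 * xi \<theta> 1 / 2\<bar> < e"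
    using tendstoD[OF expectation_log_Z_bar e] by (simp add: dist_real_def)
  have l2: "\<forall>\<^sub>F N in sequentially. ln 2 / real N < e"
    by (intro order_tendstoD(2)[OF lim_const_over_n] e)
  show ?thesis
    using p lh lb l2 s(2) eventually_ge_at_top[of 2]
  proof eventually_elim
    case (elim N)
    note N = elim(6)
    let ?Z = "Z_hat J \<theta> N \<beta> (h N)" and ?F = "\<lambda>\<omega>. ln (partition_fun J \<theta> N \<beta> (h N) \<omega>)"
    have Z [measurable]: "random_variable borel ?Z" using expectation_Z_hat(1) by auto
    note F = ln_partition_fun_variance[OF N, of \<beta> "h N", folded v_def]
    note L = log_Z_bar_variance[OF N, of \<beta>, folded v_def]
    note [measurable] = F(1) L(1)
    \<comment> \<open>For large \<open>N\<close> these four exceptional events do not exhaust the space.\<close>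
    define A where "A = {\<omega>\<in>space M. e * real N \<le> \<bar>?F \<omega> - expectation ?F\<bar>}"
    define B where "B = {\<omega>\<in>space M. e * real N \<le> \<bar>log_Z_bar \<beta> N \<omega> - expectation (log_Z_bar \<beta> N)\<bar>}"
    define C where "C = {\<omega>\<in>space M. exp (e * real N) \<le> ?Z \<omega>}"
    define D where "D = {\<omega>\<in>space M. ?Z \<omega> < 1/2}"
    have [measurable]: "A \<in> sets M" "B \<in> sets M" "C \<in> sets M" "D \<in> sets M"
      unfolding A_def B_def C_def D_def by measurable
    have "prob A \<le> v / e\<^sup>2 / real N" unfolding A_def by (rule prob_deviation_le[OF N F e])
    moreover have "prob B \<le> v / e\<^sup>2 / real N" unfolding B_def by (rule prob_deviation_le[OF N L e])
    moreover have "prob C \<le> exp (- e) ^ N"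
    proof -
      have "prob C \<le> expectation ?Z / exp (e * real N)"
        unfolding C_def
        by (rule integral_Markov_inequality_measure[of M ?Z "space M"])
           (use expectation_Z_hat(1) in \<open>auto intro!: AE_I2 less_imp_le Z_hat_pos\<close>)
      also have "\<dots> = exp (- e) ^ N"
        by (simp add: expectation_Z_hat(2) exp_of_nat_mult[symmetric])
           (simp add: exp_minus inverse_eq_divide mult.commute)
      finally show ?thesis .
    qed
    moreover have "prob D \<le> 1 - 1 / (4 * s)"
      unfolding D_def
      by (rule prob_less_half_le[OF expectation_Z_hat(1) second_moment_Z_hat(1) expectation_Z_hat(2) s(1) elim(5)])
    moreover have "prob (A \<union> B \<union> C \<union> D) \<le> prob A + prob B + prob C + prob D"
      using measure_Un_le[of "A \<union> B \<union> C" M D] measure_Un_le[of "A \<union> B" M C]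
        measure_Un_le[of A M B] by simp
    ultimately have "prob (A \<union> B \<union> C \<union> D) < 1" using elim(1) by linarith
    then have "A \<union> B \<union> C \<union> D \<noteq> space M" using prob_space by auto
    moreover have "A \<union> B \<union> C \<union> D \<subseteq> space M" by (auto simp: A_def B_def C_def D_def)
    ultimately obtain \<omega> where \<omega>: "\<omega> \<in> space M" "\<omega> \<notin> A" "\<omega> \<notin> B" "\<omega> \<notin> C" "\<omega> \<notin> D" by blast
    have 1: "\<bar>?F \<omega> - expectation ?F\<bar> < e * real N" using \<omega> by (simp add: A_def)
    have 2: "\<bar>log_Z_bar \<beta> N \<omega> - expectation (log_Z_bar \<beta> N)\<bar> < e * real N" using \<omega> by (simp add: B_def)
    have Z_bounds: "?Z \<omega> < exp (e * real N)" "1/2 \<le> ?Z \<omega>" using \<omega> by (simp_all add: C_def D_def)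
    have 3: "ln (?Z \<omega>) < e * real N"
      using Z_bounds(1) Z_hat_pos[of N \<beta> "h N" \<omega>] by (metis exp_ln exp_less_cancel_iff)
    have "ln (1/2) \<le> ln (?Z \<omega>)" using Z_bounds(2) Z_hat_pos[of N \<beta> "h N" \<omega>] by (subst ln_le_cancel_iff) auto
    moreover have "ln 2 < e * real N" using elim(4) N by (simp add: field_simps)
    ultimately have 4: "- (e * real N) < ln (?Z \<omega>)" by (simp add: ln_div)
    \<comment> \<open>One \<open>e\<close> each for the deviations of \<open>ln Z\<close> and \<open>ln Z_bar\<close> from their means, the size of \<open>ln Z_hat\<close>, the
      field, and the mean of \<open>ln Z_bar\<close>.\<close>
    have "\<bar>expectation ?F - (real N * ln 2 + real N * (\<beta>\<^sup>2 * xi \<theta> 1 / 2))\<bar> \<le> 5 * (e * real N)"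
    proof -
      have "\<bar>real N * ln (exp (h N) + exp (- h N)) - real N * ln 2\<bar> \<le> e * real N"
      proof -
        have "\<bar>real N * ln (exp (h N) + exp (- h N)) - real N * ln 2\<bar>
            = real N * \<bar>ln (exp (h N) + exp (- h N)) - ln 2\<bar>"
          by (simp add: right_diff_distrib[symmetric] abs_mult)
        also have "\<dots> \<le> real N * e" by (rule mult_left_mono) (use elim(2) in auto)
        finally show ?thesis by (simp add: mult.commute)
      qed
      moreover have "\<bar>expectation (log_Z_bar \<beta> N) - real N * (\<beta>\<^sup>2 * xi \<theta> 1 / 2)\<bar> \<le> e * real N"
      proof -
        have "expectation (log_Z_bar \<beta> N) - real N * (\<beta>\<^sup>2 * xi \<theta> 1 / 2)
          = real N * (expectation (log_Z_bar \<beta> N) / real N - \<beta>\<^sup>2 * xi \<theta> 1 / 2)"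
          using N by (simp add: right_diff_distrib)
        then have "\<bar>expectation (log_Z_bar \<beta> N) - real N * (\<beta>\<^sup>2 * xi \<theta> 1 / 2)\<bar>
          = real N * \<bar>expectation (log_Z_bar \<beta> N) / real N - \<beta>\<^sup>2 * xi \<theta> 1 / 2\<bar>"
          by (simp only: abs_mult)
        also have "\<dots> \<le> real N * e" by (rule mult_left_mono) (use elim(3) in auto)
        finally show ?thesis by (simp add: mult.commute)
      qed
      ultimately show ?thesis
        using 1 2 3 4 ln_partition_fun[of N \<beta> "h N" \<omega>] unfolding abs_le_iff abs_less_iff by linarith
    qed
    then have "\<bar>expectation ?F - (real N * ln 2 + real N * (\<beta>\<^sup>2 * xi \<theta> 1 / 2))\<bar> / real N \<le> 5 * (e * real N) / real N"
      by (rule divide_right_mono) simp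
    moreover have "\<bar>expectation ?F - (real N * ln 2 + real N * (\<beta>\<^sup>2 * xi \<theta> 1 / 2))\<bar> / real N
       = \<bar>expectation ?F / real N - (ln 2 + \<beta>\<^sup>2 * xi \<theta> 1 / 2)\<bar>"
    proof -
      have "(expectation ?F - (real N * ln 2 + real N * (\<beta>\<^sup>2 * xi \<theta> 1 / 2))) / real N
          = expectation ?F / real N - (ln 2 + \<beta>\<^sup>2 * xi \<theta> 1 / 2)"
        using N by (simp add: diff_divide_distrib add_divide_distrib)
      moreover have "\<bar>x\<bar> / real N = \<bar>x / real N\<bar>" for x by simp
      ultimately show ?thesis by metis
    qed
    ultimately show ?case using N by simp
  qed
qed

lemma free_energy_tendsto:
  fixes h :: "nat \<Rightarrow> real"
  assumes h: "(\<lambda>N. ln (exp (h N) + exp (- h N))) \<longlonglongrightarrow> ln 2"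
    and s: "0 < s" "\<forall>\<^sub>F N in sequentially. expectation (\<lambda>\<omega>. (Z_hat J \<theta> N \<beta> (h N) \<omega>)\<^sup>2) \<le> s"
  shows "tendsto_in_prob M (\<lambda>N \<omega>. ln (partition_fun J \<theta> N \<beta> (h N) \<omega>) / real N) (ln 2 + \<beta>\<^sup>2 * xi \<theta> 1 / 2)"
  unfolding tendsto_in_prob_def
proof (intro allI impI)
  fix \<epsilon> :: real assume \<epsilon>: "0 < \<epsilon>"
  let ?F = "\<lambda>N \<omega>. ln (partition_fun J \<theta> N \<beta> (h N) \<omega>)" and ?a = "ln 2 + \<beta>\<^sup>2 * xi \<theta> 1 / 2"
  define v where "v = \<beta>\<^sup>2 * xi \<theta> 1"
  have near: "\<forall>\<^sub>F N in sequentially. \<bar>expectation (?F N) / real N - ?a\<bar> \<le> 5 * (\<epsilon> / 10)"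
    by (rule expectation_free_energy_near[OF h s]) (use \<epsilon> in simp)
  show "(\<lambda>N. prob {\<omega>\<in>space M. \<epsilon> < \<bar>?F N \<omega> / real N - ?a\<bar>}) \<longlonglongrightarrow> 0"
  proof (rule tendsto_sandwich[OF _ _ tendsto_const])
    show "(\<lambda>N. v / (\<epsilon> / 2)\<^sup>2 / real N) \<longlonglongrightarrow> 0" by (rule lim_const_over_n)
    show "\<forall>\<^sub>F N in sequentially. prob {\<omega>\<in>space M. \<epsilon> < \<bar>?F N \<omega> / real N - ?a\<bar>} \<le> v / (\<epsilon> / 2)\<^sup>2 / real N"
      using near eventually_ge_at_top[of 2]
    proof eventually_elim
      case (elim N)
      note F = ln_partition_fun_variance[OF elim(2), of \<beta> "h N", folded v_def]
      note [measurable] = F(1)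
      have "prob {\<omega>\<in>space M. \<epsilon> < \<bar>?F N \<omega> / real N - ?a\<bar>}
         \<le> prob {\<omega>\<in>space M. \<epsilon> / 2 * real N \<le> \<bar>?F N \<omega> - expectation (?F N)\<bar>}"
      proof (intro finite_measure_mono subsetI)
        fix \<omega> assume "\<omega> \<in> {\<omega>\<in>space M. \<epsilon> < \<bar>?F N \<omega> / real N - ?a\<bar>}"
        then have \<omega>: "\<omega> \<in> space M" "\<epsilon> < \<bar>?F N \<omega> / real N - ?a\<bar>" by auto
        have "\<epsilon> / 2 \<le> \<bar>?F N \<omega> / real N - expectation (?F N) / real N\<bar>"
          using \<omega>(2) elim(1) by linarith
        also have "\<dots> = \<bar>?F N \<omega> - expectation (?F N)\<bar> / real N"
          by (simp add: diff_divide_distrib[symmetric])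
        finally show "\<omega> \<in> {\<omega>\<in>space M. \<epsilon> / 2 * real N \<le> \<bar>?F N \<omega> - expectation (?F N)\<bar>}"
          using \<omega>(1) elim(2) by (simp add: pos_le_divide_eq)
      qed measurable
      also have "\<dots> \<le> v / (\<epsilon> / 2)\<^sup>2 / real N"
        by (rule prob_deviation_le[OF elim(2) F]) (use \<epsilon> in simp)
      finally show ?case .
    qed
  qed simp
qed

end

text \<open>The exponent \<open>1/4\<close> is the threshold at which \<open>N * h^4\<close> stays bounded.\<close>

lemma ext_field_fourth_le:
  assumes \<alpha>: "1/4 \<le> \<alpha>" and \<rho>: "0 < \<rho>" and N: "0 < N"
  shows "real N * ext_field \<rho> \<alpha> N ^ 4 \<le> \<rho> ^ 4"
proof (cases \<alpha>)
  case (real a)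
  have "(1/4 :: ereal) = ereal (1/4)" by (simp add: ereal_divide one_ereal_def numeral_eq_ereal)
  then have a: "1/4 \<le> a" using \<alpha> real by simp
  have "(real N powr (- a)) ^ 4 = real N powr (- (4 * a))"
    using N by (simp add: powr_power)
  then have "real N * ext_field \<rho> \<alpha> N ^ 4 = \<rho>^4 * (real N powr 1 * real N powr (- (4 * a)))"
    using N real by (simp add: ext_field_def power_mult_distrib)
  also have "real N powr 1 * real N powr (- (4 * a)) = real N powr (1 - 4 * a)"
    by (simp only: powr_add[symmetric]) simp
  also have "\<dots> \<le> real N powr 0" using a N by (intro powr_mono) auto
  also have "\<rho>^4 * real N powr 0 = \<rho>^4" using N by simp
  finally show ?thesis using \<rho> by simp
next
  case PInf
  then show ?thesis using \<rho> by (simp add: ext_field_def)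
next
  case MInf
  then show ?thesis using \<alpha> by simp
qed

lemma ln_two_cosh_tendsto:
  assumes h: "\<And>N. 0 < N \<Longrightarrow> real N * h N ^ 4 \<le> \<rho> ^ 4"
  shows "(\<lambda>N. ln (exp (h N) + exp (- h N))) \<longlonglongrightarrow> ln 2"
proof -
  have eq: "ln (exp (h N) + exp (- h N)) = ln 2 + ln (cosh (h N))" for N
  proof -
    have "exp (h N) + exp (- h N) = 2 * cosh (h N)" by (simp add: cosh_def)
    then show ?thesis using cosh_real_pos[of "h N"] by (simp add: ln_mult)
  qed
  have h4: "(\<lambda>N. h N ^ 4) \<longlonglongrightarrow> 0"
  proof (rule tendsto_sandwich[OF _ _ tendsto_const])
    show "(\<lambda>N. \<rho>^4 / real N) \<longlonglongrightarrow> 0" by (rule lim_const_over_n)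
    show "\<forall>\<^sub>F N in sequentially. h N ^ 4 \<le> \<rho>^4 / real N"
      using eventually_gt_at_top[of 0]
      by (rule eventually_mono) (use h in \<open>simp add: pos_le_divide_eq mult.commute\<close>)
  qed simp
  have "(\<lambda>N. (h N)\<^sup>2) \<longlonglongrightarrow> 0"
  proof -
    have "sqrt (h N ^ 4) = (h N)\<^sup>2" for N by (rule real_sqrt_unique) auto
    then show ?thesis using tendsto_real_sqrt[OF h4] by simp
  qed
  then have "(\<lambda>N. (h N)\<^sup>2 / 2) \<longlonglongrightarrow> 0 / 2" by (rule tendsto_divide) auto
  then have h2: "(\<lambda>N. (h N)\<^sup>2 / 2) \<longlonglongrightarrow> 0" by simp
  have "(\<lambda>N. ln (cosh (h N))) \<longlonglongrightarrow> 0"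
    by (rule tendsto_sandwich[OF _ _ tendsto_const h2]) (use ln_cosh_nonneg ln_cosh_le in \<open>auto intro!: always_eventually\<close>)
  then have "(\<lambda>N. ln 2 + ln (cosh (h N))) \<longlonglongrightarrow> ln 2 + 0" by (intro tendsto_add tendsto_const)
  then show ?thesis unfolding eq by simp
qed

section \<open>The second moment bound and the free energy below \<open>\<beta>\<^sub>f\<close>\<close>

theorem theorem1p4:
  shows "\<exists>C :: real \<Rightarrow> real. (\<forall>b>0. C b > 0) \<and>
    (\<forall>(M :: 'a measure) J \<theta> \<beta> \<rho> (\<alpha> :: ereal).
       mixed_p_spin M J \<theta> \<longrightarrow> 0 < \<beta> \<longrightarrow> \<beta> < beta_f (xi \<theta>) \<longrightarrow> 0 < \<rho> \<longrightarrow> 1/4 \<le> \<alpha> \<longrightarrow>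
         (\<forall>\<^sub>F N in sequentially.
            integral\<^sup>L M (\<lambda>\<omega>. (Z_hat J \<theta> N \<beta> (ext_field \<rho> \<alpha> N) \<omega>)\<^sup>2)
              \<le> C (beta_f (xi \<theta>)) / sqrt ((beta_f (xi \<theta>))\<^sup>2 - \<beta>\<^sup>2)
                  * exp (\<rho>^4 * \<beta>\<^sup>2 / ((beta_f (xi \<theta>))\<^sup>2 - \<beta>\<^sup>2))) \<and>
         tendsto_in_prob M
           (\<lambda>N \<omega>. ln (partition_fun J \<theta> N \<beta> (ext_field \<rho> \<alpha> N) \<omega>) / real N)
           (ln 2 + \<beta>\<^sup>2 * xi \<theta> 1 / 2))"
  \<comment> \<open>Replacing \<open>(\<theta>, \<beta>)\<close> by \<open>(\<theta> / s, s * \<beta>)\<close> changes nothing but multiplies \<open>beta_f\<close> by \<open>s\<close>, hence a constant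
    linear in \<open>beta_f\<close>.\<close>
proof (intro exI[of _ "\<lambda>b. 2 * b"] conjI allI impI)
  fix b :: real assume "0 < b" then show "0 < 2 * b" by simp
next
  fix M :: "'a measure" and J \<theta> and \<beta> \<rho> :: real and \<alpha> :: ereal
  assume "mixed_p_spin M J \<theta>" and \<beta>: "0 < \<beta>" "\<beta> < beta_f (xi \<theta>)" and \<rho>: "0 < \<rho>" and \<alpha>: "1/4 \<le> \<alpha>"
  then interpret mixed_p_spin M J \<theta> by simp
  interpret below_beta_f \<theta> \<beta> by unfold_locales (use \<beta> in auto)
  have below: "below_beta_f \<theta> \<beta>" by unfold_locales
  define b where "b = beta_f (xi \<theta>)"
  define S where "S = 2 * b / sqrt (b\<^sup>2 - \<beta>\<^sup>2) * exp (\<rho>^4 * \<beta>\<^sup>2 / (b\<^sup>2 - \<beta>\<^sup>2))"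
  have b: "0 < b" "0 < b\<^sup>2 - \<beta>\<^sup>2" using \<beta> by (auto simp: b_def power_strict_mono)
  have ratio: "1 - ratio = (b\<^sup>2 - \<beta>\<^sup>2) / b\<^sup>2" using b by (simp add: ratio_def b_def[symmetric] field_simps)
  have "2 / sqrt (1 - ratio) = 2 * b / sqrt (b\<^sup>2 - \<beta>\<^sup>2)"
    unfolding ratio using b by (simp add: real_sqrt_divide)
  moreover have "\<rho>^4 * ratio / (1 - ratio) = \<rho>^4 * \<beta>\<^sup>2 / (b\<^sup>2 - \<beta>\<^sup>2)"
    unfolding ratio using b by (simp add: ratio_def b_def[symmetric])
  ultimately have S: "2 / sqrt (1 - ratio) * exp (\<rho>^4 * ratio / (1 - ratio)) = S"
    unfolding S_def by simp
  have bound: "\<forall>\<^sub>F N in sequentially. expectation (\<lambda>\<omega>. (Z_hat J \<theta> N \<beta> (ext_field \<rho> \<alpha> N) \<omega>)\<^sup>2) \<le> S"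
    using second_moment_bound[OF below \<rho> ext_field_fourth_le[OF \<alpha> \<rho>]] unfolding S .
  then show "\<forall>\<^sub>F N in sequentially. expectation (\<lambda>\<omega>. (Z_hat J \<theta> N \<beta> (ext_field \<rho> \<alpha> N) \<omega>)\<^sup>2)
      \<le> 2 * beta_f (xi \<theta>) / sqrt ((beta_f (xi \<theta>))\<^sup>2 - \<beta>\<^sup>2) * exp (\<rho>^4 * \<beta>\<^sup>2 / ((beta_f (xi \<theta>))\<^sup>2 - \<beta>\<^sup>2))"
    unfolding S_def b_def .
  have "0 < S" using b by (simp add: S_def)
  have field: "(\<lambda>N. ln (exp (ext_field \<rho> \<alpha> N) + exp (- ext_field \<rho> \<alpha> N))) \<longlonglongrightarrow> ln 2"
    by (rule ln_two_cosh_tendsto[of _ \<rho>]) (rule ext_field_fourth_le[OF \<alpha> \<rho>])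
  show "tendsto_in_prob M
           (\<lambda>N \<omega>. ln (partition_fun J \<theta> N \<beta> (ext_field \<rho> \<alpha> N) \<omega>) / real N)
           (ln 2 + \<beta>\<^sup>2 * xi \<theta> 1 / 2)"
    by (rule free_energy_tendsto[OF field \<open>0 < S\<close> bound])
qed

end
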